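(* Let $\mathfrak g$ be a finite-dimensional real Lie algebra, $\mathfrak i\lhd\mathfrak g$ an ideal and $\iota_{\mathfrak i}\colon\mathfrak i\to\mathfrak g$ the inclusion. The natural restriction $$\mathrm{res}_{\wedge\mathfrak i}\colon C^\bullet_\wedge(\mathfrak g;\mathfrak i^*\otimes\mathfrak g/\mathfrak i)\twoheadrightarrow C^\bullet(\mathfrak i;\mathfrak g/\mathfrak i)[1],\qquad C^k_\wedge(\mathfrak g;\mathfrak i^*\otimes\mathfrak g/\mathfrak i)\ni\phi\mapsto(-1)^{k+1}\phi|_{\wedge^{k+1}\mathfrak i},\quad k\ge0,$$ is a cochain map, and $$H^0(\mathrm{res}_{\wedge\mathfrak i})\colon H^0_\wedge(\mathfrak g;\mathfrak i^*\otimes\mathfrak g/\mathfrak i)\to H^1_{\mathrm{def}}(\mathfrak i\subset\mathfrak g)$$ is injective. Furthermore, there is a commutative diagram of short exact sequences of cochain complexes $$\begin{array}{ccccc} C^\bullet(\mathfrak g/\mathfrak i;\mathfrak g/\mathfrak i)[1]&\hookrightarrow&C^\bullet(\mathfrak g;\mathfrak g/\mathfrak i)[1]&\overset{\Pi_\wedge}{\twoheadrightarrow}&C^\bullet_\wedge(\mathfrak g;\mathfrak i^*\otimes\mathfrak g/\mathfrak i)\\ \downarrow&&\parallel&&\downarrow{\scriptstyle\mathrm{res}_{\wedge\mathfrak i}}\\ \mathrm{Ker}^\bullet(\iota_{\mathfrak i}^* )[1]&\hookrightarrow&C^\bullet(\mathfrak g;\mathfrak g/\mathfrak i)[1]&\overset{\iota_{\mathfrak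 i}^*}{\twoheadrightarrow}&C^\bullet(\mathfrak i;\mathfrak g/\mathfrak i)[1] \end{array}$$ in which $\mathrm{Ker}^\bullet(\iota_{\mathfrak i}^* )=\{\phi\colon\wedge^\bullet\mathfrak g\to\mathfrak g/\mathfrak i\mid\phi|_{\wedge^\bullet\mathfrak i}=0\}$, the left vertical map is injective, the right vertical map is surjective, and the top left and the left inclusions are given by the canonical inclusion $\wedge^\bullet(\mathfrak g/\mathfrak i)^*\simeq\wedge^\bullet\mathfrak i^\circ\hookrightarrow\wedge^\bullet\mathfrak g^*$.
   Context: $\pi_{\mathfrak g/\mathfrak i}\colon\mathfrak g\to\mathfrak g/\mathfrak i$, $x\mapsto\bar x$, is the projection; $\mathfrak i^\circ\subseteq\mathfrak g^*$ is the annihilator of $\mathfrak i$; $C^p(\mathfrak h;V)=\wedge^p\mathfrak h^*\otimes V$. All differentials are Chevalley–Eilenberg differentials $\delta\omega(x_1,\dots,x_{p+1})=\sum_i(-1)^{i+1}r(x_i)(\omega(\dots,\widehat{x_i},\dots))+\sum_{i<j}(-1)^{i+j}\omega([x_i,x_j],\dots,\widehat{x_i},\dots,\widehat{x_j},\dots)$ for a representation $r$: • $C^\bullet(\mathfrak g;\mathfrak g/\mathfrak i)$: $\delta_{\pi_{\mathfrak g/\mathfrak i}}$ for $r(x)=[\bar x,\cdot]$ (restricted to $\mathrm{Ker}^\bullet(\iota_{\mathfrak i}^* )$); • $C^\bullet(\mathfrak g/\mathfrak i;\mathfrak g/\mathfrak i)$: for the adjoint representation of $\mathfrak g/\mathfrak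 i$; • $C^\bullet(\mathfrak i;\mathfrak g/\mathfrak i)$: for the Bott representation $u\mapsto\overline{[u,\cdot]}$ of $\mathfrak i$ on $\mathfrak g/\mathfrak i$, which vanishes since $\mathfrak i$ is an ideal; this is the deformation complex of $\mathfrak i$ as a Lie subalgebra, with cohomology $H^\bullet_{\mathrm{def}}(\mathfrak i\subset\mathfrak g)$; • $C^\bullet(\mathfrak g;\mathfrak i^*\otimes\mathfrak g/\mathfrak i)$: $\delta^{\mathrm{Hom}}_{\mathfrak g\rhd\mathfrak i}$ for $\mathrm{ad}^{\mathrm{Hom}}_x(\phi)(u)=[\bar x,\phi(u)]-\phi([x,u])$ on $\mathrm{Hom}(\mathfrak i,\mathfrak g/\mathfrak i)$. Shift convention: $A^\bullet[1]$ carries the differential $-d$ and is truncated to non-negative degrees, i.e. has $A^{k+1}$ in degree $k$ for $k\ge 0$ only. $\Pi\colon C^\bullet(\mathfrak g;\mathfrak g/\mathfrak i)[1]\to C^\bullet(\mathfrak g;\mathfrak i^*\otimes\mathfrak g/\mathfrak i)$ is the cochain map $C^{k+1}(\mathfrak g;\mathfrak g/\mathfrak i)\ni\phi\mapsto(-1)^{k+1}\phi|_{\wedge^k\mathfrak g\wedge\mathfrak i}$, $k\geq 0$, where $\phi|_{\wedge^k\mathfrak g\wedge\mathfrak i}(x_1,\dots,x_k,u)=\phi(x_1,\dots,x_k,u)$. Its image is the subcomplex $C^\bullet_\wedge(\mathfrak g;\mathfrak i^*\otimes\mathfrak g/\mathfrak i)$ (with differential $\delta^{\mathrm{Hom}}_{\mathfrak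 g\rhd\mathfrak i}$), with cohomology $H^\bullet_\wedge(\mathfrak g;\mathfrak i^*\otimes\mathfrak g/\mathfrak i)$, and $\Pi_\wedge$ is $\Pi$ with codomain restricted to its image. $\phi|_{\wedge^{k+1}\mathfrak i}$ is the restriction of all arguments to $\mathfrak i$. $\iota_{\mathfrak i}^*$ is restriction of forms to $\mathfrak i$. *)

theory Defs
  imports
    "Jordan_Normal_Form.VS_Connect"
    "HOL-Algebra.AbelCoset"
begin

section \<open>Real Lie algebras, ideals and quotients\<close>

abbreviation real_ring :: "real ring" where
  "real_ring \<equiv> class_ring"

record 'a lie_alg = "(real, 'a) module" +
  bracket :: "'a \<Rightarrow> 'a \<Rightarrow> 'a"

locale real_lie_algebra = vectorspace "class_ring :: real ring" g for g :: "'a lie_alg" +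
  assumes bracket_left_linear:
      "y \<in> carrier g \<Longrightarrow> (\<lambda>x. bracket g x y) \<in> LinearCombinations.module_hom real_ring g g"
    and bracket_right_linear:
      "x \<in> carrier g \<Longrightarrow> (\<lambda>y. bracket g x y) \<in> LinearCombinations.module_hom real_ring g g"
    and bracket_self: "x \<in> carrier g \<Longrightarrow> bracket g x x = \<zero>\<^bsub>g\<^esub>"
    and jacobi:
      "\<lbrakk>x \<in> carrier g; y \<in> carrier g; z \<in> carrier g\<rbrakk> \<Longrightarrow>
        bracket g x (bracket g y z) \<oplus>\<^bsub>g\<^esub> bracket g y (bracket g z x)
          \<oplus>\<^bsub>g\<^esub> bracket g z (bracket g x y) = \<zero>\<^bsub>g\<^esub>"

definition lie_ideal :: "'a set \<Rightarrow> 'a lie_alg \<Rightarrow> bool" where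
  "lie_ideal I g \<longleftrightarrow>
     VectorSpace.subspace real_ring I g \<and> (\<forall>x\<in>carrier g. \<forall>u\<in>I. bracket g x u \<in> I)"

definition sub_lie :: "'a lie_alg \<Rightarrow> 'a set \<Rightarrow> 'a lie_alg" where
  "sub_lie g I = g\<lparr>carrier := I\<rparr>"

text \<open>
  Quotients consist of cosets. As for the multiplication of HOL-Algebra's factor rings, an
  operation on cosets is the union of the cosets of the results on representatives. The
  multiplicative fields of a module record are never used.
\<close>

definition quot_vs :: "(real, 'a, 'm) module_scheme \<Rightarrow> 'a set \<Rightarrow> (real, 'a set) module" where
  "quot_vs V W = \<lparr>carrier = a_rcosets\<^bsub>V\<^esub> W, mult = undefined, one = undefined,
     zero = W, add = (\<lambda>X Y. X <+>\<^bsub>V\<^esub> Y),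
     smult = (\<lambda>c X. \<Union>x\<in>X. W +>\<^bsub>V\<^esub> (c \<odot>\<^bsub>V\<^esub> x))\<rparr>"

definition quot_lie :: "'a lie_alg \<Rightarrow> 'a set \<Rightarrow> 'a set lie_alg" where
  "quot_lie g I = module.extend (quot_vs g I)
     (lie_alg.fields (\<lambda>X Y. \<Union>x\<in>X. \<Union>y\<in>Y. I +>\<^bsub>g\<^esub> bracket g x y))"

definition quot_proj :: "'a lie_alg \<Rightarrow> 'a set \<Rightarrow> 'a \<Rightarrow> 'a set" where
  "quot_proj g I x = I +>\<^bsub>g\<^esub> x"

definition hom_space ::
  "(real, 'a, 'm) module_scheme \<Rightarrow> (real, 'v, 'n) module_scheme \<Rightarrow> (real, 'a \<Rightarrow> 'v) module" where
  "hom_space U V = \<lparr>carrier = LinearCombinations.module_hom real_ring U V \<inter> extensional (carrier U),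
     mult = undefined, one = undefined,
     zero = (\<lambda>u\<in>carrier U. \<zero>\<^bsub>V\<^esub>),
     add = (\<lambda>\<phi> \<psi>. \<lambda>u\<in>carrier U. \<phi> u \<oplus>\<^bsub>V\<^esub> \<psi> u),
     smult = (\<lambda>c \<phi>. \<lambda>u\<in>carrier U. c \<odot>\<^bsub>V\<^esub> \<phi> u)\<rparr>"


section \<open>Chevalley--Eilenberg cochains\<close>

definition tuples :: "nat \<Rightarrow> (real, 'a, 'm) module_scheme \<Rightarrow> 'a list set" where
  "tuples p h = {xs. length xs = p \<and> set xs \<subseteq> carrier h}"

text \<open>
  An element of \<open>\<And>\<^sup>p h\<^sup>* \<otimes> V\<close> is an alternating \<open>p\<close>-linear map from \<open>h\<close> to \<open>V\<close>; the arguments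
  form a list of length \<open>p\<close>, and the map is \<open>undefined\<close> on all other lists.
\<close>

definition cochain_space ::
  "nat \<Rightarrow> (real, 'a, 'm) module_scheme \<Rightarrow> (real, 'v, 'n) module_scheme
    \<Rightarrow> (real, 'a list \<Rightarrow> 'v) module" where
  "cochain_space p h V = \<lparr>
     carrier = {\<omega> \<in> tuples p h \<rightarrow>\<^sub>E carrier V.
       (\<forall>xs\<in>tuples p h. \<forall>i<p. (\<lambda>x. \<omega> (xs[i := x])) \<in> LinearCombinations.module_hom real_ring h V) \<and>
       (\<forall>xs\<in>tuples p h. \<forall>i j. i < j \<and> j < p \<and> xs ! i = xs ! j \<longrightarrow> \<omega> xs = \<zero>\<^bsub>V\<^esub>)},
     mult = undefined, one = undefined,
     zero = (\<lambda>xs\<in>tuples p h. \<zero>\<^bsub>V\<^esub>),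
     add = (\<lambda>\<phi> \<psi>. \<lambda>xs\<in>tuples p h. \<phi> xs \<oplus>\<^bsub>V\<^esub> \<psi> xs),
     smult = (\<lambda>c \<phi>. \<lambda>xs\<in>tuples p h. c \<odot>\<^bsub>V\<^esub> \<phi> xs)\<rparr>"

definition omit :: "nat \<Rightarrow> 'a list \<Rightarrow> 'a list" where
  "omit i xs = take i xs @ drop (Suc i) xs"

text \<open>Indices start at 0 here, so the sign \<open>(-1)\<^sup>i\<^sup>+\<^sup>1\<close> of the usual formula becomes \<open>(-1)\<^sup>i\<close>.\<close>

definition ce_diff ::
  "'a lie_alg \<Rightarrow> (real, 'v, 'n) module_scheme \<Rightarrow> ('a \<Rightarrow> 'v \<Rightarrow> 'v)
    \<Rightarrow> nat \<Rightarrow> ('a list \<Rightarrow> 'v) \<Rightarrow> 'a list \<Rightarrow> 'v" where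
  "ce_diff h V r p \<omega> = (\<lambda>xs\<in>tuples (Suc p) h.
     (\<Oplus>\<^bsub>V\<^esub>i\<in>{..<Suc p}. (-1) ^ i \<odot>\<^bsub>V\<^esub> r (xs ! i) (\<omega> (omit i xs)))
     \<oplus>\<^bsub>V\<^esub>
     (\<Oplus>\<^bsub>V\<^esub>ij\<in>{(i, j). i < j \<and> j < Suc p}. (case ij of (i, j) \<Rightarrow>
        (-1) ^ (i + j) \<odot>\<^bsub>V\<^esub> \<omega> (bracket h (xs ! i) (xs ! j) # omit i (omit j xs)))))"


section \<open>Cochain complexes\<close>

text \<open>Non-negatively graded complexes only; in particular \<open>shift\<close> below drops degree \<open>-1\<close>.\<close>

record 'c cochain_cx =
  cx_space :: "nat \<Rightarrow> (real, 'c) module"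
  cx_diff :: "nat \<Rightarrow> 'c \<Rightarrow> 'c"

definition cochain_complex :: "'c cochain_cx \<Rightarrow> bool" where
  "cochain_complex A \<longleftrightarrow>
     (\<forall>k. linear_map real_ring (cx_space A k) (cx_space A (Suc k)) (cx_diff A k)) \<and>
     (\<forall>k. \<forall>\<phi>\<in>carrier (cx_space A k).
        cx_diff A (Suc k) (cx_diff A k \<phi>) = \<zero>\<^bsub>cx_space A (Suc (Suc k))\<^esub>)"

definition cochain_map :: "'c cochain_cx \<Rightarrow> 'd cochain_cx \<Rightarrow> (nat \<Rightarrow> 'c \<Rightarrow> 'd) \<Rightarrow> bool" where
  "cochain_map A B f \<longleftrightarrow> cochain_complex A \<and> cochain_complex B \<and>
     (\<forall>k. linear_map real_ring (cx_space A k) (cx_space B k) (f k)) \<and>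
     (\<forall>k. \<forall>\<phi>\<in>carrier (cx_space A k). f (Suc k) (cx_diff A k \<phi>) = cx_diff B k (f k \<phi>))"

definition cx_injective :: "'c cochain_cx \<Rightarrow> (nat \<Rightarrow> 'c \<Rightarrow> 'd) \<Rightarrow> bool" where
  "cx_injective A f \<longleftrightarrow> (\<forall>k. inj_on (f k) (carrier (cx_space A k)))"

definition cx_surjective :: "'c cochain_cx \<Rightarrow> 'd cochain_cx \<Rightarrow> (nat \<Rightarrow> 'c \<Rightarrow> 'd) \<Rightarrow> bool" where
  "cx_surjective A B f \<longleftrightarrow> (\<forall>k. f k ` carrier (cx_space A k) = carrier (cx_space B k))"

definition short_exact ::
  "'c cochain_cx \<Rightarrow> 'd cochain_cx \<Rightarrow> 'e cochain_cx
    \<Rightarrow> (nat \<Rightarrow> 'c \<Rightarrow> 'd) \<Rightarrow> (nat \<Rightarrow> 'd \<Rightarrow> 'e) \<Rightarrow> bool" where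
  "short_exact A B C f h \<longleftrightarrow> cochain_map A B f \<and> cochain_map B C h \<and>
     cx_injective A f \<and> cx_surjective B C h \<and>
     (\<forall>k. f k ` carrier (cx_space A k) = a_kernel (cx_space B k) (cx_space C k) (h k))"

definition shift :: "'c cochain_cx \<Rightarrow> 'c cochain_cx" where
  "shift A = \<lparr>cx_space = (\<lambda>k. cx_space A (Suc k)),
     cx_diff = (\<lambda>k \<phi>. \<ominus>\<^bsub>cx_space A (Suc (Suc k))\<^esub> cx_diff A (Suc k) \<phi>)\<rparr>"

definition sub_cx :: "'c cochain_cx \<Rightarrow> (nat \<Rightarrow> 'c set) \<Rightarrow> 'c cochain_cx" where
  "sub_cx A S = \<lparr>cx_space = (\<lambda>k. (cx_space A k)\<lparr>carrier := S k\<rparr>), cx_diff = cx_diff A\<rparr>"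

definition cocycles :: "'c cochain_cx \<Rightarrow> nat \<Rightarrow> 'c set" where
  "cocycles A k = a_kernel (cx_space A k) (cx_space A (Suc k)) (cx_diff A k)"

fun coboundaries :: "'c cochain_cx \<Rightarrow> nat \<Rightarrow> 'c set" where
  "coboundaries A 0 = {\<zero>\<^bsub>cx_space A 0\<^esub>}"
| "coboundaries A (Suc k) = cx_diff A k ` carrier (cx_space A k)"

definition cohomology :: "'c cochain_cx \<Rightarrow> nat \<Rightarrow> (real, 'c set) module" where
  "cohomology A k = quot_vs ((cx_space A k)\<lparr>carrier := cocycles A k\<rparr>) (coboundaries A k)"

text \<open>If \<open>f\<close> is a cochain map, all members of the union coincide: the class of \<open>z\<close> goes to that of \<open>f k z\<close>.\<close>

definition cohomology_map ::
  "'d cochain_cx \<Rightarrow> (nat \<Rightarrow> 'c \<Rightarrow> 'd) \<Rightarrow> nat \<Rightarrow> 'c set \<Rightarrow> 'd set" where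
  "cohomology_map B f k X = (\<Union>z\<in>X. coboundaries B k +>\<^bsub>cx_space B k\<^esub> f k z)"


section \<open>The complexes of an ideal\<close>

definition ce_cx ::
  "'a lie_alg \<Rightarrow> (real, 'v, 'n) module_scheme \<Rightarrow> ('a \<Rightarrow> 'v \<Rightarrow> 'v)
    \<Rightarrow> ('a list \<Rightarrow> 'v) cochain_cx" where
  "ce_cx h V r = \<lparr>cx_space = (\<lambda>p. cochain_space p h V), cx_diff = ce_diff h V r\<rparr>"

definition bott :: "'a lie_alg \<Rightarrow> 'a set \<Rightarrow> 'a \<Rightarrow> 'a set \<Rightarrow> 'a set" where
  "bott g I u X = (\<Union>x\<in>X. quot_proj g I (bracket g u x))"

definition ad_hom :: "'a lie_alg \<Rightarrow> 'a set \<Rightarrow> 'a \<Rightarrow> ('a \<Rightarrow> 'a set) \<Rightarrow> 'a \<Rightarrow> 'a set" where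
  "ad_hom g I x \<phi> = (\<lambda>u\<in>I.
     bracket (quot_lie g I) (quot_proj g I x) (\<phi> u) \<ominus>\<^bsub>quot_lie g I\<^esub> \<phi> (bracket g x u))"

definition C_alg :: "'a lie_alg \<Rightarrow> 'a set \<Rightarrow> ('a list \<Rightarrow> 'a set) cochain_cx" where
  "C_alg g I = ce_cx g (quot_lie g I) (\<lambda>x. bracket (quot_lie g I) (quot_proj g I x))"

definition C_quot :: "'a lie_alg \<Rightarrow> 'a set \<Rightarrow> ('a set list \<Rightarrow> 'a set) cochain_cx" where
  "C_quot g I = ce_cx (quot_lie g I) (quot_lie g I) (bracket (quot_lie g I))"

definition C_def :: "'a lie_alg \<Rightarrow> 'a set \<Rightarrow> ('a list \<Rightarrow> 'a set) cochain_cx" where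
  "C_def g I = ce_cx (sub_lie g I) (quot_lie g I) (bott g I)"

definition C_hom :: "'a lie_alg \<Rightarrow> 'a set \<Rightarrow> ('a list \<Rightarrow> 'a \<Rightarrow> 'a set) cochain_cx" where
  "C_hom g I = ce_cx g (hom_space (sub_lie g I) (quot_lie g I)) (ad_hom g I)"

definition Pi_map ::
  "'a lie_alg \<Rightarrow> 'a set \<Rightarrow> nat \<Rightarrow> ('a list \<Rightarrow> 'a set) \<Rightarrow> 'a list \<Rightarrow> 'a \<Rightarrow> 'a set" where
  "Pi_map g I k \<phi> = (\<lambda>xs\<in>tuples k g. \<lambda>u\<in>I. (-1) ^ (k + 1) \<odot>\<^bsub>quot_lie g I\<^esub> \<phi> (xs @ [u]))"

definition C_wedge :: "'a lie_alg \<Rightarrow> 'a set \<Rightarrow> ('a list \<Rightarrow> 'a \<Rightarrow> 'a set) cochain_cx" where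
  "C_wedge g I =
     sub_cx (C_hom g I) (\<lambda>k. Pi_map g I k ` carrier (cx_space (shift (C_alg g I)) k))"

definition iota_star ::
  "'a lie_alg \<Rightarrow> 'a set \<Rightarrow> nat \<Rightarrow> ('a list \<Rightarrow> 'a set) \<Rightarrow> 'a list \<Rightarrow> 'a set" where
  "iota_star g I p \<phi> = restrict \<phi> (tuples p (sub_lie g I))"

definition C_ker :: "'a lie_alg \<Rightarrow> 'a set \<Rightarrow> ('a list \<Rightarrow> 'a set) cochain_cx" where
  "C_ker g I = sub_cx (C_alg g I) (\<lambda>p. {\<phi> \<in> carrier (cx_space (C_alg g I) p).
     \<forall>us\<in>tuples p (sub_lie g I). \<phi> us = \<zero>\<^bsub>quot_lie g I\<^esub>})"

text \<open>
  An element of \<open>C_wedge\<close> in degree \<open>k\<close> is a function of \<open>x\<^sub>1, \<dots>, x\<^sub>k\<close> and a last argument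
  from the ideal; all \<open>k + 1\<close> of them are restricted to the ideal.
\<close>

definition res_wedge ::
  "'a lie_alg \<Rightarrow> 'a set \<Rightarrow> nat \<Rightarrow> ('a list \<Rightarrow> 'a \<Rightarrow> 'a set) \<Rightarrow> 'a list \<Rightarrow> 'a set" where
  "res_wedge g I k \<phi> = (\<lambda>us\<in>tuples (Suc k) (sub_lie g I).
     (-1) ^ (k + 1) \<odot>\<^bsub>quot_lie g I\<^esub> \<phi> (butlast us) (last us))"


section \<open>The canonical inclusion\<close>

definition real_line :: "(real, real) module" where
  "real_line = \<lparr>carrier = UNIV, mult = (*), one = 1, zero = 0, add = (+), smult = (*)\<rparr>"

abbreviation dual :: "(real, 'a, 'm) module_scheme \<Rightarrow> (real, 'a \<Rightarrow> real) module" where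
  "dual V \<equiv> hom_space V real_line"

definition annihilator :: "(real, 'a, 'm) module_scheme \<Rightarrow> 'a set \<Rightarrow> ('a \<Rightarrow> real) set" where
  "annihilator V W = {\<alpha> \<in> carrier (dual V). \<forall>u\<in>W. \<alpha> u = 0}"

text \<open>The decomposable element \<open>\<alpha>\<^sub>1 \<and> \<dots> \<and> \<alpha>\<^sub>p \<otimes> v\<close>, without a factor \<open>1/p!\<close>.\<close>

definition wedge ::
  "(real, 'a, 'm) module_scheme \<Rightarrow> (real, 'v, 'n) module_scheme
    \<Rightarrow> ('a \<Rightarrow> real) list \<Rightarrow> 'v \<Rightarrow> 'a list \<Rightarrow> 'v" where
  "wedge h V \<alpha>s v = (\<lambda>xs\<in>tuples (length \<alpha>s) h.
     (\<Sum>\<sigma> | \<sigma> permutes {..<length \<alpha>s}.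
        of_int (sign \<sigma>) * (\<Prod>j<length \<alpha>s. (\<alpha>s ! j) (xs ! \<sigma> j))) \<odot>\<^bsub>V\<^esub> v)"

definition dual_proj :: "'a lie_alg \<Rightarrow> 'a set \<Rightarrow> ('a set \<Rightarrow> real) \<Rightarrow> 'a \<Rightarrow> real" where
  "dual_proj g I \<alpha> = (\<lambda>x\<in>carrier g. \<alpha> (quot_proj g I x))"

text \<open>
  On alternating maps, the inclusion of \<open>\<And>(g/i)\<^sup>*\<close>, identified with \<open>\<And>i\<^sup>\<circ>\<close>, into \<open>\<And>g\<^sup>*\<close>
  is the pullback along the projection.
\<close>

definition canonical_incl ::
  "'a lie_alg \<Rightarrow> 'a set \<Rightarrow> nat \<Rightarrow> ('a set list \<Rightarrow> 'a set) \<Rightarrow> 'a list \<Rightarrow> 'a set" where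
  "canonical_incl g I p \<phi> = (\<lambda>xs\<in>tuples p g. \<phi> (map (quot_proj g I) xs))"

end

theory Submission
  imports Defs
begin

text \<open>
  Everything rests on two ways of restricting the arguments of a cochain \<open>\<phi>\<close> on \<open>g\<close> with values
  in \<open>g/i\<close>: \<open>\<iota>\<^sup>*\<close> restricts all arguments to the ideal, \<open>\<Pi>\<close> only the last one, and \<open>res\<close> restricts
  the remaining ones. Hence \<open>res \<circ> \<Pi> = \<iota>\<^sup>*\<close>; the two signs \<open>(-1)\<^sup>k\<^sup>+\<^sup>1\<close> cancel (\<open>right_square\<close>). As \<open>\<Pi>\<close>
  maps onto \<open>C\<^sub>\<and>\<close> by definition, any such factorisation of a cochain map through a surjective cochain
  map is itself a cochain map (\<open>cochain_map_factor\<close>), and \<open>res\<close> is surjective because \<open>\<iota>\<^sup>*\<close> is: a cochain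
  on \<open>i\<close> extends to \<open>g\<close> by composition with a linear projection of \<open>g\<close> onto \<open>i\<close>
  (\<open>iota_star_surjective\<close>).
  
  The top row is exact since a cochain that vanishes when its last argument lies in \<open>i\<close> vanishes, by
  alternation, when any argument does, hence depends only on the classes of its arguments in \<open>g/i\<close>.
  It is then the pullback along the projection of its own pullback along a linear section
  (\<open>Pi_map_kernel\<close>). The bottom row is the kernel sequence of the surjection \<open>\<iota>\<^sup>*\<close>. In degree zero
  a cochain of \<open>C\<^sub>\<and>\<close> is a linear map from \<open>i\<close> to \<open>g/i\<close> and \<open>res\<close> merely changes its sign, while there are no
  nonzero coboundaries on either side, the Bott representation being zero; this gives injectivity on
  \<open>H\<^sup>0\<close> (\<open>res_wedge_0_inj\<close>, \<open>shift_cohomology_0\<close>).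
  
  What remains is that all differentials square to zero and commute with these maps. Written as
  sums over positions and pairs of positions this is laborious, so the Chevalley--Eilenberg
  differential is recast through Cartan's formula \<open>\<iota>\<^sub>x d = L\<^sub>x - d \<iota>\<^sub>x\<close>. When the arguments form a list,
  \<open>\<iota>\<^sub>x\<close> puts \<open>x\<close> in front of it, and the formula becomes a recursion over the list that contains no
  sums (\<open>lie_deriv\<close>, \<open>cartan_diff\<close>). Closedness, linearity, \<open>[L\<^sub>x, L\<^sub>y] = L\<close> of the bracket,
  \<open>L\<^sub>x d = d L\<^sub>x\<close>, \<open>d d = 0\<close> and the compatibility with pullbacks and with the restriction of the last
  argument are then inductions over the list; \<open>D_eq_sum\<close> identifies the recursion with the usual
  formula on multilinear alternating functions.
\<close>

section \<open>Linear maps and spaces of functions\<close>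

abbreviation lin ::
  "(real, 'a, 'm) module_scheme \<Rightarrow> (real, 'b, 'n) module_scheme \<Rightarrow> ('a \<Rightarrow> 'b) set" where
  "lin U V \<equiv> LinearCombinations.module_hom real_ring U V"

abbreviation lin_subspace :: "'a set \<Rightarrow> (real, 'a, 'm) module_scheme \<Rightarrow> bool" where
  "lin_subspace W V \<equiv> VectorSpace.subspace real_ring W V"

abbreviation real_vs :: "(real, 'a, 'm) module_scheme \<Rightarrow> bool" where
  "real_vs V \<equiv> vectorspace real_ring V"

lemma linI:
  assumes "\<And>x. x \<in> carrier U \<Longrightarrow> f x \<in> carrier V"
    and "\<And>x y. x \<in> carrier U \<Longrightarrow> y \<in> carrier U \<Longrightarrow> f (x \<oplus>\<^bsub>U\<^esub> y) = f x \<oplus>\<^bsub>V\<^esub> f y"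
    and "\<And>c x. x \<in> carrier U \<Longrightarrow> f (c \<odot>\<^bsub>U\<^esub> x) = c \<odot>\<^bsub>V\<^esub> f x"
  shows "f \<in> lin U V"
  using assms by (auto simp: LinearCombinations.module_hom_def)

lemma lin_closed: "f \<in> lin U V \<Longrightarrow> x \<in> carrier U \<Longrightarrow> f x \<in> carrier V"
  and lin_add: "f \<in> lin U V \<Longrightarrow> x \<in> carrier U \<Longrightarrow> y \<in> carrier U \<Longrightarrow> f (x \<oplus>\<^bsub>U\<^esub> y) = f x \<oplus>\<^bsub>V\<^esub> f y"
  and lin_smult: "f \<in> lin U V \<Longrightarrow> x \<in> carrier U \<Longrightarrow> f (c \<odot>\<^bsub>U\<^esub> x) = c \<odot>\<^bsub>V\<^esub> f x"
  by (auto simp: LinearCombinations.module_hom_def)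

lemma real_vs_facts:
  assumes "real_vs V"
  shows real_vs_abelian: "abelian_group V"
    and real_vs_module: "module real_ring V"
    and real_vs_add_closed: "\<And>x y. x \<in> carrier V \<Longrightarrow> y \<in> carrier V \<Longrightarrow> x \<oplus>\<^bsub>V\<^esub> y \<in> carrier V"
    and real_vs_zero_closed: "\<zero>\<^bsub>V\<^esub> \<in> carrier V"
    and real_vs_neg_closed: "\<And>x. x \<in> carrier V \<Longrightarrow> \<ominus>\<^bsub>V\<^esub> x \<in> carrier V"
    and real_vs_smult_closed: "\<And>c x. x \<in> carrier V \<Longrightarrow> c \<odot>\<^bsub>V\<^esub> x \<in> carrier V"
    and real_vs_smult_assoc: "\<And>b c x. x \<in> carrier V \<Longrightarrow> b \<odot>\<^bsub>V\<^esub> (c \<odot>\<^bsub>V\<^esub> x) = (b * c) \<odot>\<^bsub>V\<^esub> x"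
    and real_vs_one: "\<And>x. x \<in> carrier V \<Longrightarrow> 1 \<odot>\<^bsub>V\<^esub> x = x"
    and real_vs_neg_eq: "\<And>x. x \<in> carrier V \<Longrightarrow> (- 1) \<odot>\<^bsub>V\<^esub> x = \<ominus>\<^bsub>V\<^esub> x"
    and real_vs_smult_neg: "\<And>c x. x \<in> carrier V \<Longrightarrow> (- c) \<odot>\<^bsub>V\<^esub> x = \<ominus>\<^bsub>V\<^esub> (c \<odot>\<^bsub>V\<^esub> x)"
    and real_vs_smult_add: "\<And>c x y. x \<in> carrier V \<Longrightarrow> y \<in> carrier V \<Longrightarrow>
        c \<odot>\<^bsub>V\<^esub> (x \<oplus>\<^bsub>V\<^esub> y) = c \<odot>\<^bsub>V\<^esub> x \<oplus>\<^bsub>V\<^esub> c \<odot>\<^bsub>V\<^esub> y"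
    and real_vs_add_smult: "\<And>b c x. x \<in> carrier V \<Longrightarrow> (b + c) \<odot>\<^bsub>V\<^esub> x = b \<odot>\<^bsub>V\<^esub> x \<oplus>\<^bsub>V\<^esub> c \<odot>\<^bsub>V\<^esub> x"
    and real_vs_smult_zero: "\<And>c. c \<odot>\<^bsub>V\<^esub> \<zero>\<^bsub>V\<^esub> = \<zero>\<^bsub>V\<^esub>"
    and real_vs_zero_smult: "\<And>x. x \<in> carrier V \<Longrightarrow> 0 \<odot>\<^bsub>V\<^esub> x = \<zero>\<^bsub>V\<^esub>"
proof -
  interpret vectorspace real_ring V by fact
  show "abelian_group V" "module real_ring V" ..
  show "\<And>x y. x \<in> carrier V \<Longrightarrow> y \<in> carrier V \<Longrightarrow> x \<oplus>\<^bsub>V\<^esub> y \<in> carrier V" "\<zero>\<^bsub>V\<^esub> \<in> carrier V"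
    "\<And>x. x \<in> carrier V \<Longrightarrow> \<ominus>\<^bsub>V\<^esub> x \<in> carrier V" by auto
  show "c \<odot>\<^bsub>V\<^esub> x \<in> carrier V" if "x \<in> carrier V" for c x using that by simp
  show "b \<odot>\<^bsub>V\<^esub> (c \<odot>\<^bsub>V\<^esub> x) = (b * c) \<odot>\<^bsub>V\<^esub> x" if "x \<in> carrier V" for b c x
    using smult_assoc1[of b c x] that by simp
  show "1 \<odot>\<^bsub>V\<^esub> x = x" if "x \<in> carrier V" for x using smult_one[of x] that by simp
  show neg: "(- c) \<odot>\<^bsub>V\<^esub> x = \<ominus>\<^bsub>V\<^esub> (c \<odot>\<^bsub>V\<^esub> x)" if "x \<in> carrier V" for c x
    using smult_l_minus[of c x] that by (simp add: class_ring_simps)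
  show "(- 1) \<odot>\<^bsub>V\<^esub> x = \<ominus>\<^bsub>V\<^esub> x" if "x \<in> carrier V" for x
    using smult_one[of x] neg[of x 1] that by simp
  show "c \<odot>\<^bsub>V\<^esub> (x \<oplus>\<^bsub>V\<^esub> y) = c \<odot>\<^bsub>V\<^esub> x \<oplus>\<^bsub>V\<^esub> c \<odot>\<^bsub>V\<^esub> y" if "x \<in> carrier V" "y \<in> carrier V" for c x y
    using smult_r_distr[of c x y] that by simp
  show "(b + c) \<odot>\<^bsub>V\<^esub> x = b \<odot>\<^bsub>V\<^esub> x \<oplus>\<^bsub>V\<^esub> c \<odot>\<^bsub>V\<^esub> x" if "x \<in> carrier V" for b c x
    using smult_l_distr[of b c x] that by simp
  show "c \<odot>\<^bsub>V\<^esub> \<zero>\<^bsub>V\<^esub> = \<zero>\<^bsub>V\<^esub>" for c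
    using smult_r_null[of c] by simp
  show "0 \<odot>\<^bsub>V\<^esub> x = \<zero>\<^bsub>V\<^esub>" if "x \<in> carrier V" for x
    using smult_l_null[of x] that by simp
qed

lemma real_vs_neg_zero: "real_vs V \<Longrightarrow> \<ominus>\<^bsub>V\<^esub> \<zero>\<^bsub>V\<^esub> = \<zero>\<^bsub>V\<^esub>"
  using real_vs_neg_eq real_vs_smult_zero real_vs_zero_closed by metis

lemma real_vs_minus_self: "real_vs V \<Longrightarrow> x \<in> carrier V \<Longrightarrow> x \<ominus>\<^bsub>V\<^esub> x = \<zero>\<^bsub>V\<^esub>"
  by (simp add: a_minus_def abelian_group.r_neg real_vs_abelian)

lemma lin_zero: "real_vs U \<Longrightarrow> real_vs V \<Longrightarrow> f \<in> lin U V \<Longrightarrow> f \<zero>\<^bsub>U\<^esub> = \<zero>\<^bsub>V\<^esub>"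
  by (metis lin_closed lin_smult real_vs_zero_smult real_vs_zero_closed)

lemma lin_neg: "real_vs U \<Longrightarrow> real_vs V \<Longrightarrow> f \<in> lin U V \<Longrightarrow> x \<in> carrier U \<Longrightarrow> f (\<ominus>\<^bsub>U\<^esub> x) = \<ominus>\<^bsub>V\<^esub> f x"
  by (metis lin_closed lin_smult real_vs_neg_eq)

lemma lin_minus:
  "real_vs U \<Longrightarrow> real_vs V \<Longrightarrow> f \<in> lin U V \<Longrightarrow> x \<in> carrier U \<Longrightarrow> y \<in> carrier U \<Longrightarrow>
    f (x \<ominus>\<^bsub>U\<^esub> y) = f x \<ominus>\<^bsub>V\<^esub> f y"
  by (simp add: a_minus_def lin_neg lin_add real_vs_neg_closed)

lemma lin_cong:
  assumes "real_vs U" "\<And>x. x \<in> carrier U \<Longrightarrow> f x = g x"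
  shows "f \<in> lin U V \<longleftrightarrow> g \<in> lin U V"
  using assms real_vs_add_closed[OF assms(1)] real_vs_smult_closed[OF assms(1)]
  unfolding LinearCombinations.module_hom_def by (auto simp: Pi_iff)

lemma lin_compose: "f \<in> lin U V \<Longrightarrow> g \<in> lin V W \<Longrightarrow> (\<lambda>x. g (f x)) \<in> lin U W"
  by (intro linI) (simp_all add: lin_closed lin_add lin_smult)

text \<open>
  Rewriting modulo associativity and commutativity does not bring \<open>x\<close> and \<open>\<ominus> x\<close> next to each other
  in long sums; these two rules rearrange and cancel differences of differences instead.
\<close>

lemma (in abelian_group) minus_minus_swap:
  assumes "a \<in> carrier G" "b \<in> carrier G" "c \<in> carrier G" "d \<in> carrier G"
  shows "(a \<ominus> b) \<ominus> (c \<ominus> d) = (a \<ominus> c) \<ominus> (b \<ominus> d)"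
  using assms by (simp add: a_minus_def minus_add a_ac)

lemma (in abelian_group) minus_minus_cancel:
  assumes "a \<in> carrier G" "b \<in> carrier G" "c \<in> carrier G"
  shows "(a \<ominus> c) \<ominus> (b \<ominus> c) = a \<ominus> b"
  using assms by (subst minus_minus_swap) (simp_all add: a_minus_def r_neg)

lemma lin_const_zero: "real_vs V \<Longrightarrow> (\<lambda>x. \<zero>\<^bsub>V\<^esub>) \<in> lin U V"
  by (intro linI) (simp_all add: real_vs_facts abelian_group.axioms abelian_monoid.l_zero)

lemma lin_diff:
  assumes "real_vs V" "f \<in> lin U V" "g \<in> lin U V"
  shows "(\<lambda>x. f x \<ominus>\<^bsub>V\<^esub> g x) \<in> lin U V"
proof (rule linI)
  interpret vectorspace real_ring V by fact
  fix x y c assume x: "x \<in> carrier U"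
  show "f x \<ominus>\<^bsub>V\<^esub> g x \<in> carrier V" using x assms by (simp add: lin_closed)
  show "f (c \<odot>\<^bsub>U\<^esub> x) \<ominus>\<^bsub>V\<^esub> g (c \<odot>\<^bsub>U\<^esub> x) = c \<odot>\<^bsub>V\<^esub> (f x \<ominus>\<^bsub>V\<^esub> g x)"
    using x assms lin_closed[OF assms(2) x] lin_closed[OF assms(3) x]
    by (simp add: lin_smult a_minus_def smult_r_distr smult_r_minus)
  assume y: "y \<in> carrier U"
  show "f (x \<oplus>\<^bsub>U\<^esub> y) \<ominus>\<^bsub>V\<^esub> g (x \<oplus>\<^bsub>U\<^esub> y) = f x \<ominus>\<^bsub>V\<^esub> g x \<oplus>\<^bsub>V\<^esub> (f y \<ominus>\<^bsub>V\<^esub> g y)"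
    using lin_closed[OF assms(2) x] lin_closed[OF assms(3) x] lin_closed[OF assms(2) y] lin_closed[OF assms(3) y]
    by (simp add: lin_add[OF assms(2) x y] lin_add[OF assms(3) x y] a_minus_def M.minus_add M.a_ac)
qed

lemma real_vs_eq_if_minus_zero:
  assumes "real_vs V" "x \<in> carrier V" "y \<in> carrier V" "x \<ominus>\<^bsub>V\<^esub> y = \<zero>\<^bsub>V\<^esub>"
  shows "x = y"
proof -
  interpret V: vectorspace real_ring V by fact
  show ?thesis using assms(2-4) by (metis a_minus_def V.M.a_inv_closed V.M.minus_equality V.M.minus_minus)
qed

lemma lin_smult_left:
  assumes "real_vs V" "f \<in> lin U V"
  shows "(\<lambda>x. c \<odot>\<^bsub>V\<^esub> f x) \<in> lin U V"
  by (rule linI) (use assms(1) lin_closed[OF assms(2)] in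
      \<open>auto simp: lin_add[OF assms(2)] lin_smult[OF assms(2)] real_vs_smult_closed
        real_vs_smult_assoc mult.commute real_vs_smult_add\<close>)

lemma lin_plus:
  assumes "real_vs V" "f \<in> lin U V" "g \<in> lin U V"
  shows "(\<lambda>x. f x \<oplus>\<^bsub>V\<^esub> g x) \<in> lin U V"
proof -
  interpret V: vectorspace real_ring V by fact
  show ?thesis
    by (rule linI) (use lin_closed[OF assms(2)] lin_closed[OF assms(3)] in
      \<open>auto simp: lin_add[OF assms(2)] lin_add[OF assms(3)] lin_smult[OF assms(2)] lin_smult[OF assms(3)]
        V.M.a_ac real_vs_smult_add[OF assms(1)]\<close>)
qed

lemma linear_mapI: "real_vs U \<Longrightarrow> real_vs W \<Longrightarrow> f \<in> lin U W \<Longrightarrow> linear_map real_ring U W f"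
  by (simp add: linear_map_def mod_hom_def mod_hom_axioms_def real_vs_module)

text \<open>
  Spaces of linear maps and of cochains carry the same pointwise operations on functions that are
  undefined outside a fixed set; only the closure properties differ.
\<close>

lemma pointwise_vectorspace:
  fixes V :: "(real, 'v, 'n) module_scheme" and M :: "(real, 's \<Rightarrow> 'v) module"
  assumes V: "real_vs V" and sub: "carrier M \<subseteq> S \<rightarrow>\<^sub>E carrier V"
    and zero: "\<zero>\<^bsub>M\<^esub> = (\<lambda>s\<in>S. \<zero>\<^bsub>V\<^esub>)"
    and add: "\<And>f g. f \<oplus>\<^bsub>M\<^esub> g = (\<lambda>s\<in>S. f s \<oplus>\<^bsub>V\<^esub> g s)"
    and smult: "\<And>c f. c \<odot>\<^bsub>M\<^esub> f = (\<lambda>s\<in>S. c \<odot>\<^bsub>V\<^esub> f s)"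
    and zero_closed: "\<zero>\<^bsub>M\<^esub> \<in> carrier M"
    and add_closed: "\<And>f g. f \<in> carrier M \<Longrightarrow> g \<in> carrier M \<Longrightarrow> f \<oplus>\<^bsub>M\<^esub> g \<in> carrier M"
    and smult_closed: "\<And>c f. f \<in> carrier M \<Longrightarrow> c \<odot>\<^bsub>M\<^esub> f \<in> carrier M"
  shows "real_vs M"
    and "\<And>f g. f \<in> carrier M \<Longrightarrow> g \<in> carrier M \<Longrightarrow> f \<ominus>\<^bsub>M\<^esub> g = (\<lambda>s\<in>S. f s \<ominus>\<^bsub>V\<^esub> g s)"
proof -
  interpret V: vectorspace real_ring V by fact
  have mem: "f s \<in> carrier V" if "f \<in> carrier M" "s \<in> S" for f s using that sub by auto
  have eqI: "f = g" if "f \<in> carrier M" "g \<in> carrier M" "\<And>s. s \<in> S \<Longrightarrow> f s = g s" for f g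
    using that sub by (meson PiE_ext subsetD)
  have neg: "\<exists>n\<in>carrier M. f \<oplus>\<^bsub>M\<^esub> n = \<zero>\<^bsub>M\<^esub>" if f: "f \<in> carrier M" for f
  proof
    show "(-1) \<odot>\<^bsub>M\<^esub> f \<in> carrier M" using smult_closed f by simp
    show "f \<oplus>\<^bsub>M\<^esub> (-1) \<odot>\<^bsub>M\<^esub> f = \<zero>\<^bsub>M\<^esub>"
      unfolding add smult zero using mem[OF f] V by (auto simp: real_vs_neg_eq V.M.r_neg intro!: restrict_ext)
  qed
  show vs: "real_vs M"
  proof (rule vs_criteria)
    show "field real_ring" by (rule class_field)
    show "\<zero>\<^bsub>M\<^esub> \<in> carrier M" by fact
    show "\<forall>v w. v \<in> carrier M \<and> w \<in> carrier M \<longrightarrow> v \<oplus>\<^bsub>M\<^esub> w \<in> carrier M" using add_closed by auto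
    show "\<forall>v\<in>carrier M. \<exists>neg_v\<in>carrier M. v \<oplus>\<^bsub>M\<^esub> neg_v = \<zero>\<^bsub>M\<^esub>" using neg by auto
    show "\<forall>c v. c \<in> carrier real_ring \<and> v \<in> carrier M \<longrightarrow> c \<odot>\<^bsub>M\<^esub> v \<in> carrier M"
      using smult_closed by auto
    show "\<forall>v w. v \<in> carrier M \<and> w \<in> carrier M \<longrightarrow> v \<oplus>\<^bsub>M\<^esub> w = w \<oplus>\<^bsub>M\<^esub> v"
      unfolding add using mem by (auto simp: V.M.a_comm intro!: restrict_ext)
    show "\<forall>v w x. v \<in> carrier M \<and> w \<in> carrier M \<and> x \<in> carrier M \<longrightarrow> v \<oplus>\<^bsub>M\<^esub> w \<oplus>\<^bsub>M\<^esub> x = v \<oplus>\<^bsub>M\<^esub> (w \<oplus>\<^bsub>M\<^esub> x)"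
      unfolding add using mem by (auto simp: V.M.a_assoc intro!: restrict_ext)
    show "\<forall>v\<in>carrier M. v \<oplus>\<^bsub>M\<^esub> \<zero>\<^bsub>M\<^esub> = v"
    proof
      fix v assume v: "v \<in> carrier M"
      show "v \<oplus>\<^bsub>M\<^esub> \<zero>\<^bsub>M\<^esub> = v"
        by (rule eqI[OF add_closed[OF v zero_closed] v]) (simp add: add zero mem[OF v])
    qed
    show "\<forall>a b v. a \<in> carrier real_ring \<and> b \<in> carrier real_ring \<and> v \<in> carrier M \<longrightarrow>
       a \<otimes>\<^bsub>real_ring\<^esub> b \<odot>\<^bsub>M\<^esub> v = a \<odot>\<^bsub>M\<^esub> (b \<odot>\<^bsub>M\<^esub> v)"
      unfolding smult using mem V by (auto simp: real_vs_smult_assoc intro!: restrict_ext)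
    show "\<forall>v\<in>carrier M. \<one>\<^bsub>real_ring\<^esub> \<odot>\<^bsub>M\<^esub> v = v"
    proof
      fix v assume v: "v \<in> carrier M"
      show "\<one>\<^bsub>real_ring\<^esub> \<odot>\<^bsub>M\<^esub> v = v"
        by (rule eqI[OF smult_closed[OF v] v]) (simp add: smult mem[OF v] real_vs_one[OF V])
    qed
    show "\<forall>a b v. a \<in> carrier real_ring \<and> b \<in> carrier real_ring \<and> v \<in> carrier M \<longrightarrow>
       (a \<oplus>\<^bsub>real_ring\<^esub> b) \<odot>\<^bsub>M\<^esub> v = a \<odot>\<^bsub>M\<^esub> v \<oplus>\<^bsub>M\<^esub> b \<odot>\<^bsub>M\<^esub> v"
      unfolding smult add using mem V by (auto simp: real_vs_add_smult intro!: restrict_ext)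
    show "\<forall>a v w. a \<in> carrier real_ring \<and> v \<in> carrier M \<and> w \<in> carrier M \<longrightarrow>
       a \<odot>\<^bsub>M\<^esub> (v \<oplus>\<^bsub>M\<^esub> w) = a \<odot>\<^bsub>M\<^esub> v \<oplus>\<^bsub>M\<^esub> a \<odot>\<^bsub>M\<^esub> w"
      unfolding smult add using mem V by (auto simp: real_vs_smult_add intro!: restrict_ext)
  qed
  have neg: "\<ominus>\<^bsub>M\<^esub> f = (\<lambda>s\<in>S. \<ominus>\<^bsub>V\<^esub> f s)" if f: "f \<in> carrier M" for f
    unfolding real_vs_neg_eq[OF vs f, symmetric] smult using mem[OF f] V
    by (auto simp: real_vs_neg_eq intro!: restrict_ext)
  show "f \<ominus>\<^bsub>M\<^esub> g = (\<lambda>s\<in>S. f s \<ominus>\<^bsub>V\<^esub> g s)" if "f \<in> carrier M" "g \<in> carrier M" for f g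
    unfolding a_minus_def add neg[OF that(2)] by (auto intro!: restrict_ext)
qed

section \<open>Subspaces, quotients and complements\<close>

lemma subspaceI:
  assumes "real_vs V" "W \<subseteq> carrier V" "\<zero>\<^bsub>V\<^esub> \<in> W"
    and "\<And>x y. x \<in> W \<Longrightarrow> y \<in> W \<Longrightarrow> x \<oplus>\<^bsub>V\<^esub> y \<in> W" "\<And>c x. x \<in> W \<Longrightarrow> c \<odot>\<^bsub>V\<^esub> x \<in> W"
  shows "lin_subspace W V"
  using assms
  by (intro VectorSpace.subspace.intro LinearCombinations.submodule.intro) (simp_all add: real_vs_module)

lemma subspaceD:
  assumes "lin_subspace W V"
  shows "real_vs V" "W \<subseteq> carrier V" "\<zero>\<^bsub>V\<^esub> \<in> W"
    and "\<And>x y. x \<in> W \<Longrightarrow> y \<in> W \<Longrightarrow> x \<oplus>\<^bsub>V\<^esub> y \<in> W" "\<And>c x. x \<in> W \<Longrightarrow> c \<odot>\<^bsub>V\<^esub> x \<in> W"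
  using assms by (auto simp: VectorSpace.subspace_def LinearCombinations.submodule_def)

lemma subspace_neg:
  "lin_subspace W V \<Longrightarrow> x \<in> W \<Longrightarrow> \<ominus>\<^bsub>V\<^esub> x \<in> W"
  using subspaceD(2,5) real_vs_neg_eq[OF subspaceD(1)] by (metis subsetD)

lemma subspace_minus:
  "lin_subspace W V \<Longrightarrow> x \<in> W \<Longrightarrow> y \<in> W \<Longrightarrow> x \<ominus>\<^bsub>V\<^esub> y \<in> W"
  by (simp add: a_minus_def subspaceD(4) subspace_neg)

lemma subspace_real_vs: "lin_subspace W V \<Longrightarrow> real_vs (V\<lparr>carrier := W\<rparr>)"
  using vectorspace.subspace_is_vs[OF subspaceD(1)] by blast

lemma subspace_neg_eq:
  assumes "lin_subspace W V" "x \<in> W"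
  shows "\<ominus>\<^bsub>V\<lparr>carrier := W\<rparr>\<^esub> x = \<ominus>\<^bsub>V\<^esub> x"
  using real_vs_neg_eq[OF subspace_real_vs[OF assms(1)], of x] real_vs_neg_eq[OF subspaceD(1)[OF assms(1)], of x]
    subspaceD(2)[OF assms(1)] assms(2) by auto

text \<open>
  A quotient space and a quotient Lie algebra are records of different types with the same
  underlying operations; transporting the axioms along the projection serves both.
\<close>

lemma real_vs_image:
  assumes V: "real_vs V" and car: "carrier Q = p ` carrier V"
    and add: "\<And>x y. x \<in> carrier V \<Longrightarrow> y \<in> carrier V \<Longrightarrow> p x \<oplus>\<^bsub>Q\<^esub> p y = p (x \<oplus>\<^bsub>V\<^esub> y)"
    and smult: "\<And>c x. x \<in> carrier V \<Longrightarrow> c \<odot>\<^bsub>Q\<^esub> p x = p (c \<odot>\<^bsub>V\<^esub> x)"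
    and zero: "\<zero>\<^bsub>Q\<^esub> = p \<zero>\<^bsub>V\<^esub>"
  shows "real_vs Q" and "p \<in> lin V Q"
proof -
  interpret V: vectorspace real_ring V by fact
  show "real_vs Q"
  proof (rule vs_criteria)
    show "field real_ring" by (rule class_field)
    show "\<forall>v\<in>carrier Q. \<exists>neg_v\<in>carrier Q. v \<oplus>\<^bsub>Q\<^esub> neg_v = \<zero>\<^bsub>Q\<^esub>"
    proof
      fix v assume "v \<in> carrier Q"
      then obtain x where "x \<in> carrier V" "v = p x" using car by auto
      then show "\<exists>neg_v\<in>carrier Q. v \<oplus>\<^bsub>Q\<^esub> neg_v = \<zero>\<^bsub>Q\<^esub>"
        using car add zero by (intro bexI[of _ "p (\<ominus>\<^bsub>V\<^esub> x)"]) (auto simp: V.M.r_neg)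
    qed
  qed (auto simp: car zero add smult V.M.a_ac real_vs_smult_assoc[OF V] real_vs_one[OF V]
        real_vs_smult_add[OF V] real_vs_add_smult[OF V] real_vs_smult_closed[OF V] imp_conjL[symmetric])
  show "p \<in> lin V Q" by (rule linI) (simp_all add: car add smult)
qed

locale quotient_space =
  fixes V :: "(real, 'a, 'm) module_scheme" (structure) and W :: "'a set"
  assumes W: "lin_subspace W V"
begin

lemma real_vs_V: "real_vs V" by (rule subspaceD(1)[OF W])

sublocale V: vectorspace real_ring V by (rule real_vs_V)

abbreviation cls where "cls x \<equiv> W +> x"

lemma cls_eq: "cls x = {w \<oplus> x | w. w \<in> W}"
  by (auto simp: a_r_coset_def')

lemma W_carrier: "w \<in> W \<Longrightarrow> w \<in> carrier V" using subspaceD(2)[OF W] by auto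

lemma mem_cls:
  assumes "x \<in> carrier V"
  shows "y \<in> cls x \<longleftrightarrow> y \<in> carrier V \<and> y \<ominus> x \<in> W"
proof
  assume "y \<in> cls x"
  then obtain w where w: "w \<in> W" "y = w \<oplus> x" by (auto simp: cls_eq)
  then show "y \<in> carrier V \<and> y \<ominus> x \<in> W"
    using assms W_carrier[OF w(1)] by (simp add: a_minus_def V.M.a_assoc V.M.r_neg)
next
  assume y: "y \<in> carrier V \<and> y \<ominus> x \<in> W"
  then have "y = (y \<ominus> x) \<oplus> x" using assms by (simp add: a_minus_def V.M.a_assoc V.M.l_neg)
  then show "y \<in> cls x" using y cls_eq by auto
qed

lemma self_cls: "x \<in> carrier V \<Longrightarrow> x \<in> cls x"
  using subspaceD(3)[OF W] by (simp add: mem_cls a_minus_def V.M.r_neg)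

lemma cls_eq_iff:
  assumes "x \<in> carrier V" "y \<in> carrier V"
  shows "cls x = cls y \<longleftrightarrow> x \<ominus> y \<in> W"
proof
  assume "cls x = cls y"
  then show "x \<ominus> y \<in> W" using self_cls[OF assms(1)] mem_cls[OF assms(2)] by simp
next
  assume d: "x \<ominus> y \<in> W"
  have "z \<ominus> x \<in> W \<longleftrightarrow> z \<ominus> y \<in> W" if z: "z \<in> carrier V" for z
  proof -
    have "(z \<ominus> x) \<oplus> (x \<ominus> y) = z \<ominus> y"
      using z assms by (simp add: a_minus_def V.M.a_assoc V.M.r_neg1 V.M.r_neg2)
    moreover have "(z \<ominus> y) \<ominus> (x \<ominus> y) = z \<ominus> x"
      using z assms by (rule V.minus_minus_cancel)
    ultimately show ?thesis using d subspaceD(4)[OF W] subspace_minus[OF W] by metis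
  qed
  then show "cls x = cls y" using mem_cls assms by blast
qed

lemma cls_zero: "cls \<zero> = W"
  using mem_cls[of "\<zero>"] W_carrier by (auto simp: a_minus_def real_vs_neg_zero[OF real_vs_V])

lemma cls_mem: "x \<in> carrier V \<Longrightarrow> cls x = W \<longleftrightarrow> x \<in> W"
  using cls_eq_iff[of x "\<zero>"] by (simp add: cls_zero a_minus_def real_vs_neg_zero[OF real_vs_V])

lemma cls_add:
  assumes "x \<in> carrier V" "y \<in> carrier V"
  shows "cls x <+>\<^bsub>V\<^esub> cls y = cls (x \<oplus> y)"
proof
  show "cls x <+>\<^bsub>V\<^esub> cls y \<subseteq> cls (x \<oplus> y)"
  proof
    fix z assume "z \<in> cls x <+>\<^bsub>V\<^esub> cls y"
    then obtain v w where "v \<in> W" "w \<in> W" "z = (v \<oplus> x) \<oplus> (w \<oplus> y)"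
      by (auto simp: set_add_def' cls_eq)
    moreover from this have "z = (v \<oplus> w) \<oplus> (x \<oplus> y)"
      using assms W_carrier by (simp add: V.M.a_ac)
    ultimately show "z \<in> cls (x \<oplus> y)" using subspaceD(4)[OF W] unfolding cls_eq by blast
  qed
  show "cls (x \<oplus> y) \<subseteq> cls x <+>\<^bsub>V\<^esub> cls y"
  proof
    fix z assume "z \<in> cls (x \<oplus> y)"
    then obtain w where "w \<in> W" "z = w \<oplus> (x \<oplus> y)" by (auto simp: cls_eq)
    then have "w \<oplus> x \<in> cls x" "z = (w \<oplus> x) \<oplus> y"
      using assms W_carrier by (auto simp: V.M.a_assoc cls_eq)
    then show "z \<in> cls x <+>\<^bsub>V\<^esub> cls y" using self_cls[OF assms(2)] by (auto simp: set_add_def')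
  qed
qed

text \<open>
  Operations on cosets are unions over representatives, which collapse when all members agree.
\<close>

lemma cls_UN:
  assumes x: "x \<in> carrier V" and F: "\<And>y. y \<in> carrier V \<Longrightarrow> y \<ominus> x \<in> W \<Longrightarrow> F y = F x"
  shows "(\<Union>y\<in>cls x. F y) = F x"
  using self_cls[OF x] F mem_cls[OF x] by blast

lemma cls_smult:
  assumes x: "x \<in> carrier V"
  shows "(\<Union>y\<in>cls x. cls (c \<odot> y)) = cls (c \<odot> x)"
proof (rule cls_UN[OF x])
  fix y assume y: "y \<in> carrier V" "y \<ominus> x \<in> W"
  have "c \<odot> (y \<ominus> x) = c \<odot> y \<ominus> c \<odot> x"
    using x y by (simp add: a_minus_def real_vs_smult_add[OF real_vs_V] V.smult_r_minus)
  then show "cls (c \<odot> y) = cls (c \<odot> x)"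
    using cls_eq_iff[of "c \<odot> y" "c \<odot> x"] subspaceD(5)[OF W y(2), of c] x y by simp
qed

lemma carrier_quot: "carrier (quot_vs V W) = cls ` carrier V"
  by (auto simp: quot_vs_def A_RCOSETS_def')

lemma quot_vs_real_vs: "real_vs (quot_vs V W)" and cls_lin: "cls \<in> lin V (quot_vs V W)"
  using real_vs_image[OF real_vs_V carrier_quot]
  by (auto simp: quot_vs_def cls_add cls_smult cls_zero)

end

text \<open>
  A maximal subspace \<open>M\<close> with \<open>M \<inter> W = 0\<close>, which exists by Zorn's lemma, is a complement of \<open>W\<close>:
  if \<open>x\<close> had no component in \<open>W\<close> modulo \<open>M\<close>, the span of \<open>M\<close> and \<open>x\<close> would still meet \<open>W\<close> trivially.
  The projection picks the unique component in \<open>W\<close>.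
\<close>

lemma subspace_projection:
  assumes W: "lin_subspace W V"
  obtains P where "P \<in> lin V V" "\<And>x. x \<in> carrier V \<Longrightarrow> P x \<in> W" "\<And>w. w \<in> W \<Longrightarrow> P w = w"
proof -
  note V = subspaceD(1)[OF W]
  interpret V: vectorspace real_ring V by (rule V)
  have WV: "w \<in> carrier V" if "w \<in> W" for w using subspaceD(2)[OF W] that by auto
  define \<C> where "\<C> = {C. lin_subspace C V \<and> C \<inter> W = {\<zero>\<^bsub>V\<^esub>}}"
  have "{\<zero>\<^bsub>V\<^esub>} \<in> \<C>"
    using subspaceD(3)[OF W] by (auto simp: \<C>_def real_vs_smult_zero[OF V] intro!: subspaceI[OF V])
  moreover have "\<Union>K \<in> \<C>" if K: "K \<noteq> {}" "subset.chain \<C> K" for K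
  proof -
    have sub: "lin_subspace C V" "C \<inter> W = {\<zero>\<^bsub>V\<^esub>}" if "C \<in> K" for C
      using K(2) that by (auto simp: subset.chain_def \<C>_def)
    have "lin_subspace (\<Union>K) V"
    proof (rule subspaceI[OF V])
      show "\<Union>K \<subseteq> carrier V" using subspaceD(2)[OF sub(1)] by auto
      show "\<zero>\<^bsub>V\<^esub> \<in> \<Union>K" using K(1) subspaceD(3)[OF sub(1)] by auto
      show "c \<odot>\<^bsub>V\<^esub> x \<in> \<Union>K" if "x \<in> \<Union>K" for c x using that subspaceD(5)[OF sub(1)] by auto
      show "x \<oplus>\<^bsub>V\<^esub> y \<in> \<Union>K" if xy: "x \<in> \<Union>K" "y \<in> \<Union>K" for x y
      proof -
        obtain A B where AB: "A \<in> K" "x \<in> A" "B \<in> K" "y \<in> B" using xy by auto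
        then have "A \<subseteq> B \<or> B \<subseteq> A" using K(2) by (auto simp: subset.chain_def)
        then show ?thesis using AB subspaceD(4)[OF sub(1)[OF AB(1)]] subspaceD(4)[OF sub(1)[OF AB(3)]] by blast
      qed
    qed
    moreover have "\<Union>K \<inter> W = {\<zero>\<^bsub>V\<^esub>}" using K(1) sub(2) by auto
    ultimately show ?thesis by (simp add: \<C>_def)
  qed
  ultimately obtain M where M: "M \<in> \<C>" and max: "\<And>X. X \<in> \<C> \<Longrightarrow> M \<subseteq> X \<Longrightarrow> X = M"
    using subset_Zorn_nonempty[of \<C>] by (metis empty_iff)
  have Ms: "lin_subspace M V" and MW: "M \<inter> W = {\<zero>\<^bsub>V\<^esub>}" using M by (auto simp: \<C>_def)
  have MV: "m \<in> carrier V" if "m \<in> M" for m using subspaceD(2)[OF Ms] that by auto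
  have ex: "\<exists>w\<in>W. x \<ominus>\<^bsub>V\<^esub> w \<in> M" if x: "x \<in> carrier V" for x
  proof (rule ccontr)
    assume no: "\<not> (\<exists>w\<in>W. x \<ominus>\<^bsub>V\<^esub> w \<in> M)"
    define X where "X = {m \<oplus>\<^bsub>V\<^esub> t \<odot>\<^bsub>V\<^esub> x | m t. m \<in> M}"
    have XI: "m \<oplus>\<^bsub>V\<^esub> t \<odot>\<^bsub>V\<^esub> x \<in> X" if "m \<in> M" for m t using that by (auto simp: X_def)
    have MX: "M \<subseteq> X"
    proof
      fix m assume "m \<in> M"
      then show "m \<in> X" using XI[of m 0] MV x by (simp add: real_vs_zero_smult[OF V])
    qed
    have Xs: "lin_subspace X V"
    proof (rule subspaceI[OF V])
      show "X \<subseteq> carrier V" using MV x by (auto simp: X_def)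
      show "\<zero>\<^bsub>V\<^esub> \<in> X" using MX subspaceD(3)[OF Ms] by auto
      show "c \<odot>\<^bsub>V\<^esub> y \<in> X" if "y \<in> X" for c y
        using that x MV XI subspaceD(5)[OF Ms]
        by (auto simp: X_def real_vs_smult_add[OF V] real_vs_smult_assoc[OF V])
      show "y \<oplus>\<^bsub>V\<^esub> z \<in> X" if yz: "y \<in> X" "z \<in> X" for y z
      proof -
        obtain m t n s where mn: "m \<in> M" "n \<in> M" "y = m \<oplus>\<^bsub>V\<^esub> t \<odot>\<^bsub>V\<^esub> x" "z = n \<oplus>\<^bsub>V\<^esub> s \<odot>\<^bsub>V\<^esub> x"
          using yz by (auto simp: X_def)
        then have "y \<oplus>\<^bsub>V\<^esub> z = (m \<oplus>\<^bsub>V\<^esub> n) \<oplus>\<^bsub>V\<^esub> (t + s) \<odot>\<^bsub>V\<^esub> x"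
          using x MV by (simp add: real_vs_add_smult[OF V] V.M.a_ac)
        then show ?thesis using XI[OF subspaceD(4)[OF Ms mn(1,2)]] by simp
      qed
    qed
    \<comment> \<open>a nonzero vector of \<open>X\<close> in \<open>W\<close> would be the component of a multiple of \<open>x\<close> in \<open>W\<close>\<close>
    have "X \<inter> W = {\<zero>\<^bsub>V\<^esub>}"
    proof -
      have "y = \<zero>\<^bsub>V\<^esub>" if y: "y \<in> X" "y \<in> W" for y
      proof -
        obtain m t where m: "m \<in> M" "y = m \<oplus>\<^bsub>V\<^esub> t \<odot>\<^bsub>V\<^esub> x" using y by (auto simp: X_def)
        show ?thesis
        proof (cases "t = 0")
          case True
          then have "y = m" using m MV x by (simp add: real_vs_zero_smult[OF V])
          then show ?thesis using m y MW by auto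
        next
          case False
          let ?w = "(1 / t) \<odot>\<^bsub>V\<^esub> y" and ?m = "(1 / t) \<odot>\<^bsub>V\<^esub> m"
          have c: "?m \<in> carrier V" using MV m by simp
          have "?w = ?m \<oplus>\<^bsub>V\<^esub> x"
            using m False x MV by (simp add: real_vs_smult_add[OF V] real_vs_smult_assoc[OF V] real_vs_one[OF V])
          then have "x \<ominus>\<^bsub>V\<^esub> ?w = \<ominus>\<^bsub>V\<^esub> ?m"
            using c x by (simp add: a_minus_def V.M.minus_add V.M.a_ac V.M.r_neg1 V.M.r_neg2)
          then have "x \<ominus>\<^bsub>V\<^esub> ?w \<in> M" using subspace_neg[OF Ms subspaceD(5)[OF Ms m(1)]] by simp
          moreover have "?w \<in> W" using subspaceD(5)[OF W y(2)] .
          ultimately show ?thesis using no by blast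
        qed
      qed
      then show ?thesis using subspaceD(3)[OF Xs] subspaceD(3)[OF W] by blast
    qed
    then have "X = M" using max MX Xs by (simp add: \<C>_def)
    then have "x \<in> M" using XI[OF subspaceD(3)[OF Ms], of 1] x by (simp add: real_vs_one[OF V])
    then show False using no subspaceD(3)[OF W] x by (auto simp: a_minus_def real_vs_neg_zero[OF V])
  qed
  have uniq: "v = w" if "v \<in> W" "w \<in> W" "x \<ominus>\<^bsub>V\<^esub> v \<in> M" "x \<ominus>\<^bsub>V\<^esub> w \<in> M" "x \<in> carrier V" for v w x
  proof -
    have "(x \<ominus>\<^bsub>V\<^esub> w) \<ominus>\<^bsub>V\<^esub> (x \<ominus>\<^bsub>V\<^esub> v) = v \<ominus>\<^bsub>V\<^esub> w"
      using that WV by (subst V.minus_minus_swap) (simp_all add: a_minus_def V.M.minus_add V.M.a_ac V.M.r_neg)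
    then have "v \<ominus>\<^bsub>V\<^esub> w \<in> M \<inter> W" using subspace_minus[OF Ms that(4,3)] subspace_minus[OF W that(1,2)] by simp
    then have "v \<ominus>\<^bsub>V\<^esub> w = \<zero>\<^bsub>V\<^esub>" using MW by auto
    then show ?thesis using that WV by (metis a_minus_def V.M.a_inv_closed V.M.minus_equality V.M.minus_minus)
  qed
  define P where "P x = (SOME w. w \<in> W \<and> x \<ominus>\<^bsub>V\<^esub> w \<in> M)" for x
  have P: "P x \<in> W \<and> x \<ominus>\<^bsub>V\<^esub> P x \<in> M" if "x \<in> carrier V" for x
    unfolding P_def by (rule someI_ex) (use ex[OF that] in blast)
  have Peq: "P x = w" if "x \<in> carrier V" "w \<in> W" "x \<ominus>\<^bsub>V\<^esub> w \<in> M" for x w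
    using uniq P that by metis
  show thesis
  proof (rule that)
    show "P \<in> lin V V"
    proof (rule linI)
      fix x y c assume x: "x \<in> carrier V"
      show "P x \<in> carrier V" using P[OF x] WV by simp
      show "P (c \<odot>\<^bsub>V\<^esub> x) = c \<odot>\<^bsub>V\<^esub> P x"
      proof (rule Peq)
        have "c \<odot>\<^bsub>V\<^esub> x \<ominus>\<^bsub>V\<^esub> c \<odot>\<^bsub>V\<^esub> P x = c \<odot>\<^bsub>V\<^esub> (x \<ominus>\<^bsub>V\<^esub> P x)"
          using x P[OF x] WV by (simp add: a_minus_def real_vs_smult_add[OF V] V.smult_r_minus)
        then show "c \<odot>\<^bsub>V\<^esub> x \<ominus>\<^bsub>V\<^esub> c \<odot>\<^bsub>V\<^esub> P x \<in> M" using P[OF x] subspaceD(5)[OF Ms] by simp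
      qed (use x P[OF x] subspaceD(5)[OF W] in auto)
      assume y: "y \<in> carrier V"
      show "P (x \<oplus>\<^bsub>V\<^esub> y) = P x \<oplus>\<^bsub>V\<^esub> P y"
      proof (rule Peq)
        have "(x \<oplus>\<^bsub>V\<^esub> y) \<ominus>\<^bsub>V\<^esub> (P x \<oplus>\<^bsub>V\<^esub> P y) = (x \<ominus>\<^bsub>V\<^esub> P x) \<oplus>\<^bsub>V\<^esub> (y \<ominus>\<^bsub>V\<^esub> P y)"
          using x y P[OF x] P[OF y] WV by (simp add: a_minus_def V.M.minus_add V.M.a_ac)
        then show "(x \<oplus>\<^bsub>V\<^esub> y) \<ominus>\<^bsub>V\<^esub> (P x \<oplus>\<^bsub>V\<^esub> P y) \<in> M" using P x y subspaceD(4)[OF Ms] by simp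
      qed (use x y P subspaceD(4)[OF W] in auto)
    qed
    show "P x \<in> W" if "x \<in> carrier V" for x using P[OF that] by simp
    show "P w = w" if "w \<in> W" for w
      using that WV subspaceD(3)[OF Ms] by (intro Peq) (auto simp: a_minus_def V.M.r_neg)
  qed
qed

text \<open>
  With a projection \<open>P\<close> onto \<open>W\<close>, the vector \<open>x \<ominus> P x\<close> depends only on the class of \<open>x\<close>, because \<open>P\<close>
  is the identity on \<open>W\<close>.
\<close>

lemma (in quotient_space) linear_section:
  obtains s where "s \<in> lin (quot_vs V W) V" "\<And>X. X \<in> carrier (quot_vs V W) \<Longrightarrow> cls (s X) = X"
proof -
  obtain P where P: "P \<in> lin V V" "\<And>x. x \<in> carrier V \<Longrightarrow> P x \<in> W" "\<And>w. w \<in> W \<Longrightarrow> P w = w"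
    using subspace_projection[OF W] by blast
  have id: "(\<lambda>x. x) \<in> lin V V" by (rule linI) simp_all
  have d: "(\<lambda>x. x \<ominus> P x) \<in> lin V V" by (rule lin_diff[OF real_vs_V id P(1)])
  define s where "s X = (let x = SOME x. x \<in> carrier V \<and> cls x = X in x \<ominus> P x)" for X
  have s: "s (cls x) = x \<ominus> P x" if x: "x \<in> carrier V" for x
  proof -
    define y where "y = (SOME y. y \<in> carrier V \<and> cls y = cls x)"
    have y: "y \<in> carrier V \<and> cls y = cls x" unfolding y_def by (rule someI[of _ x]) (simp add: x)
    then have yx: "y \<ominus> x \<in> W" using cls_eq_iff[of y x] x by simp
    have "(y \<ominus> x) \<ominus> P (y \<ominus> x) = (y \<ominus> P y) \<ominus> (x \<ominus> P x)"
      using lin_minus[OF real_vs_V real_vs_V d, of y x] y x by simp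
    then have "(y \<ominus> P y) \<ominus> (x \<ominus> P x) = \<zero>"
      using P(3)[OF yx] W_carrier[OF yx] by (simp add: a_minus_def V.M.r_neg)
    moreover have "y \<ominus> P y \<in> carrier V" "x \<ominus> P x \<in> carrier V"
      using lin_closed[OF d] x y by auto
    ultimately have "y \<ominus> P y = x \<ominus> P x"
      by (metis a_minus_def V.M.a_inv_closed V.M.minus_equality V.M.minus_minus)
    then show ?thesis by (simp add: s_def y_def[symmetric])
  qed
  have ex: "\<exists>x\<in>carrier V. X = cls x" if "X \<in> carrier (quot_vs V W)" for X
    using that by (auto simp: carrier_quot)
  show thesis
  proof (rule that)
    show "s \<in> lin (quot_vs V W) V"
      by (rule linI) (auto dest!: ex simp: s lin_closed[OF d] lin_add[OF d] lin_smult[OF d]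
          simp flip: lin_add[OF cls_lin] lin_smult[OF cls_lin])
    show "cls (s X) = X" if X: "X \<in> carrier (quot_vs V W)" for X
    proof -
      obtain x where x: "x \<in> carrier V" "X = cls x" using ex[OF X] by blast
      have "x \<ominus> P x \<ominus> x = \<ominus> P x"
        using x lin_closed[OF P(1)] by (simp add: a_minus_def V.M.a_ac V.M.r_neg1 V.M.r_neg2)
      then show ?thesis using x s cls_eq_iff[of "x \<ominus> P x" x] subspace_neg[OF W P(2)] lin_closed[OF P(1)]
        by simp
    qed
  qed
qed

section \<open>Complexes, short exact sequences and cohomology\<close>

lemma cochain_complexI:
  assumes "\<And>k. real_vs (cx_space A k)"
    and "\<And>k. cx_diff A k \<in> lin (cx_space A k) (cx_space A (Suc k))"
    and "\<And>k \<phi>. \<phi> \<in> carrier (cx_space A k) \<Longrightarrow> cx_diff A (Suc k) (cx_diff A k \<phi>) = \<zero>\<^bsub>cx_space A (Suc (Suc k))\<^esub>"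
  shows "cochain_complex A"
  using assms by (simp add: cochain_complex_def linear_mapI)

lemma linear_mapD:
  assumes "linear_map real_ring U V f"
  shows "real_vs U" "real_vs V" "f \<in> lin U V"
  using assms by (auto simp: linear_map_def mod_hom_def mod_hom_axioms_def)

lemma cochain_complexD:
  assumes "cochain_complex A"
  shows "real_vs (cx_space A k)"
    and "cx_diff A k \<in> lin (cx_space A k) (cx_space A (Suc k))"
    and "\<phi> \<in> carrier (cx_space A k) \<Longrightarrow> cx_diff A (Suc k) (cx_diff A k \<phi>) = \<zero>\<^bsub>cx_space A (Suc (Suc k))\<^esub>"
  using assms unfolding cochain_complex_def by (auto dest: linear_mapD)

lemma cochain_mapI:
  assumes "cochain_complex A" "cochain_complex B"
    and "\<And>k. f k \<in> lin (cx_space A k) (cx_space B k)"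
    and "\<And>k \<phi>. \<phi> \<in> carrier (cx_space A k) \<Longrightarrow> f (Suc k) (cx_diff A k \<phi>) = cx_diff B k (f k \<phi>)"
  shows "cochain_map A B f"
  using assms by (simp add: cochain_map_def linear_mapI cochain_complexD(1))

lemma cochain_mapD:
  assumes "cochain_map A B f"
  shows "cochain_complex A" "cochain_complex B"
    and "f k \<in> lin (cx_space A k) (cx_space B k)"
    and "\<phi> \<in> carrier (cx_space A k) \<Longrightarrow> f (Suc k) (cx_diff A k \<phi>) = cx_diff B k (f k \<phi>)"
  using assms unfolding cochain_map_def by (auto dest: linear_mapD)

lemma shift_simps [simp]:
  "cx_space (shift A) k = cx_space A (Suc k)"
  "cx_diff (shift A) k \<phi> = \<ominus>\<^bsub>cx_space A (Suc (Suc k))\<^esub> cx_diff A (Suc k) \<phi>"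
  by (simp_all add: shift_def)

lemma sub_cx_simps [simp]:
  "cx_space (sub_cx A S) k = (cx_space A k)\<lparr>carrier := S k\<rparr>" "cx_diff (sub_cx A S) k = cx_diff A k"
  by (simp_all add: sub_cx_def)

lemma cochain_complex_shift:
  assumes A: "cochain_complex A"
  shows "cochain_complex (shift A)"
proof (rule cochain_complexI)
  fix k
  note vs = cochain_complexD(1)[OF A] and d = cochain_complexD(2)[OF A]
  show "real_vs (cx_space (shift A) k)" by (simp add: vs)
  show "cx_diff (shift A) k \<in> lin (cx_space (shift A) k) (cx_space (shift A) (Suc k))"
  proof -
    interpret V: vectorspace real_ring "cx_space A (Suc (Suc k))" by (rule vs)
    show ?thesis
      by (rule linI) (simp_all add: lin_closed[OF d] lin_add[OF d] lin_smult[OF d] V.M.minus_add V.smult_r_minus V.M.a_comm)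
  qed
  show "cx_diff (shift A) (Suc k) (cx_diff (shift A) k \<phi>) = \<zero>\<^bsub>cx_space (shift A) (Suc (Suc k))\<^esub>"
    if "\<phi> \<in> carrier (cx_space (shift A) k)" for \<phi>
    using that by (simp add: lin_neg[OF vs vs d] lin_closed[OF d] cochain_complexD(3)[OF A] real_vs_neg_zero[OF vs])
qed

lemma cochain_complex_sub_cx:
  assumes A: "cochain_complex A"
    and S: "\<And>k. lin_subspace (S k) (cx_space A k)"
    and d: "\<And>k \<phi>. \<phi> \<in> S k \<Longrightarrow> cx_diff A k \<phi> \<in> S (Suc k)"
  shows "cochain_complex (sub_cx A S)"
proof (rule cochain_complexI)
  fix k
  have S': "\<phi> \<in> carrier (cx_space A k)" if "\<phi> \<in> S k" for \<phi> k using subspaceD(2)[OF S] that by auto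
  show "real_vs (cx_space (sub_cx A S) k)" using subspace_real_vs[OF S] by simp
  show "cx_diff (sub_cx A S) k \<in> lin (cx_space (sub_cx A S) k) (cx_space (sub_cx A S) (Suc k))"
    by (rule linI) (simp_all add: d S' lin_add[OF cochain_complexD(2)[OF A]] lin_smult[OF cochain_complexD(2)[OF A]])
  show "cx_diff (sub_cx A S) (Suc k) (cx_diff (sub_cx A S) k \<phi>) = \<zero>\<^bsub>cx_space (sub_cx A S) (Suc (Suc k))\<^esub>"
    if "\<phi> \<in> carrier (cx_space (sub_cx A S) k)" for \<phi>
    using that S' cochain_complexD(3)[OF A] by simp
qed

lemma lin_image_subspace:
  assumes "real_vs U" "real_vs V" "f \<in> lin U V"
  shows "lin_subspace (f ` carrier U) V"
proof (rule subspaceI[OF assms(2)])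
  show "f ` carrier U \<subseteq> carrier V" using lin_closed[OF assms(3)] by auto
  show "\<zero>\<^bsub>V\<^esub> \<in> f ` carrier U"
    using lin_zero[OF assms] real_vs_zero_closed[OF assms(1)] by (metis imageI)
  show "x \<oplus>\<^bsub>V\<^esub> y \<in> f ` carrier U" if "x \<in> f ` carrier U" "y \<in> f ` carrier U" for x y
    using that real_vs_add_closed[OF assms(1)] by (auto simp flip: lin_add[OF assms(3)])
  show "c \<odot>\<^bsub>V\<^esub> x \<in> f ` carrier U" if "x \<in> f ` carrier U" for c x
    using that real_vs_smult_closed[OF assms(1)] by (auto simp flip: lin_smult[OF assms(3)])
qed

lemma lin_kernel_subspace:
  assumes "real_vs U" "real_vs V" "f \<in> lin U V"
  shows "lin_subspace (a_kernel U V f) U"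
proof (rule subspaceI[OF assms(1)])
  interpret V: vectorspace real_ring V by fact
  show "a_kernel U V f \<subseteq> carrier U" by (auto simp: a_kernel_def')
  show "\<zero>\<^bsub>U\<^esub> \<in> a_kernel U V f"
    using lin_zero[OF assms] real_vs_zero_closed[OF assms(1)] by (simp add: a_kernel_def')
  show "x \<oplus>\<^bsub>U\<^esub> y \<in> a_kernel U V f" if "x \<in> a_kernel U V f" "y \<in> a_kernel U V f" for x y
    using that real_vs_add_closed[OF assms(1)] by (auto simp: a_kernel_def' lin_add[OF assms(3)])
  show "c \<odot>\<^bsub>U\<^esub> x \<in> a_kernel U V f" if "x \<in> a_kernel U V f" for c x
    using that real_vs_smult_closed[OF assms(1)]
    by (auto simp: a_kernel_def' lin_smult[OF assms(3)] real_vs_smult_zero[OF assms(2)])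
qed

lemma cochain_map_image:
  assumes f: "cochain_map A B f"
  shows "cochain_map A (sub_cx B (\<lambda>k. f k ` carrier (cx_space A k))) f"
    and "cx_surjective A (sub_cx B (\<lambda>k. f k ` carrier (cx_space A k))) f"
proof -
  note D = cochain_mapD[OF f]
  have "cochain_complex (sub_cx B (\<lambda>k. f k ` carrier (cx_space A k)))"
    using lin_closed[OF cochain_complexD(2)[OF D(1)]]
    by (intro cochain_complex_sub_cx lin_image_subspace cochain_complexD(1) D) (auto simp flip: D(4))
  then show "cochain_map A (sub_cx B (\<lambda>k. f k ` carrier (cx_space A k))) f"
    by (intro cochain_mapI D linI) (simp_all add: D(4) lin_add[OF D(3)] lin_smult[OF D(3)])
  show "cx_surjective A (sub_cx B (\<lambda>k. f k ` carrier (cx_space A k))) f"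
    by (simp add: cx_surjective_def)
qed

text \<open>
  Every element of \<open>B\<close> has the form \<open>p \<psi>\<close>, and on such elements \<open>r\<close> acts as the cochain map \<open>q\<close>.
\<close>

lemma cochain_map_factor:
  assumes p: "cochain_map A B p" "cx_surjective A B p" and q: "cochain_map A C q"
    and r: "\<And>k \<phi>. \<phi> \<in> carrier (cx_space A k) \<Longrightarrow> r k (p k \<phi>) = q k \<phi>"
  shows "cochain_map B C r"
proof (rule cochain_mapI)
  note P = cochain_mapD[OF p(1)] and Q = cochain_mapD[OF q]
  show "cochain_complex B" "cochain_complex C" using P Q by auto
  have surj: "\<exists>\<psi>\<in>carrier (cx_space A k). \<phi> = p k \<psi>" if "\<phi> \<in> carrier (cx_space B k)" for \<phi> k
    using p(2) that by (auto simp: cx_surjective_def)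
  note ops = real_vs_add_closed[OF cochain_complexD(1)[OF P(1)]] real_vs_smult_closed[OF cochain_complexD(1)[OF P(1)]]
    lin_closed[OF cochain_complexD(2)[OF P(1)]]
  show "r k \<in> lin (cx_space B k) (cx_space C k)" for k
    by (rule linI) (auto dest!: surj simp: r lin_closed[OF Q(3)] lin_add[OF Q(3)] lin_smult[OF Q(3)] ops
        simp flip: lin_add[OF P(3)] lin_smult[OF P(3)])
  show "r (Suc k) (cx_diff B k \<phi>) = cx_diff C k (r k \<phi>)" if "\<phi> \<in> carrier (cx_space B k)" for k \<phi>
    using surj[OF that] by (auto simp: r ops Q(4) simp flip: P(4))
qed

lemma cocycles_eq:
  "cocycles A k = {z \<in> carrier (cx_space A k). cx_diff A k z = \<zero>\<^bsub>cx_space A (Suc k)\<^esub>}"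
  by (simp add: cocycles_def a_kernel_def')

lemma coboundaries_subspace:
  assumes A: "cochain_complex A"
  shows "lin_subspace (coboundaries A k) ((cx_space A k)\<lparr>carrier := cocycles A k\<rparr>)"
proof -
  note vs = cochain_complexD(1)[OF A] and d = cochain_complexD(2)[OF A]
  have Z: "lin_subspace (cocycles A k) (cx_space A k)"
    unfolding cocycles_def by (intro lin_kernel_subspace vs d)
  have B: "lin_subspace (coboundaries A k) (cx_space A k)"
  proof (cases k)
    case 0
    interpret V: vectorspace real_ring "cx_space A 0" by (rule vs)
    show ?thesis unfolding 0 by (rule subspaceI[OF vs]) (auto simp: real_vs_smult_zero[OF vs])
  next
    case (Suc k')
    then show ?thesis by (simp add: lin_image_subspace vs d)
  qed
  have "coboundaries A k \<subseteq> cocycles A k"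
  proof (cases k)
    case 0
    then show ?thesis using subspaceD(3)[OF Z] by simp
  next
    case (Suc k')
    then show ?thesis using lin_closed[OF d] cochain_complexD(3)[OF A] by (auto simp: cocycles_eq)
  qed
  then show ?thesis
    using subspaceD[OF B] by (intro subspaceI subspace_real_vs[OF Z]) auto
qed

text \<open>
  A cochain map preserves cocycles and coboundaries, so the union over the representatives of a
  class that defines the induced map is the class of the image of any single one of them.
\<close>

lemma cohomology_map_linear:
  assumes f: "cochain_map A B f"
  shows "linear_map real_ring (cohomology A k) (cohomology B k) (cohomology_map B f k)"
    and "z \<in> cocycles A k \<Longrightarrow> cohomology_map B f k (coboundaries A k +>\<^bsub>cx_space A k\<^esub> z) =
      coboundaries B k +>\<^bsub>cx_space B k\<^esub> f k z"
    and "carrier (cohomology A k) = (\<lambda>z. coboundaries A k +>\<^bsub>cx_space A k\<^esub> z) ` cocycles A k"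
proof -
  note D = cochain_mapD[OF f]
  let ?ZA = "(cx_space A k)\<lparr>carrier := cocycles A k\<rparr>" and ?ZB = "(cx_space B k)\<lparr>carrier := cocycles B k\<rparr>"
  interpret A: quotient_space ?ZA "coboundaries A k"
    by (rule quotient_space.intro) (rule coboundaries_subspace[OF D(1)])
  interpret B: quotient_space ?ZB "coboundaries B k"
    by (rule quotient_space.intro) (rule coboundaries_subspace[OF D(2)])
  have clsA: "coboundaries A k +>\<^bsub>?ZA\<^esub> z = coboundaries A k +>\<^bsub>cx_space A k\<^esub> z" for z
    by (simp add: a_r_coset_def')
  have clsB: "coboundaries B k +>\<^bsub>?ZB\<^esub> z = coboundaries B k +>\<^bsub>cx_space B k\<^esub> z" for z
    by (simp add: a_r_coset_def')
  have fZ: "f k \<in> lin ?ZA ?ZB"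
  proof (rule linI)
    fix x assume "x \<in> carrier ?ZA"
    then have x: "x \<in> carrier (cx_space A k)" "cx_diff A k x = \<zero>\<^bsub>cx_space A (Suc k)\<^esub>"
      by (auto simp: cocycles_eq)
    have "cx_diff B k (f k x) = f (Suc k) \<zero>\<^bsub>cx_space A (Suc k)\<^esub>"
      using D(4)[OF x(1)] x(2) by simp
    also have "\<dots> = \<zero>\<^bsub>cx_space B (Suc k)\<^esub>"
      by (intro lin_zero cochain_complexD(1) D)
    finally show "f k x \<in> carrier ?ZB" using lin_closed[OF D(3) x(1)] by (simp add: cocycles_eq)
  qed (auto simp: cocycles_eq lin_add[OF D(3)] lin_smult[OF D(3)])
  have fB: "f k b \<in> coboundaries B k" if "b \<in> coboundaries A k" for b
  proof (cases k)
    case 0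
    then show ?thesis using that lin_zero[OF cochain_complexD(1)[OF D(1)] cochain_complexD(1)[OF D(2)] D(3)] by simp
  next
    case (Suc k')
    then show ?thesis using that lin_closed[OF D(3)] by (auto simp: D(4))
  qed
  have map: "cohomology_map B f k (A.cls z) = B.cls (f k z)" if z: "z \<in> carrier ?ZA" for z
    unfolding cohomology_map_def clsB[symmetric]
  proof (rule A.cls_UN[OF z])
    fix y assume y: "y \<in> carrier ?ZA" "y \<ominus>\<^bsub>?ZA\<^esub> z \<in> coboundaries A k"
    have "f k (y \<ominus>\<^bsub>?ZA\<^esub> z) = f k y \<ominus>\<^bsub>?ZB\<^esub> f k z"
      by (rule lin_minus[OF A.real_vs_V B.real_vs_V fZ y(1) z])
    then show "B.cls (f k y) = B.cls (f k z)"
      using fB[OF y(2)] lin_closed[OF fZ] y z B.cls_eq_iff by metis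
  qed
  have HA: "cohomology A k = quot_vs ?ZA (coboundaries A k)" and HB: "cohomology B k = quot_vs ?ZB (coboundaries B k)"
    by (simp_all add: cohomology_def)
  show "linear_map real_ring (cohomology A k) (cohomology B k) (cohomology_map B f k)"
    unfolding HA HB
  proof (intro linear_mapI A.quot_vs_real_vs B.quot_vs_real_vs linI)
    have *: "\<exists>z\<in>carrier ?ZA. X = A.cls z" if "X \<in> carrier (quot_vs ?ZA (coboundaries A k))" for X
      using that unfolding A.carrier_quot by auto
    fix X Y c assume "X \<in> carrier (quot_vs ?ZA (coboundaries A k))"
    then obtain x where x: "x \<in> carrier ?ZA" "X = A.cls x" using * by blast
    show "cohomology_map B f k X \<in> carrier (quot_vs ?ZB (coboundaries B k))"
      unfolding x(2) map[OF x(1)] by (intro lin_closed[OF B.cls_lin] lin_closed[OF fZ] x)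
    show "cohomology_map B f k (c \<odot>\<^bsub>quot_vs ?ZA (coboundaries A k)\<^esub> X) =
        c \<odot>\<^bsub>quot_vs ?ZB (coboundaries B k)\<^esub> cohomology_map B f k X"
      unfolding x(2) map[OF x(1)] lin_smult[OF A.cls_lin x(1), symmetric] map[OF real_vs_smult_closed[OF A.real_vs_V x(1)]]
        lin_smult[OF B.cls_lin lin_closed[OF fZ x(1)], symmetric] lin_smult[OF fZ x(1)] ..
    assume "Y \<in> carrier (quot_vs ?ZA (coboundaries A k))"
    then obtain y where y: "y \<in> carrier ?ZA" "Y = A.cls y" using * by blast
    show "cohomology_map B f k (X \<oplus>\<^bsub>quot_vs ?ZA (coboundaries A k)\<^esub> Y) =
        cohomology_map B f k X \<oplus>\<^bsub>quot_vs ?ZB (coboundaries B k)\<^esub> cohomology_map B f k Y"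
      unfolding x(2) y(2) map[OF x(1)] map[OF y(1)] lin_add[OF A.cls_lin x(1) y(1), symmetric]
        map[OF real_vs_add_closed[OF A.real_vs_V x(1) y(1)]]
        lin_add[OF B.cls_lin lin_closed[OF fZ x(1)] lin_closed[OF fZ y(1)], symmetric] lin_add[OF fZ x(1) y(1)] ..
  qed
  show "cohomology_map B f k (coboundaries A k +>\<^bsub>cx_space A k\<^esub> z) = coboundaries B k +>\<^bsub>cx_space B k\<^esub> f k z"
    if "z \<in> cocycles A k" using map[of z] that by (simp add: clsA clsB)
  show "carrier (cohomology A k) = (\<lambda>z. coboundaries A k +>\<^bsub>cx_space A k\<^esub> z) ` cocycles A k"
    unfolding HA A.carrier_quot clsA by simp
qed

text \<open>
  In degree zero the coboundaries are trivial and the class of a cocycle is a singleton.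
\<close>

lemma zeroth_cohomology_map_inj:
  assumes f: "cochain_map A B f" and inj: "inj_on (f 0) (carrier (cx_space A 0))"
  shows "inj_on (cohomology_map B f 0) (carrier (cohomology A 0))"
proof -
  note D = cochain_mapD[OF f]
  have cls: "coboundaries C 0 +>\<^bsub>cx_space C 0\<^esub> z = {z}" if "cochain_complex C" "z \<in> carrier (cx_space C 0)" for C :: "'x cochain_cx" and z
    using that abelian_monoid.l_zero[of "cx_space C 0"] real_vs_abelian[OF cochain_complexD(1)[OF that(1)]]
    by (simp add: a_r_coset_def' abelian_group.axioms)
  have Z: "z \<in> carrier (cx_space A 0)" if "z \<in> cocycles A 0" for z using that by (simp add: cocycles_eq)
  show ?thesis
    unfolding cohomology_map_linear(3)[OF f] inj_on_def
    using cohomology_map_linear(2)[OF f, where k = 0] cls[OF D(1)] cls[OF D(2)] lin_closed[OF D(3)] Z inj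
    by (auto simp: inj_on_def simp del: coboundaries.simps)
qed

lemma cochain_map_shift:
  assumes f: "cochain_map A B f"
  shows "cochain_map (shift A) (shift B) (\<lambda>k. f (Suc k))"
proof -
  note D = cochain_mapD[OF f]
  show ?thesis
    using lin_neg[OF cochain_complexD(1)[OF D(1)] cochain_complexD(1)[OF D(2)] D(3)]
      lin_closed[OF cochain_complexD(2)[OF D(1)]]
    by (intro cochain_mapI cochain_complex_shift D(1,2)) (simp_all add: D(3,4))
qed

lemma short_exactI:
  assumes "cochain_map A B f" "cochain_map B C h"
    and "\<And>k. inj_on (f k) (carrier (cx_space A k))"
    and "\<And>k. h k ` carrier (cx_space B k) = carrier (cx_space C k)"
    and "\<And>k. f k ` carrier (cx_space A k) = {\<phi> \<in> carrier (cx_space B k). h k \<phi> = \<zero>\<^bsub>cx_space C k\<^esub>}"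
  shows "short_exact A B C f h"
  using assms by (simp add: short_exact_def cx_injective_def cx_surjective_def a_kernel_def')

lemma short_exact_shift:
  assumes "short_exact A B C f h"
  shows "short_exact (shift A) (shift B) (shift C) (\<lambda>k. f (Suc k)) (\<lambda>k. h (Suc k))"
  using assms by (simp add: short_exact_def cochain_map_shift cx_injective_def cx_surjective_def)

lemma short_exact_kernel:
  assumes f: "cochain_map A B f" and surj: "cx_surjective A B f"
  shows "short_exact (sub_cx A (\<lambda>k. a_kernel (cx_space A k) (cx_space B k) (f k))) A B (\<lambda>k \<phi>. \<phi>) f"
proof -
  note D = cochain_mapD[OF f]
  note vs = cochain_complexD(1)[OF D(1)] cochain_complexD(1)[OF D(2)]
  have "cochain_complex (sub_cx A (\<lambda>k. a_kernel (cx_space A k) (cx_space B k) (f k)))"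
  proof (intro cochain_complex_sub_cx D lin_kernel_subspace vs)
    show "cx_diff A k \<phi> \<in> a_kernel (cx_space A (Suc k)) (cx_space B (Suc k)) (f (Suc k))"
      if "\<phi> \<in> a_kernel (cx_space A k) (cx_space B k) (f k)" for k \<phi>
      using that lin_closed[OF cochain_complexD(2)[OF D(1)]] lin_zero[OF vs(2) vs(2) cochain_complexD(2)[OF D(2)]]
      by (auto simp: a_kernel_def' D(4))
  qed
  then have "cochain_map (sub_cx A (\<lambda>k. a_kernel (cx_space A k) (cx_space B k) (f k))) A (\<lambda>k \<phi>. \<phi>)"
    by (intro cochain_mapI D(1) linI) (auto simp: a_kernel_def')
  then show ?thesis using f surj by (simp add: short_exact_def cx_injective_def)
qed

section \<open>Cartan calculus on functions of lists\<close>

text \<open>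
  These are \<open>L\<^sub>x f\<close> and \<open>d f\<close>, for a function \<open>f\<close> of lists of arbitrary length, read off from
  \<open>\<iota>\<^sub>y L\<^sub>x = L\<^sub>x \<iota>\<^sub>y - \<iota>\<^sub>[\<^sub>x\<^sub>,\<^sub>y\<^sub>]\<close> and \<open>\<iota>\<^sub>x d = L\<^sub>x - d \<iota>\<^sub>x\<close>. A value of \<open>d f\<close> on the empty list would
  belong to a form of degree zero that is a differential, hence is zero.
\<close>

fun lie_deriv ::
  "'a lie_alg \<Rightarrow> (real, 'v, 'n) module_scheme \<Rightarrow> ('a \<Rightarrow> 'v \<Rightarrow> 'v) \<Rightarrow> 'a
    \<Rightarrow> ('a list \<Rightarrow> 'v) \<Rightarrow> 'a list \<Rightarrow> 'v" where
  "lie_deriv h V r x f [] = r x (f [])"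
| "lie_deriv h V r x f (y # ys) =
     lie_deriv h V r x (\<lambda>zs. f (y # zs)) ys \<ominus>\<^bsub>V\<^esub> f (bracket h x y # ys)"

fun cartan_diff ::
  "'a lie_alg \<Rightarrow> (real, 'v, 'n) module_scheme \<Rightarrow> ('a \<Rightarrow> 'v \<Rightarrow> 'v)
    \<Rightarrow> ('a list \<Rightarrow> 'v) \<Rightarrow> 'a list \<Rightarrow> 'v" where
  "cartan_diff h V r f [] = \<zero>\<^bsub>V\<^esub>"
| "cartan_diff h V r f (x # xs) =
     lie_deriv h V r x f xs \<ominus>\<^bsub>V\<^esub> cartan_diff h V r (\<lambda>zs. f (x # zs)) xs"

abbreviation valued ::
  "(real, 'a, 'm) module_scheme \<Rightarrow> (real, 'v, 'n) module_scheme \<Rightarrow> ('a list \<Rightarrow> 'v) \<Rightarrow> bool" where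
  "valued h V f \<equiv> \<forall>xs. set xs \<subseteq> carrier h \<longrightarrow> f xs \<in> carrier V"

text \<open>
  No degree is fixed, so that the class of these functions is closed under inserting a first
  argument, which is what the inductions need.
\<close>

definition multilinear ::
  "(real, 'a, 'm) module_scheme \<Rightarrow> (real, 'v, 'n) module_scheme \<Rightarrow> ('a list \<Rightarrow> 'v) \<Rightarrow> bool" where
  "multilinear h V f \<longleftrightarrow> valued h V f \<and>
     (\<forall>pre post. set pre \<subseteq> carrier h \<longrightarrow> set post \<subseteq> carrier h \<longrightarrow> (\<lambda>x. f (pre @ x # post)) \<in> lin h V)"

text \<open>
  Only adjacent repetitions are considered: in an induction over \<open>pre\<close> such a repetition either is
  at the front of the list or stays intact when the first argument is split off.
\<close>

definition alternating ::
  "(real, 'a, 'm) module_scheme \<Rightarrow> (real, 'v, 'n) module_scheme \<Rightarrow> ('a list \<Rightarrow> 'v) \<Rightarrow> bool" where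
  "alternating h V f \<longleftrightarrow> (\<forall>pre x post. set pre \<subseteq> carrier h \<longrightarrow> x \<in> carrier h \<longrightarrow> set post \<subseteq> carrier h \<longrightarrow>
     f (pre @ x # x # post) = \<zero>\<^bsub>V\<^esub>)"

lemma multilinearI:
  assumes "\<And>xs. set xs \<subseteq> carrier h \<Longrightarrow> f xs \<in> carrier V"
    and "\<And>pre post. set pre \<subseteq> carrier h \<Longrightarrow> set post \<subseteq> carrier h \<Longrightarrow> (\<lambda>x. f (pre @ x # post)) \<in> lin h V"
  shows "multilinear h V f"
  using assms by (simp add: multilinear_def)

lemma alternatingI:
  assumes "\<And>pre x post. set pre \<subseteq> carrier h \<Longrightarrow> x \<in> carrier h \<Longrightarrow> set post \<subseteq> carrier h \<Longrightarrow>
    f (pre @ x # x # post) = \<zero>\<^bsub>V\<^esub>"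
  shows "alternating h V f"
  using assms by (simp add: alternating_def)

lemma multilinear_closed: "multilinear h V f \<Longrightarrow> set xs \<subseteq> carrier h \<Longrightarrow> f xs \<in> carrier V"
  by (auto simp: multilinear_def)

lemma multilinear_lin:
  "multilinear h V f \<Longrightarrow> set pre \<subseteq> carrier h \<Longrightarrow> set post \<subseteq> carrier h \<Longrightarrow>
    (\<lambda>x. f (pre @ x # post)) \<in> lin h V"
  by (auto simp: multilinear_def)

lemma multilinear_head:
  "multilinear h V f \<Longrightarrow> set post \<subseteq> carrier h \<Longrightarrow> (\<lambda>x. f (x # post)) \<in> lin h V"
  using multilinear_lin[of h V f "[]" post] by simp

lemma multilinear_Cons:
  assumes "multilinear h V f" "x \<in> carrier h"
  shows "multilinear h V (\<lambda>zs. f (x # zs))"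
proof (rule multilinearI)
  show "f (x # xs) \<in> carrier V" if "set xs \<subseteq> carrier h" for xs
    using assms that by (auto simp: multilinear_closed)
  show "(\<lambda>y. f (x # pre @ y # post)) \<in> lin h V"
    if "set pre \<subseteq> carrier h" "set post \<subseteq> carrier h" for pre post
    using multilinear_lin[OF assms(1), of "x # pre" post] that assms(2) by simp
qed

lemma alternating_adjacent:
  "alternating h V f \<Longrightarrow> set pre \<subseteq> carrier h \<Longrightarrow> x \<in> carrier h \<Longrightarrow> set post \<subseteq> carrier h \<Longrightarrow>
    f (pre @ x # x # post) = \<zero>\<^bsub>V\<^esub>"
  by (auto simp: alternating_def)

lemma alternating_Cons:
  assumes "alternating h V f" "x \<in> carrier h"
  shows "alternating h V (\<lambda>zs. f (x # zs))"
proof (rule alternatingI)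
  show "f (x # pre @ y # y # post) = \<zero>\<^bsub>V\<^esub>"
    if "set pre \<subseteq> carrier h" "y \<in> carrier h" "set post \<subseteq> carrier h" for pre y post
    using alternating_adjacent[OF assms(1), of "x # pre" y post] that assms(2) by simp
qed

lemma alternating_swap:
  assumes V: "real_vs V" and h: "real_vs h" and f: "multilinear h V f" "alternating h V f"
    and mem: "set pre \<subseteq> carrier h" "x \<in> carrier h" "y \<in> carrier h" "set post \<subseteq> carrier h"
  shows "f (pre @ x # y # post) = \<ominus>\<^bsub>V\<^esub> f (pre @ y # x # post)"
proof -
  interpret V: vectorspace real_ring V by fact
  interpret h: vectorspace real_ring h by fact
  let ?s = "x \<oplus>\<^bsub>h\<^esub> y"
  have s: "?s \<in> carrier h" using mem by simp
  have left: "f (pre @ ?s # z # post) = f (pre @ x # z # post) \<oplus>\<^bsub>V\<^esub> f (pre @ y # z # post)"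
    if "z \<in> carrier h" for z
    using lin_add[OF multilinear_lin[OF f(1), of pre "z # post"]] mem that by simp
  have right: "f (pre @ z # ?s # post) = f (pre @ z # x # post) \<oplus>\<^bsub>V\<^esub> f (pre @ z # y # post)"
    if "z \<in> carrier h" for z
    using lin_add[OF multilinear_lin[OF f(1), of "pre @ [z]" post]] mem that by simp
  have c: "f (pre @ a # b # post) \<in> carrier V" if "a \<in> carrier h" "b \<in> carrier h" for a b
    using multilinear_closed[OF f(1)] mem that by simp
  have "f (pre @ ?s # ?s # post) = \<zero>\<^bsub>V\<^esub>"
    using alternating_adjacent[OF f(2)] mem s by simp
  then have "f (pre @ x # y # post) \<oplus>\<^bsub>V\<^esub> f (pre @ y # x # post) = \<zero>\<^bsub>V\<^esub>"
    using mem c s alternating_adjacent[OF f(2) mem(1,2,4)] alternating_adjacent[OF f(2) mem(1,3,4)]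
    by (simp add: left right V.M.a_comm)
  then show ?thesis using c mem by (simp add: V.M.minus_equality)
qed

text \<open>
  Equal arguments are moved next to each other by adjacent transpositions.
\<close>

lemma alternating_repeat:
  assumes V: "real_vs V" and h: "real_vs h" and f: "multilinear h V f" "alternating h V f"
    and "set pre \<subseteq> carrier h" "x \<in> carrier h" "set mid \<subseteq> carrier h" "set post \<subseteq> carrier h"
  shows "f (pre @ x # mid @ x # post) = \<zero>\<^bsub>V\<^esub>"
  using assms(5-8)
proof (induction mid arbitrary: pre)
  case Nil
  then show ?case using alternating_adjacent[OF f(2)] by simp
next
  case (Cons y mid)
  interpret V: vectorspace real_ring V by fact
  have "f (pre @ x # y # mid @ x # post) = \<ominus>\<^bsub>V\<^esub> f ((pre @ [y]) @ x # mid @ x # post)"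
    using alternating_swap[OF V h f, of pre x y "mid @ x # post"] Cons.prems by simp
  also have "\<dots> = \<zero>\<^bsub>V\<^esub>" using Cons.IH[of "pre @ [y]"] Cons.prems by simp
  finally show ?case by simp
qed

context real_lie_algebra
begin

lemma real_vs_g: "real_vs g" ..

lemma bracket_closed: "x \<in> carrier g \<Longrightarrow> y \<in> carrier g \<Longrightarrow> bracket g x y \<in> carrier g"
  using bracket_left_linear lin_closed by fastforce

lemma bracket_skew:
  assumes "x \<in> carrier g" "y \<in> carrier g"
  shows "bracket g x y = \<ominus>\<^bsub>g\<^esub> bracket g y x"
proof -
  let ?s = "x \<oplus>\<^bsub>g\<^esub> y"
  have "bracket g ?s ?s = (bracket g x x \<oplus>\<^bsub>g\<^esub> bracket g y x) \<oplus>\<^bsub>g\<^esub> (bracket g x y \<oplus>\<^bsub>g\<^esub> bracket g y y)"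
    using assms lin_add[OF bracket_left_linear] lin_add[OF bracket_right_linear] by simp
  then have "bracket g y x \<oplus>\<^bsub>g\<^esub> bracket g x y = \<zero>\<^bsub>g\<^esub>"
    using assms bracket_closed by (simp add: bracket_self)
  then show ?thesis using assms bracket_closed by (simp add: M.minus_equality M.a_comm)
qed

text \<open>
  The Jacobi identity in the form stating that the adjoint action is a representation.
\<close>

lemma jacobi_minus:
  assumes "x \<in> carrier g" "y \<in> carrier g" "z \<in> carrier g"
  shows "bracket g (bracket g x y) z = bracket g x (bracket g y z) \<ominus>\<^bsub>g\<^esub> bracket g y (bracket g x z)"
proof -
  have neg: "bracket g z' (bracket g x' y') = \<ominus>\<^bsub>g\<^esub> bracket g (bracket g x' y') z'"
    "bracket g x' (bracket g y' z') = \<ominus>\<^bsub>g\<^esub> bracket g x' (bracket g z' y')"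
    if "x' \<in> carrier g" "y' \<in> carrier g" "z' \<in> carrier g" for x' y' z'
    using that bracket_skew bracket_closed lin_neg[OF real_vs_g real_vs_g bracket_right_linear] by metis+
  have "bracket g x (bracket g y z) \<oplus>\<^bsub>g\<^esub> \<ominus>\<^bsub>g\<^esub> bracket g y (bracket g x z)
      \<oplus>\<^bsub>g\<^esub> \<ominus>\<^bsub>g\<^esub> bracket g (bracket g x y) z = \<zero>\<^bsub>g\<^esub>"
    using jacobi[OF assms] assms neg(1)[of x y z] neg(2)[of y z x] by simp
  then show ?thesis using assms bracket_closed
    by (metis a_minus_def M.a_inv_closed M.add.m_closed M.minus_equality M.minus_minus)
qed

end

locale lie_representation = h: real_lie_algebra h + V: vectorspace real_ring V
  for h :: "'a lie_alg" and V :: "(real, 'v, 'n) module_scheme" (structure) +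
  fixes r :: "'a \<Rightarrow> 'v \<Rightarrow> 'v"
  assumes rep_lin: "x \<in> carrier h \<Longrightarrow> r x \<in> lin V V"
    and rep_lin_left: "v \<in> carrier V \<Longrightarrow> (\<lambda>x. r x v) \<in> lin h V"
    and rep_bracket: "x \<in> carrier h \<Longrightarrow> y \<in> carrier h \<Longrightarrow> v \<in> carrier V \<Longrightarrow>
      r (bracket h x y) v = r x (r y v) \<ominus> r y (r x v)"
begin

abbreviation L where "L \<equiv> lie_deriv h V r"
abbreviation D where "D \<equiv> cartan_diff h V r"

text \<open>
  As a rewrite rule the general \<open>multilinear_closed\<close> cannot be applied, since its conclusion does not
  determine the Lie algebra; here it is fixed.
\<close>

lemma ml_closed: "multilinear h V f \<Longrightarrow> set xs \<subseteq> carrier h \<Longrightarrow> f xs \<in> carrier V"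
  by (rule multilinear_closed)

lemma real_vs_V: "real_vs V" and real_vs_h: "real_vs h" ..

lemmas bracket_closed = h.bracket_closed and jacobi_minus = h.jacobi_minus

lemma rep_closed: "x \<in> carrier h \<Longrightarrow> v \<in> carrier V \<Longrightarrow> r x v \<in> carrier V"
  using rep_lin lin_closed by fastforce

lemma L_closed:
  "valued h V f \<Longrightarrow> x \<in> carrier h \<Longrightarrow> set zs \<subseteq> carrier h \<Longrightarrow> L x f zs \<in> carrier V"
proof (induction zs arbitrary: f)
  case Nil then show ?case by (simp add: rep_closed)
next
  case (Cons y ys)
  have "L x (\<lambda>zs. f (y # zs)) ys \<in> carrier V" using Cons.prems by (intro Cons.IH) auto
  moreover have "f (bracket h x y # ys) \<in> carrier V" using Cons.prems bracket_closed by auto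
  ultimately show ?case by simp
qed

lemma D_closed: "valued h V f \<Longrightarrow> set zs \<subseteq> carrier h \<Longrightarrow> D f zs \<in> carrier V"
proof (induction zs arbitrary: f)
  case Nil then show ?case by simp
next
  case (Cons y ys)
  have "D (\<lambda>zs. f (y # zs)) ys \<in> carrier V" using Cons.prems by (intro Cons.IH) auto
  then show ?case using Cons.prems L_closed by simp
qed

text \<open>
  Linear dependence of a family of functions on a parameter passes to \<open>L\<^sub>x\<close> and \<open>d\<close>. The parameter
  may be an argument of the function, which yields multilinearity, or the cochain itself, which
  yields linearity of the differential.
\<close>

lemma L_parametric:
  assumes "\<And>zs. set zs \<subseteq> carrier h \<Longrightarrow> (\<lambda>t. F t zs) \<in> lin X V" "x \<in> carrier h" "set zs \<subseteq> carrier h"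
  shows "(\<lambda>t. L x (F t) zs) \<in> lin X V"
  using assms
proof (induction zs arbitrary: F)
  case Nil
  have "(\<lambda>t. F t []) \<in> lin X V" using Nil.prems(1)[of "[]"] by simp
  from lin_compose[OF this rep_lin[OF Nil.prems(2)]] show ?case by simp
next
  case (Cons y ys)
  have "(\<lambda>t. L x (\<lambda>zs. F t (y # zs)) ys) \<in> lin X V" using Cons.prems by (intro Cons.IH) auto
  moreover have "(\<lambda>t. F t (bracket h x y # ys)) \<in> lin X V" using Cons.prems bracket_closed by auto
  ultimately show ?case by (simp add: lin_diff real_vs_V)
qed

lemma D_parametric:
  assumes "\<And>zs. set zs \<subseteq> carrier h \<Longrightarrow> (\<lambda>t. F t zs) \<in> lin X V" "set zs \<subseteq> carrier h"
  shows "(\<lambda>t. D (F t) zs) \<in> lin X V"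
  using assms
proof (induction zs arbitrary: F)
  case Nil then show ?case by (simp add: lin_const_zero real_vs_V)
next
  case (Cons y ys)
  have "(\<lambda>t. D (\<lambda>zs. F t (y # zs)) ys) \<in> lin X V" using Cons.prems by (intro Cons.IH) auto
  then show ?case using Cons.prems by (simp add: lin_diff real_vs_V L_parametric)
qed

lemma L_minus:
  assumes "valued h V f" "valued h V g" "x \<in> carrier h" "set zs \<subseteq> carrier h"
  shows "L x (\<lambda>zs. f zs \<ominus> g zs) zs = L x f zs \<ominus> L x g zs"
  using assms
proof (induction zs arbitrary: f g)
  case Nil
  then show ?case using lin_minus[OF real_vs_V real_vs_V rep_lin] by simp
next
  case (Cons y ys)
  have 1: "valued h V (\<lambda>zs. f (y # zs))" "valued h V (\<lambda>zs. g (y # zs))"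
    using Cons.prems by auto
  have "f (bracket h x y # ys) \<in> carrier V" "g (bracket h x y # ys) \<in> carrier V"
    using Cons.prems bracket_closed by auto
  then show ?case using Cons.IH[OF 1] Cons.prems 1 by (simp add: V.minus_minus_swap L_closed)
qed

lemma D_minus:
  assumes "valued h V f" "valued h V g" "set zs \<subseteq> carrier h"
  shows "D (\<lambda>zs. f zs \<ominus> g zs) zs = D f zs \<ominus> D g zs"
  using assms
proof (induction zs arbitrary: f g)
  case Nil
  then show ?case by (simp add: V.M.r_neg a_minus_def)
next
  case (Cons y ys)
  have 1: "valued h V (\<lambda>zs. f (y # zs))" "valued h V (\<lambda>zs. g (y # zs))"
    using Cons.prems by auto
  then show ?case using Cons.IH[OF 1] Cons.prems by (simp add: V.minus_minus_swap L_closed D_closed L_minus)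
qed

lemma L_lin_left:
  assumes "multilinear h V f" "set zs \<subseteq> carrier h"
  shows "(\<lambda>x. L x f zs) \<in> lin h V"
  using assms
proof (induction zs arbitrary: f)
  case Nil then show ?case by (simp add: rep_lin_left ml_closed)
next
  case (Cons y ys)
  have "(\<lambda>x. f (bracket h x y # ys)) \<in> lin h V"
    using Cons.prems by (intro lin_compose[OF h.bracket_left_linear multilinear_head[OF Cons.prems(1)]]) auto
  then show ?case using Cons multilinear_Cons[OF Cons.prems(1)] by (simp add: lin_diff real_vs_V)
qed

lemma multilinear_L:
  assumes f: "multilinear h V f" and x: "x \<in> carrier h"
  shows "multilinear h V (L x f)"
proof (rule multilinearI)
  show "L x f xs \<in> carrier V" if "set xs \<subseteq> carrier h" for xs
    using f x that by (auto intro!: L_closed simp: ml_closed)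
  show "(\<lambda>y. L x f (pre @ y # post)) \<in> lin h V" if "set pre \<subseteq> carrier h" "set post \<subseteq> carrier h" for pre post
    using that f
  proof (induction pre arbitrary: f)
    case Nil
    have "(\<lambda>y. f (bracket h x y # post)) \<in> lin h V"
      using x Nil by (intro lin_compose[OF h.bracket_right_linear multilinear_head[OF Nil(3)]]) auto
    then show ?case using Nil x
      by (auto intro!: lin_diff real_vs_V L_parametric multilinear_head)
  next
    case (Cons z pre)
    have "(\<lambda>y. f ((bracket h x z # pre) @ y # post)) \<in> lin h V"
      using x Cons.prems bracket_closed by (intro multilinear_lin[OF Cons.prems(3)]) auto
    then show ?case using Cons.IH[of "\<lambda>zs. f (z # zs)"] multilinear_Cons[OF Cons.prems(3)] Cons.prems
      by (simp add: lin_diff real_vs_V)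
  qed
qed

lemma multilinear_D:
  assumes f: "multilinear h V f"
  shows "multilinear h V (D f)"
proof (rule multilinearI)
  show "D f xs \<in> carrier V" if "set xs \<subseteq> carrier h" for xs
    using f that by (auto intro!: D_closed simp: ml_closed)
  show "(\<lambda>y. D f (pre @ y # post)) \<in> lin h V" if "set pre \<subseteq> carrier h" "set post \<subseteq> carrier h" for pre post
    using that f
  proof (induction pre arbitrary: f)
    case Nil
    then show ?case
      by (auto intro!: lin_diff real_vs_V D_parametric multilinear_head L_lin_left)
  next
    case (Cons z pre)
    then show ?case using Cons.IH[of "\<lambda>zs. f (z # zs)"] multilinear_Cons[OF Cons.prems(3)]
        multilinear_lin[OF multilinear_L[OF Cons.prems(3)]]
      by (simp add: lin_diff real_vs_V)
  qed
qed

lemma L_zero: "(\<And>ys. set ys \<subseteq> carrier h \<Longrightarrow> length ys = length zs \<Longrightarrow> f ys = \<zero>) \<Longrightarrow> x \<in> carrier h \<Longrightarrow>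
    set zs \<subseteq> carrier h \<Longrightarrow> L x f zs = \<zero>"
proof (induction zs arbitrary: f)
  case Nil then show ?case using lin_zero[OF real_vs_V real_vs_V rep_lin] by simp
next
  case (Cons y ys)
  then have "L x (\<lambda>zs. f (y # zs)) ys = \<zero>" by (intro Cons.IH) auto
  moreover have "f (bracket h x y # ys) = \<zero>" using Cons.prems bracket_closed by simp
  ultimately show ?case by (simp add: a_minus_def)
qed

lemma D_zero: "(\<And>ys. set ys \<subseteq> carrier h \<Longrightarrow> f ys = \<zero>) \<Longrightarrow>
    set zs \<subseteq> carrier h \<Longrightarrow> D f zs = \<zero>"
proof (induction zs arbitrary: f)
  case Nil then show ?case by simp
next
  case (Cons y ys)
  then have "D (\<lambda>zs. f (y # zs)) ys = \<zero>" by (intro Cons.IH) auto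
  moreover have "L y f ys = \<zero>" using Cons.prems by (intro L_zero) auto
  ultimately show ?case by (simp add: a_minus_def)
qed

lemma L_cong: "(\<And>ys. set ys \<subseteq> carrier h \<Longrightarrow> length ys = length zs \<Longrightarrow> f ys = g ys) \<Longrightarrow> x \<in> carrier h \<Longrightarrow>
    set zs \<subseteq> carrier h \<Longrightarrow> L x f zs = L x g zs"
proof (induction zs arbitrary: f g)
  case Nil then show ?case by simp
next
  case (Cons y ys)
  then have "L x (\<lambda>zs. f (y # zs)) ys = L x (\<lambda>zs. g (y # zs)) ys" by (intro Cons.IH) auto
  then show ?case using Cons.prems bracket_closed by simp
qed

lemma D_cong: "(\<And>ys. set ys \<subseteq> carrier h \<Longrightarrow> Suc (length ys) = length zs \<Longrightarrow> f ys = g ys) \<Longrightarrow>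
    set zs \<subseteq> carrier h \<Longrightarrow> D f zs = D g zs"
proof (induction zs arbitrary: f g)
  case Nil then show ?case by simp
next
  case (Cons y ys)
  then have "D (\<lambda>zs. f (y # zs)) ys = D (\<lambda>zs. g (y # zs)) ys" by (intro Cons.IH) auto
  moreover have "L y f ys = L y g ys" using Cons.prems by (intro L_cong) auto
  ultimately show ?case by simp
qed

lemma L_alternating:
  assumes f: "multilinear h V f" "alternating h V f" and x: "x \<in> carrier h"
  shows "alternating h V (L x f)"
proof (rule alternatingI)
  show "L x f (pre @ y # y # post) = \<zero>"
    if "set pre \<subseteq> carrier h" "y \<in> carrier h" "set post \<subseteq> carrier h" for pre y post
    using that f
  proof (induction pre arbitrary: f)
    case Nil
    let ?b = "bracket h x y"
    have b: "?b \<in> carrier h" using x Nil bracket_closed by simp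
    have "L x (\<lambda>zs. f (y # y # zs)) post = \<zero>"
      using Nil x alternating_adjacent[OF Nil(5), of "[]" y] by (intro L_zero) auto
    moreover have "f (?b # y # post) = \<ominus> f (y # ?b # post)"
      using alternating_swap[OF real_vs_V real_vs_h Nil(4,5), of "[]" ?b y post] Nil b by simp
    moreover have "f (y # ?b # post) \<in> carrier V" using Nil b ml_closed by fastforce
    ultimately show ?case by (simp add: a_minus_def V.M.r_neg V.M.l_neg)
  next
    case (Cons z pre)
    have "f ((bracket h x z # pre) @ y # y # post) = \<zero>"
      using Cons.prems x bracket_closed by (intro alternating_adjacent[OF Cons.prems(5)]) auto
    moreover have "L x (\<lambda>zs. f (z # zs)) (pre @ y # y # post) = \<zero>"
      using Cons.prems by (intro Cons.IH) (auto intro: multilinear_Cons alternating_Cons)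
    ultimately show ?case by (simp add: a_minus_def)
  qed
qed

lemma D_alternating:
  assumes f: "multilinear h V f" "alternating h V f"
  shows "alternating h V (D f)"
proof (rule alternatingI)
  show "D f (pre @ y # y # post) = \<zero>"
    if "set pre \<subseteq> carrier h" "y \<in> carrier h" "set post \<subseteq> carrier h" for pre y post
    using that f
  proof (induction pre arbitrary: f)
    case Nil
    have "D (\<lambda>zs. f (y # y # zs)) post = \<zero>"
      using Nil alternating_adjacent[OF Nil(5), of "[]" y] by (intro D_zero) auto
    moreover have "f (bracket h y y # post) = \<zero>"
      using lin_zero[OF real_vs_h real_vs_V multilinear_head[OF Nil(4)]] Nil h.bracket_self by simp
    moreover have "L y (\<lambda>zs. f (y # zs)) post \<in> carrier V"
      using Nil multilinear_Cons[OF Nil(4)] by (intro L_closed) (auto intro: ml_closed)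
    ultimately show ?case by (simp add: a_minus_def V.M.r_neg V.M.l_neg)
  next
    case (Cons z pre)
    have "L z f (pre @ y # y # post) = \<zero>"
      using Cons.prems by (intro alternating_adjacent[OF L_alternating]) auto
    moreover have "D (\<lambda>zs. f (z # zs)) (pre @ y # y # post) = \<zero>"
      using Cons.prems by (intro Cons.IH) (auto intro: multilinear_Cons alternating_Cons)
    ultimately show ?case by (simp add: a_minus_def)
  qed
qed

text \<open>
  The induction step contracts both sides with the first argument \<open>z\<close>; the terms in which two
  brackets are applied to \<open>z\<close> combine by the Jacobi identity and linearity in the first argument.
\<close>

lemma L_commutator:
  assumes "multilinear h V f" "x \<in> carrier h" "y \<in> carrier h" "set zs \<subseteq> carrier h"
  shows "L (bracket h x y) f zs = L x (L y f) zs \<ominus> L y (L x f) zs"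
  using assms
proof (induction zs arbitrary: f)
  case Nil then show ?case by (simp add: rep_bracket ml_closed)
next
  case (Cons z zs)
  note mem = Cons.prems(2-4)
  have ml: "multilinear h V (\<lambda>zs. f (b # zs))" if "b \<in> carrier h" for b
    using Cons.prems(1) that by (rule multilinear_Cons)
  have cl: "valued h V (L a (\<lambda>zs. f (b # zs)))" "valued h V (\<lambda>zs. f (b # zs))"
    if "a \<in> carrier h" "b \<in> carrier h" for a b
    using multilinear_L[OF ml] ml that by (auto simp: multilinear_def)
  have step: "L a (L b f) (z # zs) =
      L a (L b (\<lambda>zs. f (z # zs))) zs \<ominus> L a (\<lambda>zs. f (bracket h b z # zs)) zs
      \<ominus> (L b (\<lambda>zs. f (bracket h a z # zs)) zs \<ominus> f (bracket h b (bracket h a z) # zs))"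
    if "a \<in> carrier h" "b \<in> carrier h" for a b
    using that mem cl[OF that(2)] bracket_closed by (subst lie_deriv.simps, subst lie_deriv.simps) (simp add: L_minus)
  have "f (bracket h (bracket h x y) z # zs) =
     f (bracket h x (bracket h y z) # zs) \<ominus> f (bracket h y (bracket h x z) # zs)"
    using mem bracket_closed lin_minus[OF real_vs_h real_vs_V multilinear_head[OF Cons.prems(1)]]
    by (simp add: jacobi_minus)
  moreover have "L (bracket h x y) (\<lambda>zs. f (z # zs)) zs =
     L x (L y (\<lambda>zs. f (z # zs))) zs \<ominus> L y (L x (\<lambda>zs. f (z # zs))) zs"
    using mem ml by (intro Cons.IH) auto
  moreover have "A \<ominus> B \<ominus> (G \<ominus> F) = A \<ominus> C \<ominus> (E \<ominus> F) \<ominus> (B \<ominus> E \<ominus> (C \<ominus> G))"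
    if "A \<in> carrier V" "B \<in> carrier V" "C \<in> carrier V" "E \<in> carrier V" "F \<in> carrier V" "G \<in> carrier V" for A B C E F G
  proof -
    have "A \<ominus> C \<ominus> (E \<ominus> F) \<ominus> (B \<ominus> E \<ominus> (C \<ominus> G)) =
        A \<ominus> B \<ominus> (C \<ominus> E) \<ominus> (G \<ominus> F \<ominus> (C \<ominus> E))"
      using that by (simp add: a_minus_def V.M.minus_add V.M.a_ac)
    then show ?thesis using that by (simp add: V.minus_minus_cancel)
  qed
  ultimately show ?case
    using mem bracket_closed cl ml_closed[OF Cons.prems(1)]
    by (simp only: lie_deriv.simps(2)[of h V r "bracket h x y"] step[OF mem(1,2)] step[OF mem(2,1)])
      (simp add: L_closed cl)
qed

text \<open>
  Contracting \<open>L\<^sub>x d - d L\<^sub>x\<close> with \<open>y\<close> and using both recursions leaves \<open>[L\<^sub>x, L\<^sub>y] - L\<^sub>[\<^sub>x\<^sub>,\<^sub>y\<^sub>]\<close> and the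
  same commutator on functions of one argument less.
\<close>

lemma L_D_commute:
  assumes "multilinear h V f" "x \<in> carrier h" "set zs \<subseteq> carrier h"
  shows "L x (D f) zs = D (L x f) zs"
  using assms
proof (induction zs arbitrary: f)
  case Nil then show ?case using lin_zero[OF real_vs_V real_vs_V rep_lin] by simp
next
  case (Cons y zs)
  note mem = Cons.prems(2-3)
  have y: "y \<in> carrier h" "set zs \<subseteq> carrier h" "bracket h x y \<in> carrier h" using mem bracket_closed by auto
  have ml: "multilinear h V (\<lambda>zs. f (b # zs))" if "b \<in> carrier h" for b
    using Cons.prems(1) that by (rule multilinear_Cons)
  have cl: "valued h V g" if "multilinear h V g" for g using that by (simp add: multilinear_def)
  have "L x (D f) (y # zs) = L x (L y f) zs \<ominus> L x (D (\<lambda>zs. f (y # zs))) zs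
      \<ominus> (L (bracket h x y) f zs \<ominus> D (\<lambda>zs. f (bracket h x y # zs)) zs)"
    using Cons.prems(1) mem y by (simp add: L_minus cl multilinear_L multilinear_D ml)
  also have "L x (D (\<lambda>zs. f (y # zs))) zs = D (L x (\<lambda>zs. f (y # zs))) zs"
    using Cons.IH ml y mem by simp
  also have "L (bracket h x y) f zs = L x (L y f) zs \<ominus> L y (L x f) zs"
    using L_commutator Cons.prems(1) mem y by simp
  also have "L x (L y f) zs \<ominus> D (L x (\<lambda>zs. f (y # zs))) zs
      \<ominus> (L x (L y f) zs \<ominus> L y (L x f) zs \<ominus> D (\<lambda>zs. f (bracket h x y # zs)) zs) =
    L y (L x f) zs \<ominus> (D (L x (\<lambda>zs. f (y # zs))) zs \<ominus> D (\<lambda>zs. f (bracket h x y # zs)) zs)"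
  proof -
    have "A \<ominus> B \<ominus> (A \<ominus> C \<ominus> E) = C \<ominus> (B \<ominus> E)"
      if "A \<in> carrier V" "B \<in> carrier V" "C \<in> carrier V" "E \<in> carrier V" for A B C E
      using that by (simp add: a_minus_def V.M.minus_add V.M.a_ac V.M.r_neg1 V.M.r_neg2 V.M.r_neg V.M.l_neg)
    then show ?thesis using Cons.prems(1) mem y by (simp add: ml_closed multilinear_L multilinear_D ml)
  qed
  also have "\<dots> = D (L x f) (y # zs)"
    using Cons.prems(1) mem y by (simp add: D_minus cl multilinear_L multilinear_D ml)
  finally show ?case .
qed

text \<open>
  \<open>\<iota>\<^sub>x d d = L\<^sub>x d - d (L\<^sub>x - d \<iota>\<^sub>x) = d d \<iota>\<^sub>x\<close>.
\<close>

lemma D_D: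
  assumes "multilinear h V f" "set zs \<subseteq> carrier h"
  shows "D (D f) zs = \<zero>"
  using assms
proof (induction zs arbitrary: f)
  case Nil then show ?case by simp
next
  case (Cons x zs)
  then have mem: "x \<in> carrier h" "set zs \<subseteq> carrier h" by auto
  have ml: "multilinear h V (\<lambda>zs. f (x # zs))"
    using Cons.prems(1) mem(1) by (rule multilinear_Cons)
  have cl: "valued h V g" if "multilinear h V g" for g using that by (simp add: multilinear_def)
  have c: "D (L x f) zs \<in> carrier V"
    using mem Cons.prems by (simp add: ml_closed multilinear_L multilinear_D)
  have "D (D f) (x # zs) = D (L x f) zs \<ominus> (D (L x f) zs \<ominus> \<zero>)"
    using Cons.prems(1) mem Cons.IH[OF ml]
    by (simp add: D_minus cl multilinear_L multilinear_D ml L_D_commute)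
  also have "\<dots> = \<zero>" using c by (simp add: a_minus_def real_vs_neg_zero[OF real_vs_V] V.M.r_neg)
  finally show ?case .
qed

end

section \<open>The Chevalley--Eilenberg complex of a representation\<close>

lemma omit_0: "omit 0 (x # xs) = xs" and omit_Suc: "omit (Suc i) (x # xs) = x # omit i xs"
  by (simp_all add: omit_def)

lemma nth_in: "set xs \<subseteq> A \<Longrightarrow> i < length xs \<Longrightarrow> xs ! i \<in> A"
  using nth_mem by blast

lemma set_omit: "set xs \<subseteq> A \<Longrightarrow> set (omit i xs) \<subseteq> A"
  unfolding omit_def using set_take_subset set_drop_subset by fastforce

context lie_representation
begin

lemma finsum_shift:
  assumes "F \<in> {..<Suc n} \<rightarrow> carrier V"
  shows "(\<Oplus>i\<in>{..<Suc n}. F i) = F 0 \<oplus> (\<Oplus>i\<in>{..<n}. F (Suc i))"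
proof -
  have "(\<Oplus>i\<in>{..<Suc n}. F i) = (\<Oplus>i\<in>insert 0 (Suc ` {..<n}). F i)"
    by (simp add: lessThan_Suc_eq_insert_0)
  also have "\<dots> = F 0 \<oplus> (\<Oplus>i\<in>Suc ` {..<n}. F i)"
    using assms by (intro V.M.finsum_insert) auto
  also have "(\<Oplus>i\<in>Suc ` {..<n}. F i) = (\<Oplus>i\<in>{..<n}. F (Suc i))"
    using assms by (intro V.M.finsum_reindex) auto
  finally show ?thesis .
qed

lemma finsum_neg:
  assumes "F \<in> A \<rightarrow> carrier V"
  shows "(\<Oplus>i\<in>A. \<ominus> F i) = \<ominus> (\<Oplus>i\<in>A. F i)"
  using assms
proof (induction A rule: infinite_finite_induct)
  case (insert x A)
  then show ?case by (simp add: V.M.minus_add Pi_iff V.M.a_comm)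
qed (simp_all add: real_vs_neg_zero[OF real_vs_V])

lemma finsum_cong_V:
  assumes "\<And>i. i \<in> A \<Longrightarrow> F i = G i" "\<And>i. i \<in> A \<Longrightarrow> G i \<in> carrier V"
  shows "(\<Oplus>i\<in>A. F i) = (\<Oplus>i\<in>A. G i)"
  using assms by (intro V.M.finsum_cong') auto

text \<open>
  The recursion replaces an argument by its bracket with \<open>x\<close> in place; moving that bracket to the
  front, as in the usual formula, takes \<open>j\<close> transpositions.
\<close>

lemma L_eq_sum:
  assumes "multilinear h V f" "alternating h V f" "x \<in> carrier h" "set xs \<subseteq> carrier h"
  shows "L x f xs = r x (f xs) \<ominus>
    (\<Oplus>j\<in>{..<length xs}. (-1) ^ j \<odot> f (bracket h x (xs ! j) # omit j xs))"
  using assms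
proof (induction xs arbitrary: f)
  case Nil
  then show ?case by (simp add: a_minus_def real_vs_neg_zero[OF real_vs_V] rep_closed ml_closed)
next
  case (Cons y ys)
  let ?b = "\<lambda>j. bracket h x (ys ! j)" and ?n = "length ys"
  let ?S = "\<Oplus>j\<in>{..<?n}. (-1) ^ j \<odot> f (y # ?b j # omit j ys)"
  have y: "y \<in> carrier h" "set ys \<subseteq> carrier h" using Cons.prems by auto
  have b: "?b j \<in> carrier h" "set (omit j ys) \<subseteq> carrier h" if "j < ?n" for j
    using that y(2) nth_in[OF y(2), of j] set_omit[OF y(2), of j] bracket_closed[OF Cons.prems(3), of "ys ! j"] by auto
  have c: "(-1) ^ j \<odot> f (y # ?b j # omit j ys) \<in> carrier V" if "j < ?n" for j
    using b[OF that] y Cons.prems by (intro real_vs_smult_closed[OF real_vs_V] ml_closed) auto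
  have swap: "(-1) ^ Suc j \<odot> f (?b j # y # omit j ys) = (-1) ^ j \<odot> f (y # ?b j # omit j ys)"
    if "j < ?n" for j
  proof -
    have "f (y # ?b j # omit j ys) \<in> carrier V" using b[OF that] y Cons.prems by (intro ml_closed) auto
    then show ?thesis
      using alternating_swap[OF real_vs_V real_vs_h Cons.prems(1,2), of "[]" "?b j" y "omit j ys"] b[OF that] y
      by (simp add: real_vs_smult_neg[OF real_vs_V] V.smult_r_minus)
  qed
  have "(\<Oplus>j\<in>{..<length (y # ys)}. (-1) ^ j \<odot> f (bracket h x ((y # ys) ! j) # omit j (y # ys))) =
      f (bracket h x y # ys) \<oplus> ?S"
  proof -
    have "(-1) ^ j \<odot> f (bracket h x ((y # ys) ! j) # omit j (y # ys)) \<in> carrier V"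
      if "j < Suc ?n" for j
      using that Cons.prems bracket_closed[OF Cons.prems(3)] set_omit[OF Cons.prems(4)] nth_mem[of j "y # ys"]
      by (intro real_vs_smult_closed[OF real_vs_V] ml_closed) auto
    then show ?thesis using swap c Cons.prems bracket_closed
      by (subst length_Cons, subst finsum_shift)
        (auto simp: omit_0 omit_Suc ml_closed real_vs_one[OF real_vs_V] intro!: arg_cong2[where f = "add V"] finsum_cong_V)
  qed
  moreover have "L x (\<lambda>zs. f (y # zs)) ys = r x (f (y # ys)) \<ominus> ?S"
    using Cons.prems y by (intro Cons.IH multilinear_Cons alternating_Cons)
  moreover have "?S \<in> carrier V" using c by (intro V.M.finsum_closed) auto
  moreover have "f (y # ys) \<in> carrier V" "f (bracket h x y # ys) \<in> carrier V"
    using Cons.prems bracket_closed by (auto intro!: ml_closed[OF Cons.prems(1)])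
  ultimately show ?case using Cons.prems(3)
    by (simp add: a_minus_def V.M.minus_add V.M.a_ac rep_closed)
qed

text \<open>
  In the sum for the list \<open>x # xs\<close>, the term with index \<open>0\<close> and the pairs \<open>(0, j)\<close> form \<open>L\<^sub>x\<close>. All other
  indices and pairs are shifted by one: an index changes the sign, and a pair keeps it but has \<open>x\<close> in
  second position, so that both sums give \<open>- d \<iota>\<^sub>x\<close>.
\<close>

lemma D_eq_sum:
  assumes "multilinear h V f" "alternating h V f" "set xs \<subseteq> carrier h"
  shows "D f xs =
     (\<Oplus>i\<in>{..<length xs}. (-1) ^ i \<odot> r (xs ! i) (f (omit i xs)))
     \<oplus>
     (\<Oplus>ij\<in>{(i, j). i < j \<and> j < length xs}. (case ij of (i, j) \<Rightarrow>
        (-1) ^ (i + j) \<odot> f (bracket h (xs ! i) (xs ! j) # omit i (omit j xs))))"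
  using assms
proof (induction xs arbitrary: f)
  case Nil
  have "{(i, j). i < j \<and> j < length ([] :: 'a list)} = {}" by auto
  then show ?case by (simp del: Collect_case_prod)
next
  case (Cons x xs)
  let ?n = "length xs"
  let ?P = "{(i, j). i < j \<and> j < ?n}"
  let ?F = "\<lambda>i. (-1) ^ i \<odot> r ((x # xs) ! i) (f (omit i (x # xs)))"
  let ?G = "\<lambda>ij. case ij of (i, j) \<Rightarrow>
        (-1) ^ (i + j) \<odot> f (bracket h ((x # xs) ! i) ((x # xs) ! j) # omit i (omit j (x # xs)))"
  let ?f = "\<lambda>zs. f (x # zs)"
  let ?a = "\<lambda>i. (-1) ^ i \<odot> r (xs ! i) (?f (omit i xs))"
    and ?b = "\<lambda>ij. (case ij of (i, j) \<Rightarrow>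
        (-1) ^ (i + j) \<odot> ?f (bracket h (xs ! i) (xs ! j) # omit i (omit j xs)))"
    and ?c = "\<lambda>j. (-1) ^ j \<odot> f (bracket h x (xs ! j) # omit j xs)"
  let ?A = "\<Oplus>i\<in>{..<?n}. ?a i"
  let ?B = "\<Oplus>ij\<in>?P. ?b ij"
  let ?C = "\<Oplus>j\<in>{..<?n}. ?c j"
  have x: "x \<in> carrier h" "set xs \<subseteq> carrier h" using Cons.prems by auto
  have nth: "xs ! i \<in> carrier h" if "i < ?n" for i using that x(2) nth_mem[of i xs] by auto
  have om: "set (omit i xs) \<subseteq> carrier h" "set (omit i (omit j xs)) \<subseteq> carrier h" for i j
    using set_omit[OF x(2)] set_omit[OF set_omit[OF x(2)]] by simp_all
  have ml: "multilinear h V ?f" and al: "alternating h V ?f"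
    using Cons.prems x by (simp_all add: multilinear_Cons alternating_Cons)
  have A: "?a i \<in> carrier V" if "i < ?n" for i
    using nth[OF that] om ml by (intro real_vs_smult_closed[OF real_vs_V] rep_closed ml_closed[OF ml])
  have B: "(-1) ^ (i + j) \<odot> ?f (bracket h (xs ! i) (xs ! j) # omit i (omit j xs)) \<in> carrier V"
    if "i < j" "j < ?n" for i j
    using nth[of i] nth[of j] om that bracket_closed
    by (intro real_vs_smult_closed[OF real_vs_V] ml_closed[OF ml]) auto
  have C: "?c j \<in> carrier V" if "j < ?n" for j
    using nth[OF that] om x bracket_closed Cons.prems
    by (intro real_vs_smult_closed[OF real_vs_V] ml_closed) auto
  have f0: "r x (f xs) \<in> carrier V" using rep_closed[OF x(1) ml_closed[OF Cons.prems(1) x(2)]] .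
  have sums: "?A \<in> carrier V" "?B \<in> carrier V" "?C \<in> carrier V"
    using A B C by (auto intro!: V.M.finsum_closed)
  have F: "(\<Oplus>i\<in>{..<length (x # xs)}. ?F i) = r x (f xs) \<ominus> ?A"
  proof -
    have FS: "?F (Suc i) = \<ominus> ?a i" if "i < ?n" for i
      using nth[OF that] om ml
      by (simp add: omit_Suc real_vs_smult_neg[OF real_vs_V] rep_closed ml_closed[OF ml])
    have F0: "?F 0 = r x (f xs)" using f0 by (simp add: omit_0 real_vs_one[OF real_vs_V])
    have "?F i \<in> carrier V" if "i < Suc ?n" for i
      using that A F0 FS f0 by (cases i) simp_all
    then have "(\<Oplus>i\<in>{..<length (x # xs)}. ?F i) = ?F 0 \<oplus> (\<Oplus>i\<in>{..<?n}. ?F (Suc i))"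
      by (subst length_Cons, subst finsum_shift) auto
    also have "(\<Oplus>i\<in>{..<?n}. ?F (Suc i)) = (\<Oplus>i\<in>{..<?n}. \<ominus> ?a i)"
      using FS A by (intro finsum_cong_V) auto
    also have "\<dots> = \<ominus> ?A" using A by (intro finsum_neg) auto
    finally show ?thesis unfolding F0 a_minus_def .
  qed
  have G: "(\<Oplus>ij\<in>{(i, j). i < j \<and> j < length (x # xs)}. ?G ij) = \<ominus> ?C \<ominus> ?B"
  proof -
    let ?p = "\<lambda>j. (0 :: nat, Suc j)" and ?q = "\<lambda>(i, j). (Suc i, Suc j)"
    have split: "{(i, j). i < j \<and> j < length (x # xs)} = ?p ` {..<?n} \<union> ?q ` ?P"
    proof (intro equalityI subsetI)
      fix ij assume "ij \<in> {(i, j). i < j \<and> j < length (x # xs)}"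
      then obtain i j where ij: "ij = (i, j)" "i < j" "j < Suc ?n" by auto
      then obtain j' where j': "j = Suc j'" "j' < ?n" by (cases j) auto
      show "ij \<in> ?p ` {..<?n} \<union> ?q ` ?P" using ij j' by (cases i) (auto simp: image_iff)
    qed auto
    have fin: "finite ?P" by (rule finite_subset[of _ "{..<?n} \<times> {..<?n}"]) auto
    have inj: "inj_on ?q ?P" by (auto simp: inj_on_def)
    have Gp: "?G (?p j) = \<ominus> ?c j" if "j < ?n" for j
      using nth[OF that] om x bracket_closed Cons.prems
      by (simp add: omit_Suc omit_0 real_vs_smult_neg[OF real_vs_V] ml_closed)
    have Gq: "?G (?q ij) = \<ominus> ?b ij" if "ij \<in> ?P" for ij
    proof -
      obtain i j where ij: "ij = (i, j)" "i < j" "j < ?n" using \<open>ij \<in> ?P\<close> by auto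
      let ?w = "bracket h (xs ! i) (xs ! j)" and ?o = "omit i (omit j xs)"
      have b: "?w \<in> carrier h" using ij nth bracket_closed by auto
      then have "f (?w # x # ?o) = \<ominus> f (x # ?w # ?o)" "f (x # ?w # ?o) \<in> carrier V"
        using alternating_swap[OF real_vs_V real_vs_h Cons.prems(1,2), of "[]" ?w x ?o] om x
          ml_closed[OF Cons.prems(1), of "x # ?w # ?o"]
        by simp_all
      then show ?thesis using ij by (simp add: omit_Suc V.smult_r_minus)
    qed
    have Gc: "?G ij \<in> carrier V" if "ij \<in> ?p ` {..<?n} \<union> ?q ` ?P" for ij
      using that Gp Gq C B by auto
    have "(\<Oplus>ij\<in>{(i, j). i < j \<and> j < length (x # xs)}. ?G ij) =
        (\<Oplus>ij\<in>?p ` {..<?n}. ?G ij) \<oplus> (\<Oplus>ij\<in>?q ` ?P. ?G ij)"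
      unfolding split using fin Gc by (intro V.M.finsum_Un_disjoint) auto
    also have "(\<Oplus>ij\<in>?p ` {..<?n}. ?G ij) = (\<Oplus>j\<in>{..<?n}. ?G (?p j))"
      using Gc by (intro V.M.finsum_reindex) (auto simp: inj_on_def)
    also have "\<dots> = (\<Oplus>j\<in>{..<?n}. \<ominus> ?c j)"
      using Gp C by (intro finsum_cong_V) auto
    also have "\<dots> = \<ominus> ?C" using C by (intro finsum_neg) auto
    also have "(\<Oplus>ij\<in>?q ` ?P. ?G ij) = (\<Oplus>ij\<in>?P. ?G (?q ij))"
      using Gc inj by (intro V.M.finsum_reindex) auto
    also have "\<dots> = (\<Oplus>ij\<in>?P. \<ominus> ?b ij)"
      using Gq B by (intro finsum_cong_V) auto
    also have "\<dots> = \<ominus> ?B" using B by (intro finsum_neg) auto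
    finally show ?thesis unfolding a_minus_def .
  qed
  have "D f (x # xs) = r x (f xs) \<ominus> ?C \<ominus> (?A \<oplus> ?B)"
    using Cons.IH[OF ml al x(2)] L_eq_sum[OF Cons.prems(1,2) x] by simp
  also have "\<dots> = (r x (f xs) \<ominus> ?A) \<oplus> (\<ominus> ?C \<ominus> ?B)"
    using f0 sums by (simp add: a_minus_def V.M.minus_add V.M.a_ac)
  finally show ?case unfolding F G .
qed

end

lemma tuples_iff: "xs \<in> tuples p h \<longleftrightarrow> length xs = p \<and> set xs \<subseteq> carrier h"
  by (auto simp: tuples_def)

lemma cochain_space_real_vs:
  assumes V: "real_vs V" and h: "real_vs h"
  shows "real_vs (cochain_space p h V)"
proof -
  interpret V: vectorspace real_ring V by fact
  have upd: "xs[i := x] \<in> tuples p h" if "xs \<in> tuples p h" "x \<in> carrier h" for xs i x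
    using that set_update_subset_insert[of xs i x] by (auto simp: tuples_def)
  let ?M = "cochain_space p h V"
  have zero_c: "\<zero>\<^bsub>?M\<^esub> \<in> carrier ?M"
    by (auto simp: cochain_space_def upd lin_const_zero[OF V] cong: lin_cong[OF h])
  have add_c: "f \<oplus>\<^bsub>?M\<^esub> g \<in> carrier ?M" if "f \<in> carrier ?M" "g \<in> carrier ?M" for f g
    using that by (auto simp: cochain_space_def upd lin_plus[OF V] PiE_mem cong: lin_cong[OF h])
  have smult_c: "c \<odot>\<^bsub>?M\<^esub> f \<in> carrier ?M" if "f \<in> carrier ?M" for f c
    using that V by (auto simp: cochain_space_def upd lin_smult_left[OF V] PiE_mem real_vs_smult_zero real_vs_smult_closed cong: lin_cong[OF h])
  show "real_vs ?M"
    by (rule pointwise_vectorspace[OF V _ _ _ _ zero_c add_c smult_c, where S = "tuples p h"])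
      (auto simp: cochain_space_def)
qed

text \<open>
  A cochain is \<open>undefined\<close> outside the lists of its degree, whereas the calculus above is about
  functions with values in the module on all lists.
\<close>

definition extend_zero ::
  "nat \<Rightarrow> (real, 'a, 'm) module_scheme \<Rightarrow> (real, 'v, 'n) module_scheme \<Rightarrow> ('a list \<Rightarrow> 'v) \<Rightarrow> 'a list \<Rightarrow> 'v" where
  "extend_zero p h V \<omega> xs = (if xs \<in> tuples p h then \<omega> xs else \<zero>\<^bsub>V\<^esub>)"

lemma cochain_spaceD:
  assumes "\<omega> \<in> carrier (cochain_space p h V)"
  shows "\<And>xs. xs \<in> tuples p h \<Longrightarrow> \<omega> xs \<in> carrier V"
    and "\<And>xs i. xs \<in> tuples p h \<Longrightarrow> i < p \<Longrightarrow> (\<lambda>x. \<omega> (xs[i := x])) \<in> lin h V"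
    and "\<And>xs i j. xs \<in> tuples p h \<Longrightarrow> i < j \<Longrightarrow> j < p \<Longrightarrow> xs ! i = xs ! j \<Longrightarrow> \<omega> xs = \<zero>\<^bsub>V\<^esub>"
    and "\<omega> \<in> extensional (tuples p h)"
  using assms by (auto simp: cochain_space_def PiE_iff)

lemma multilinear_extend_zero:
  assumes V: "real_vs V" and h: "real_vs h" and \<omega>: "\<omega> \<in> carrier (cochain_space p h V)"
  shows "multilinear h V (extend_zero p h V \<omega>)"
proof (rule multilinearI)
  show "extend_zero p h V \<omega> xs \<in> carrier V" for xs
    using cochain_spaceD(1)[OF \<omega>] real_vs_zero_closed[OF V] by (simp add: extend_zero_def)
  fix pre post assume m: "set pre \<subseteq> carrier h" "set post \<subseteq> carrier h"
  show "(\<lambda>x. extend_zero p h V \<omega> (pre @ x # post)) \<in> lin h V"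
  proof (cases "Suc (length pre + length post) = p")
    case True
    let ?xs = "pre @ \<zero>\<^bsub>h\<^esub> # post"
    have "?xs \<in> tuples p h" using m True real_vs_zero_closed[OF h] by (simp add: tuples_iff)
    then have "(\<lambda>x. \<omega> (?xs[length pre := x])) \<in> lin h V"
      using True by (intro cochain_spaceD(2)[OF \<omega>]) auto
    moreover have "extend_zero p h V \<omega> (pre @ x # post) = \<omega> (?xs[length pre := x])" if "x \<in> carrier h" for x
      using that m True by (simp add: extend_zero_def tuples_iff)
    ultimately show ?thesis using lin_cong[OF h] by (metis (no_types, lifting))
  next
    case False
    then show ?thesis using lin_const_zero[OF V] by (simp add: extend_zero_def tuples_iff)
  qed
qed

lemma alternating_extend_zero:
  assumes \<omega>: "\<omega> \<in> carrier (cochain_space p h V)"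
  shows "alternating h V (extend_zero p h V \<omega>)"
proof (rule alternatingI)
  fix pre x post
  show "extend_zero p h V \<omega> (pre @ x # x # post) = \<zero>\<^bsub>V\<^esub>"
    using cochain_spaceD(3)[OF \<omega>, of "pre @ x # x # post" "length pre" "Suc (length pre)"]
    by (auto simp: extend_zero_def tuples_iff nth_append)
qed

lemma restrict_cochain:
  assumes V: "real_vs V" and h: "real_vs h" and f: "multilinear h V f" "alternating h V f"
  shows "restrict f (tuples p h) \<in> carrier (cochain_space p h V)"
proof -
  have lin: "(\<lambda>x. restrict f (tuples p h) (xs[i := x])) \<in> lin h V" if xs: "xs \<in> tuples p h" and i: "i < p" for xs i
  proof -
    have "(\<lambda>x. f (take i xs @ x # drop (Suc i) xs)) \<in> lin h V"
      using xs by (intro multilinear_lin[OF f(1)]) (auto simp: tuples_iff dest: in_set_takeD in_set_dropD)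
    moreover have "restrict f (tuples p h) (xs[i := x]) = f (take i xs @ x # drop (Suc i) xs)" if "x \<in> carrier h" for x
      using xs i that set_update_subset_insert[of xs i x]
      by (auto simp: upd_conv_take_nth_drop tuples_iff dest: in_set_takeD in_set_dropD)
    ultimately show ?thesis using lin_cong[OF h] by (metis (no_types, lifting))
  qed
  have alt: "f xs = \<zero>\<^bsub>V\<^esub>" if xs: "xs \<in> tuples p h" and ij: "i < j" "j < p" "xs ! i = xs ! j" for xs i j
  proof -
    have l: "length xs = p" and s: "set xs \<subseteq> carrier h" using xs by (auto simp: tuples_iff)
    have "xs = take i xs @ xs ! i # drop (Suc i) xs" using id_take_nth_drop[of i xs] ij(1,2) l by simp
    moreover have "drop (Suc i) xs = take (j - Suc i) (drop (Suc i) xs) @ xs ! j # drop (Suc j) xs"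
      using id_take_nth_drop[of "j - Suc i" "drop (Suc i) xs"] ij l by simp
    ultimately have *: "xs = take i xs @ xs ! i # take (j - Suc i) (drop (Suc i) xs) @ xs ! i # drop (Suc j) xs"
      using ij(3) by simp
    have "f (take i xs @ xs ! i # take (j - Suc i) (drop (Suc i) xs) @ xs ! i # drop (Suc j) xs) = \<zero>\<^bsub>V\<^esub>"
      using s ij l nth_mem[of i xs]
      by (intro alternating_repeat[OF V h f]) (auto dest!: in_set_takeD in_set_dropD)
    then show ?thesis using * by simp
  qed
  show ?thesis using lin alt multilinear_closed[OF f(1)]
    by (auto simp: cochain_space_def tuples_iff[of _ p])
qed

lemma cochain_eqI:
  "\<phi> \<in> carrier (cochain_space p h V) \<Longrightarrow> \<psi> \<in> carrier (cochain_space p h V) \<Longrightarrow>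
    (\<And>xs. xs \<in> tuples p h \<Longrightarrow> \<phi> xs = \<psi> xs) \<Longrightarrow> \<phi> = \<psi>"
  by (metis cochain_spaceD(4) extensionalityI)

lemma pullback_cochain:
  assumes V: "real_vs V" and h: "real_vs h" and h': "real_vs h'" and T: "T \<in> lin h' h"
    and \<omega>: "\<omega> \<in> carrier (cochain_space p h V)"
  shows "(\<lambda>xs\<in>tuples p h'. \<omega> (map T xs)) \<in> carrier (cochain_space p h' V)"
proof -
  let ?f = "extend_zero p h V \<omega>"
  have ml: "multilinear h V ?f" and al: "alternating h V ?f"
    by (simp_all add: multilinear_extend_zero[OF V h \<omega>] alternating_extend_zero[OF \<omega>])
  have T': "set (map T xs) \<subseteq> carrier h" if "set xs \<subseteq> carrier h'" for xs
    using that lin_closed[OF T] by auto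
  have "multilinear h' V (\<lambda>xs. ?f (map T xs))"
  proof (rule multilinearI)
    show "?f (map T xs) \<in> carrier V" if "set xs \<subseteq> carrier h'" for xs
      using multilinear_closed[OF ml T'[OF that]] .
    show "(\<lambda>x. ?f (map T (pre @ x # post))) \<in> lin h' V" if "set pre \<subseteq> carrier h'" "set post \<subseteq> carrier h'" for pre post
      using lin_compose[OF T multilinear_lin[OF ml T'[OF that(1)] T'[OF that(2)]]] by simp
  qed
  moreover have "alternating h' V (\<lambda>xs. ?f (map T xs))"
  proof (rule alternatingI)
    show "?f (map T (pre @ x # x # post)) = \<zero>\<^bsub>V\<^esub>"
      if "set pre \<subseteq> carrier h'" "x \<in> carrier h'" "set post \<subseteq> carrier h'" for pre x post
      using alternating_adjacent[OF al T'[OF that(1)] lin_closed[OF T that(2)] T'[OF that(3)]] by simp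
  qed
  ultimately have "restrict (\<lambda>xs. ?f (map T xs)) (tuples p h') \<in> carrier (cochain_space p h' V)"
    by (rule restrict_cochain[OF V h'])
  moreover have "restrict (\<lambda>xs. ?f (map T xs)) (tuples p h') = (\<lambda>xs\<in>tuples p h'. \<omega> (map T xs))"
    using T' by (intro restrict_ext) (simp add: extend_zero_def tuples_iff)
  ultimately show ?thesis by simp
qed

lemma cochain_space_simps:
  "\<zero>\<^bsub>cochain_space p h V\<^esub> = (\<lambda>xs\<in>tuples p h. \<zero>\<^bsub>V\<^esub>)"
  "\<phi> \<oplus>\<^bsub>cochain_space p h V\<^esub> \<psi> = (\<lambda>xs\<in>tuples p h. \<phi> xs \<oplus>\<^bsub>V\<^esub> \<psi> xs)"
  "c \<odot>\<^bsub>cochain_space p h V\<^esub> \<phi> = (\<lambda>xs\<in>tuples p h. c \<odot>\<^bsub>V\<^esub> \<phi> xs)"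
  by (simp_all add: cochain_space_def)

lemma extend_zero_lin:
  assumes V: "real_vs V"
  shows "(\<lambda>\<omega>. extend_zero p h V \<omega> xs) \<in> lin (cochain_space p h V) V"
proof -
  interpret V: vectorspace real_ring V by fact
  show ?thesis
    by (rule linI) (auto simp: extend_zero_def cochain_space_simps cochain_spaceD(1) real_vs_smult_zero[OF V])
qed

context lie_representation
begin

lemma ce_diff_eq:
  assumes \<omega>: "\<omega> \<in> carrier (cochain_space p h V)" and xs: "xs \<in> tuples (Suc p) h"
  shows "ce_diff h V r p \<omega> xs = D (extend_zero p h V \<omega>) xs"
proof -
  let ?f = "extend_zero p h V \<omega>"
  note ml = multilinear_extend_zero[OF real_vs_V real_vs_h \<omega>] and al = alternating_extend_zero[OF \<omega>]
  have l: "length xs = Suc p" and s: "set xs \<subseteq> carrier h" using xs by (auto simp: tuples_iff)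
  have om: "?f (omit i xs) = \<omega> (omit i xs)" if "i < Suc p" for i
    using that l set_omit[OF s, of i] by (auto simp: extend_zero_def tuples_iff omit_def)
  have om2: "?f (bracket h (xs ! i) (xs ! j) # omit i (omit j xs)) =
     \<omega> (bracket h (xs ! i) (xs ! j) # omit i (omit j xs))" if "i < j" "j < Suc p" for i j
    using that l set_omit[OF set_omit[OF s, of j], of i] nth_in[OF s, of i] nth_in[OF s, of j] bracket_closed
    by (auto simp: extend_zero_def tuples_iff omit_def)
  have "ce_diff h V r p \<omega> xs =
     (\<Oplus>i\<in>{..<Suc p}. (-1) ^ i \<odot> r (xs ! i) (\<omega> (omit i xs)))
     \<oplus>
     (\<Oplus>ij\<in>{(i, j). i < j \<and> j < Suc p}. (case ij of (i, j) \<Rightarrow>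
        (-1) ^ (i + j) \<odot> \<omega> (bracket h (xs ! i) (xs ! j) # omit i (omit j xs))))"
    using xs by (simp add: ce_diff_def)
  also have "\<dots> =
     (\<Oplus>i\<in>{..<Suc p}. (-1) ^ i \<odot> r (xs ! i) (?f (omit i xs)))
     \<oplus>
     (\<Oplus>ij\<in>{(i, j). i < j \<and> j < Suc p}. (case ij of (i, j) \<Rightarrow>
        (-1) ^ (i + j) \<odot> ?f (bracket h (xs ! i) (xs ! j) # omit i (omit j xs))))"
  proof (intro arg_cong2[where f = "add V"] finsum_cong_V)
    show "(-1) ^ i \<odot> r (xs ! i) (?f (omit i xs)) \<in> carrier V" if "i \<in> {..<Suc p}" for i
      using that l nth_in[OF s, of i] set_omit[OF s, of i]
      by (auto intro!: real_vs_smult_closed[OF real_vs_V] rep_closed ml_closed[OF ml])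
    show "(case ij of (i, j) \<Rightarrow>
        (-1) ^ (i + j) \<odot> ?f (bracket h (xs ! i) (xs ! j) # omit i (omit j xs))) \<in> carrier V"
      if "ij \<in> {(i, j). i < j \<and> j < Suc p}" for ij
      using that l nth_in[OF s] set_omit[OF set_omit[OF s]] bracket_closed
      by (auto intro!: real_vs_smult_closed[OF real_vs_V] ml_closed[OF ml] simp: subset_iff)
  qed (auto simp: om om2)
  also have "\<dots> = D ?f xs" using D_eq_sum[OF ml al s] l by simp
  finally show ?thesis .
qed

text \<open>
  On lists of length \<open>p + 1\<close> the recursion only evaluates the function on lists of length \<open>p\<close>.
\<close>

lemma ce_diff_restrict:
  assumes f: "multilinear h V f" "alternating h V f"
  shows "ce_diff h V r p (restrict f (tuples p h)) = restrict (D f) (tuples (Suc p) h)"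
proof
  fix xs
  show "ce_diff h V r p (restrict f (tuples p h)) xs = restrict (D f) (tuples (Suc p) h) xs"
  proof (cases "xs \<in> tuples (Suc p) h")
    case True
    have "D (extend_zero p h V (restrict f (tuples p h))) xs = D f xs"
      using True by (intro D_cong) (auto simp: extend_zero_def tuples_iff)
    then show ?thesis using True ce_diff_eq[OF restrict_cochain[OF real_vs_V real_vs_h f]] by simp
  qed (simp add: ce_diff_def)
qed

lemma cochain_eq_restrict:
  assumes "\<omega> \<in> carrier (cochain_space p h V)"
  shows "\<omega> = restrict (extend_zero p h V \<omega>) (tuples p h)"
  using cochain_spaceD(4)[OF assms] by (auto simp: extend_zero_def fun_eq_iff extensional_def)

lemma ce_diff_eq_restrict:
  assumes "\<omega> \<in> carrier (cochain_space p h V)"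
  shows "ce_diff h V r p \<omega> = restrict (D (extend_zero p h V \<omega>)) (tuples (Suc p) h)"
  using ce_diff_restrict[OF multilinear_extend_zero[OF real_vs_V real_vs_h assms] alternating_extend_zero[OF assms]]
  by (subst cochain_eq_restrict[OF assms])

lemma ce_diff_closed:
  assumes "\<omega> \<in> carrier (cochain_space p h V)"
  shows "ce_diff h V r p \<omega> \<in> carrier (cochain_space (Suc p) h V)"
  unfolding ce_diff_eq_restrict[OF assms]
  by (intro restrict_cochain real_vs_V real_vs_h multilinear_D D_alternating
      multilinear_extend_zero alternating_extend_zero assms)

lemma ce_diff_lin: "ce_diff h V r p \<in> lin (cochain_space p h V) (cochain_space (Suc p) h V)"
proof -
  have D: "(\<lambda>\<omega>. D (extend_zero p h V \<omega>) xs) \<in> lin (cochain_space p h V) V" if "xs \<in> tuples (Suc p) h" for xs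
    using that by (intro D_parametric extend_zero_lin real_vs_V) (auto simp: tuples_iff)
  interpret M: vectorspace real_ring "cochain_space p h V" by (rule cochain_space_real_vs[OF real_vs_V real_vs_h])
  show ?thesis
  proof (rule linI)
    fix x y c assume x: "x \<in> carrier (cochain_space p h V)"
    show "ce_diff h V r p x \<in> carrier (cochain_space (Suc p) h V)" by (rule ce_diff_closed[OF x])
    show "ce_diff h V r p (c \<odot>\<^bsub>cochain_space p h V\<^esub> x) = c \<odot>\<^bsub>cochain_space (Suc p) h V\<^esub> ce_diff h V r p x"
      using lin_smult[OF D x] x M.smult_closed[of c x]
      by (simp add: ce_diff_eq_restrict cochain_space_simps(3)[where p = "Suc p"] cong: restrict_cong)
    assume y: "y \<in> carrier (cochain_space p h V)"
    show "ce_diff h V r p (x \<oplus>\<^bsub>cochain_space p h V\<^esub> y) =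
        ce_diff h V r p x \<oplus>\<^bsub>cochain_space (Suc p) h V\<^esub> ce_diff h V r p y"
      using lin_add[OF D x y] x y
      by (simp add: ce_diff_eq_restrict cochain_space_simps(2)[where p = "Suc p"] cong: restrict_cong)
  qed
qed

lemma ce_diff_ce_diff:
  assumes "\<omega> \<in> carrier (cochain_space p h V)"
  shows "ce_diff h V r (Suc p) (ce_diff h V r p \<omega>) = \<zero>\<^bsub>cochain_space (Suc (Suc p)) h V\<^esub>"
proof -
  note ml = multilinear_extend_zero[OF real_vs_V real_vs_h assms] and al = alternating_extend_zero[OF assms]
  show ?thesis
    unfolding ce_diff_eq_restrict[OF assms] ce_diff_restrict[OF multilinear_D[OF ml] D_alternating[OF ml al]]
      cochain_space_simps
    using D_D[OF ml] by (intro restrict_ext) (simp add: tuples_iff)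
qed

theorem cochain_complex_ce_cx: "cochain_complex (ce_cx h V r)"
  unfolding cochain_complex_def ce_cx_def
  using cochain_space_real_vs[OF real_vs_V real_vs_h] ce_diff_lin ce_diff_ce_diff
  by (simp add: linear_mapI)

end

section \<open>Constructions on representations\<close>

lemma (in real_lie_algebra) adjoint_representation: "lie_representation g g (bracket g)"
proof -
  have "bracket g (bracket g x y) v = bracket g x (bracket g y v) \<ominus>\<^bsub>g\<^esub> bracket g y (bracket g x v)"
    if "x \<in> carrier g" "y \<in> carrier g" "v \<in> carrier g" for x y v
    using that by (rule jacobi_minus)
  then show ?thesis
    by (intro lie_representation.intro lie_representation_axioms.intro real_lie_algebra_axioms real_vs_g
        bracket_right_linear bracket_left_linear)
qed

text \<open>
  The action \<open>r'\<close> need only agree with the pulled back one on the module, because the Bott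
  representation is a union over a set, which agrees with the quotient bracket on cosets only.
\<close>

lemma (in lie_representation) pullback_representation:
  assumes k: "real_lie_algebra k" and T: "T \<in> lin k h"
    and br: "\<And>x y. x \<in> carrier k \<Longrightarrow> y \<in> carrier k \<Longrightarrow> T (bracket k x y) = bracket h (T x) (T y)"
    and r': "\<And>x v. x \<in> carrier k \<Longrightarrow> v \<in> carrier V \<Longrightarrow> r' x v = r (T x) v"
  shows "lie_representation k V r'"
proof -
  interpret k: real_lie_algebra k by (rule k)
  have "lie_representation_axioms k V r'"
  proof (rule lie_representation_axioms.intro)
    show "r' x \<in> lin V V" if "x \<in> carrier k" for x
      by (rule iffD2[OF lin_cong[OF real_vs_V] rep_lin[OF lin_closed[OF T that]]]) (rule r'[OF that])
    show "(\<lambda>x. r' x v) \<in> lin k V" if "v \<in> carrier V" for v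
      by (rule iffD2[OF lin_cong[OF k.real_vs_g] lin_compose[OF T rep_lin_left[OF that]]]) (rule r'[OF _ that])
    show "r' (bracket k x y) v = r' x (r' y v) \<ominus>\<^bsub>V\<^esub> r' y (r' x v)"
      if "x \<in> carrier k" "y \<in> carrier k" "v \<in> carrier V" for x y v
      using that k.bracket_closed lin_closed[OF T] rep_closed by (simp add: r' br rep_bracket)
  qed
  then show ?thesis by (intro lie_representation.intro k) (rule real_vs_V)
qed

lemma lie_deriv_pullback:
  assumes T: "\<And>x y. x \<in> carrier k \<Longrightarrow> y \<in> carrier k \<Longrightarrow> T (bracket k x y) = bracket h (T x) (T y)"
    and r': "\<And>v. v \<in> carrier V \<Longrightarrow> r' x v = r (T x) v"
    and f: "valued k V (\<lambda>xs. f (map T xs))" and "x \<in> carrier k" "set xs \<subseteq> carrier k"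
  shows "lie_deriv k V r' x (\<lambda>xs. f (map T xs)) xs = lie_deriv h V r (T x) f (map T xs)"
  using f assms(4,5)
proof (induction xs arbitrary: f)
  case Nil
  then show ?case using r'[of "f []"] Nil(1)[rule_format, of "[]"] by simp
next
  case (Cons y ys)
  have "valued k V (\<lambda>xs. f (T y # map T xs))"
  proof (intro allI impI)
    fix xs assume "set xs \<subseteq> carrier k"
    then show "f (T y # map T xs) \<in> carrier V" using Cons.prems(1)[rule_format, of "y # xs"] Cons.prems(3) by simp
  qed
  from Cons.IH[OF this] show ?case using Cons.prems T by simp
qed

lemma cartan_diff_pullback:
  assumes T: "\<And>x y. x \<in> carrier k \<Longrightarrow> y \<in> carrier k \<Longrightarrow> T (bracket k x y) = bracket h (T x) (T y)"
    and r': "\<And>x v. x \<in> carrier k \<Longrightarrow> v \<in> carrier V \<Longrightarrow> r' x v = r (T x) v"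
    and f: "valued k V (\<lambda>xs. f (map T xs))" and "set xs \<subseteq> carrier k"
  shows "cartan_diff k V r' (\<lambda>xs. f (map T xs)) xs = cartan_diff h V r f (map T xs)"
  using f assms(4)
proof (induction xs arbitrary: f)
  case Nil
  then show ?case by simp
next
  case (Cons y ys)
  have "valued k V (\<lambda>xs. f (T y # map T xs))"
  proof (intro allI impI)
    fix xs assume "set xs \<subseteq> carrier k"
    then show "f (T y # map T xs) \<in> carrier V" using Cons.prems(1)[rule_format, of "y # xs"] Cons.prems(2) by simp
  qed
  from Cons.IH[OF this] show ?case
    using Cons.prems lie_deriv_pullback[of k T h V r' y r f ys, OF T r' Cons.prems(1)] by simp
qed

lemma pullback_lin:
  assumes V: "real_vs V" and h: "real_vs h" and k: "real_vs k" and T: "T \<in> lin k h"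
  shows "(\<lambda>\<omega>. \<lambda>xs\<in>tuples p k. \<omega> (map T xs)) \<in> lin (cochain_space p h V) (cochain_space p k V)"
proof -
  have T': "map T xs \<in> tuples p h" if "xs \<in> tuples p k" for xs
    using that lin_closed[OF T] by (auto simp: tuples_iff)
  show ?thesis
    by (rule linI) (auto simp: pullback_cochain[OF V h k T] cochain_space_simps T' intro!: restrict_ext)
qed

text \<open>
  Both \<open>canonical_incl\<close>, along the projection, and \<open>iota_star\<close>, along the inclusion of the ideal, are
  pullbacks of this kind.
\<close>

lemma (in lie_representation) pullback_cochain_map:
  assumes k: "lie_representation k V r'" and T: "T \<in> lin k h"
    and br: "\<And>x y. x \<in> carrier k \<Longrightarrow> y \<in> carrier k \<Longrightarrow> T (bracket k x y) = bracket h (T x) (T y)"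
    and r': "\<And>x v. x \<in> carrier k \<Longrightarrow> v \<in> carrier V \<Longrightarrow> r' x v = r (T x) v"
  shows "cochain_map (ce_cx h V r) (ce_cx k V r') (\<lambda>p \<omega>. \<lambda>xs\<in>tuples p k. \<omega> (map T xs))"
proof (rule cochain_mapI)
  interpret k: lie_representation k V r' by (rule k)
  show "cochain_complex (ce_cx h V r)" by (rule cochain_complex_ce_cx)
  show "cochain_complex (ce_cx k V r')" by (rule k.cochain_complex_ce_cx)
  show "(\<lambda>\<omega>. \<lambda>xs\<in>tuples p k. \<omega> (map T xs)) \<in> lin (cx_space (ce_cx h V r) p) (cx_space (ce_cx k V r') p)" for p
    unfolding ce_cx_def using pullback_lin[OF real_vs_V real_vs_h k.real_vs_h T] by simp
  show "(\<lambda>xs\<in>tuples (Suc p) k. cx_diff (ce_cx h V r) p \<omega> (map T xs)) =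
      cx_diff (ce_cx k V r') p (\<lambda>xs\<in>tuples p k. \<omega> (map T xs))"
    if "\<omega> \<in> carrier (cx_space (ce_cx h V r) p)" for p \<omega>
  proof -
    have \<omega>: "\<omega> \<in> carrier (cochain_space p h V)" using that by (simp add: ce_cx_def)
    let ?f = "extend_zero p h V \<omega>"
    have T': "map T xs \<in> tuples p h" if "xs \<in> tuples p k" for xs p
      using that lin_closed[OF T] by (auto simp: tuples_iff)
    note ml = multilinear_extend_zero[OF real_vs_V real_vs_h \<omega>]
    have val: "valued k V (\<lambda>xs. ?f (map T xs))"
    proof (intro allI impI)
      fix xs assume "set xs \<subseteq> carrier k"
      then show "?f (map T xs) \<in> carrier V" using lin_closed[OF T] by (intro ml_closed[OF ml]) auto
    qed
    note \<omega>' = pullback_cochain[OF real_vs_V real_vs_h k.real_vs_h T \<omega>]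
    have "(\<lambda>xs\<in>tuples (Suc p) k. ce_diff h V r p \<omega> (map T xs)) =
       (\<lambda>xs\<in>tuples (Suc p) k. cartan_diff k V r' (\<lambda>xs. ?f (map T xs)) xs)"
      using cartan_diff_pullback[of k T h V r' r ?f, OF br r' val] T'
      by (intro restrict_ext) (simp add: ce_diff_eq[OF \<omega>] tuples_iff)
    also have "\<dots> = ce_diff k V r' p (\<lambda>xs\<in>tuples p k. \<omega> (map T xs))"
      unfolding k.ce_diff_eq_restrict[OF \<omega>']
    proof (intro restrict_ext k.D_cong)
      fix xs ys assume "xs \<in> tuples (Suc p) k" "set ys \<subseteq> carrier k" "Suc (length ys) = length xs"
      then have "ys \<in> tuples p k" by (auto simp: tuples_iff)
      then show "?f (map T ys) = extend_zero p k V (\<lambda>xs\<in>tuples p k. \<omega> (map T xs)) ys"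
        using T' by (simp add: extend_zero_def)
    qed (simp add: tuples_iff)
    finally show ?thesis by (simp add: ce_cx_def)
  qed
qed

lemma hom_space_simps:
  "\<zero>\<^bsub>hom_space U V\<^esub> = (\<lambda>u\<in>carrier U. \<zero>\<^bsub>V\<^esub>)"
  "\<phi> \<oplus>\<^bsub>hom_space U V\<^esub> \<psi> = (\<lambda>u\<in>carrier U. \<phi> u \<oplus>\<^bsub>V\<^esub> \<psi> u)"
  "c \<odot>\<^bsub>hom_space U V\<^esub> \<phi> = (\<lambda>u\<in>carrier U. c \<odot>\<^bsub>V\<^esub> \<phi> u)"
  "carrier (hom_space U V) = lin U V \<inter> extensional (carrier U)"
  by (simp_all add: hom_space_def)

lemma hom_spaceI:
  assumes "real_vs U" "f \<in> lin U V"
  shows "restrict f (carrier U) \<in> carrier (hom_space U V)"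
  using assms lin_cong[of U "restrict f (carrier U)" f V] by (simp add: hom_space_simps)

lemma hom_space_real_vs:
  assumes U: "real_vs U" and V: "real_vs V"
  shows "real_vs (hom_space U V)"
    and "\<And>f g. f \<in> carrier (hom_space U V) \<Longrightarrow> g \<in> carrier (hom_space U V) \<Longrightarrow>
      f \<ominus>\<^bsub>hom_space U V\<^esub> g = (\<lambda>u\<in>carrier U. f u \<ominus>\<^bsub>V\<^esub> g u)"
proof -
  let ?H = "hom_space U V"
  have z: "\<zero>\<^bsub>?H\<^esub> \<in> carrier ?H"
    unfolding hom_space_simps(1) by (intro hom_spaceI U lin_const_zero V)
  have a: "f \<oplus>\<^bsub>?H\<^esub> g \<in> carrier ?H" if "f \<in> carrier ?H" "g \<in> carrier ?H" for f g
    unfolding hom_space_simps(2) using that by (intro hom_spaceI U lin_plus V) (auto simp: hom_space_simps)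
  have s: "c \<odot>\<^bsub>?H\<^esub> f \<in> carrier ?H" if "f \<in> carrier ?H" for f c
    unfolding hom_space_simps(3) using that by (intro hom_spaceI U lin_smult_left V) (auto simp: hom_space_simps)
  have sub: "carrier ?H \<subseteq> carrier U \<rightarrow>\<^sub>E carrier V"
    by (auto simp: hom_space_simps PiE_def lin_closed)
  note * = pointwise_vectorspace[OF V sub hom_space_simps(1,2,3) z a s]
  show "real_vs ?H" by (rule *(1))
  show "\<And>f g. f \<in> carrier ?H \<Longrightarrow> g \<in> carrier ?H \<Longrightarrow> f \<ominus>\<^bsub>?H\<^esub> g = (\<lambda>u\<in>carrier U. f u \<ominus>\<^bsub>V\<^esub> g u)"
    by (rule *(2))
qed

lemma lin_into_hom_space:
  assumes U: "real_vs U" and X: "real_vs X"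
    and F: "\<And>x. x \<in> carrier X \<Longrightarrow> F x \<in> lin U V"
    and lin: "\<And>u. u \<in> carrier U \<Longrightarrow> (\<lambda>x. F x u) \<in> lin X V"
  shows "(\<lambda>x. restrict (F x) (carrier U)) \<in> lin X (hom_space U V)"
  by (rule linI) (auto simp: hom_spaceI[OF U F] hom_space_simps(2,3) lin_add[OF lin] lin_smult[OF lin]
      real_vs_add_closed[OF X] intro!: restrict_ext)

text \<open>
  The terms \<open>r x (\<phi> (q y u))\<close> and \<open>r y (\<phi> (q x u))\<close> cancel in the commutator, leaving the commutator of
  the actions on \<open>V\<close>, applied after \<open>\<phi>\<close>, minus that of the actions on \<open>U\<close>, applied before it.
\<close>

lemma hom_representation:
  assumes V: "lie_representation h V r" and U: "lie_representation h U q"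
  shows "lie_representation h (hom_space U V) (\<lambda>x \<phi>. \<lambda>u\<in>carrier U. r x (\<phi> u) \<ominus>\<^bsub>V\<^esub> \<phi> (q x u))"
proof -
  interpret V: lie_representation h V r by fact
  interpret U: lie_representation h U q by fact
  let ?H = "hom_space U V"
  let ?r = "\<lambda>x \<phi>. \<lambda>u\<in>carrier U. r x (\<phi> u) \<ominus>\<^bsub>V\<^esub> \<phi> (q x u)"
  note H = hom_space_real_vs[OF U.real_vs_V V.real_vs_V]
  have HD: "\<phi> \<in> lin U V" if "\<phi> \<in> carrier ?H" for \<phi> using that by (simp add: hom_space_simps)
  have cl: "?r x \<phi> \<in> carrier ?H" if "x \<in> carrier h" "\<phi> \<in> carrier ?H" for x \<phi>
    using that by (intro hom_spaceI lin_diff lin_compose[OF HD V.rep_lin] lin_compose[OF U.rep_lin HD]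
        U.real_vs_V V.real_vs_V)
  have eval: "(\<lambda>\<phi>. \<phi> u) \<in> lin ?H V" if "u \<in> carrier U" for u
    using that by (intro linI) (auto simp: hom_space_simps lin_closed)
  have "lie_representation_axioms h ?H ?r"
  proof (rule lie_representation_axioms.intro)
    fix x y \<phi> assume x: "x \<in> carrier h"
    show "?r x \<in> lin ?H ?H"
    proof (rule lin_into_hom_space[OF U.real_vs_V H(1)])
      show "(\<lambda>u. r x (\<phi> u) \<ominus>\<^bsub>V\<^esub> \<phi> (q x u)) \<in> lin U V" if "\<phi> \<in> carrier ?H" for \<phi>
        using x that by (intro lin_diff lin_compose[OF HD V.rep_lin] lin_compose[OF U.rep_lin HD] V.real_vs_V)
      show "(\<lambda>\<phi>. r x (\<phi> u) \<ominus>\<^bsub>V\<^esub> \<phi> (q x u)) \<in> lin ?H V" if "u \<in> carrier U" for u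
        using x that by (intro lin_diff lin_compose[OF eval V.rep_lin] eval U.rep_closed V.real_vs_V)
    qed
    assume y: "y \<in> carrier h" and \<phi>: "\<phi> \<in> carrier ?H"
    note p = lin_closed[OF HD[OF \<phi>]]
    show "?r (bracket h x y) \<phi> = ?r x (?r y \<phi>) \<ominus>\<^bsub>?H\<^esub> ?r y (?r x \<phi>)"
      unfolding H(2)[OF cl[OF x cl[OF y \<phi>]] cl[OF y cl[OF x \<phi>]]]
    proof (rule restrict_ext)
      fix u assume u: "u \<in> carrier U"
      \<comment> \<open>\<open>b\<close> and \<open>c\<close> are the two mixed terms\<close>
      have AC: "(a \<ominus>\<^bsub>V\<^esub> b \<ominus>\<^bsub>V\<^esub> (c \<ominus>\<^bsub>V\<^esub> d)) \<ominus>\<^bsub>V\<^esub> (a' \<ominus>\<^bsub>V\<^esub> c \<ominus>\<^bsub>V\<^esub> (b \<ominus>\<^bsub>V\<^esub> d')) =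
          a \<ominus>\<^bsub>V\<^esub> a' \<ominus>\<^bsub>V\<^esub> (d' \<ominus>\<^bsub>V\<^esub> d)"
        if "a \<in> carrier V" "b \<in> carrier V" "c \<in> carrier V" "d \<in> carrier V" "a' \<in> carrier V" "d' \<in> carrier V"
        for a b c d a' d'
      proof -
        have "(a \<ominus>\<^bsub>V\<^esub> b \<ominus>\<^bsub>V\<^esub> (c \<ominus>\<^bsub>V\<^esub> d)) \<ominus>\<^bsub>V\<^esub> (a' \<ominus>\<^bsub>V\<^esub> c \<ominus>\<^bsub>V\<^esub> (b \<ominus>\<^bsub>V\<^esub> d')) =
           ((a \<oplus>\<^bsub>V\<^esub> d) \<ominus>\<^bsub>V\<^esub> (b \<oplus>\<^bsub>V\<^esub> c)) \<ominus>\<^bsub>V\<^esub> ((a' \<oplus>\<^bsub>V\<^esub> d') \<ominus>\<^bsub>V\<^esub> (b \<oplus>\<^bsub>V\<^esub> c))"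
          using that by (simp add: a_minus_def V.V.M.minus_add V.V.M.a_ac)
        also have "\<dots> = (a \<oplus>\<^bsub>V\<^esub> d) \<ominus>\<^bsub>V\<^esub> (a' \<oplus>\<^bsub>V\<^esub> d')"
          using that by (intro V.V.minus_minus_cancel) auto
        finally show ?thesis using that by (simp add: a_minus_def V.V.M.minus_add V.V.M.a_ac)
      qed
      have "r (bracket h x y) (\<phi> u) \<ominus>\<^bsub>V\<^esub> \<phi> (q (bracket h x y) u) =
          r x (r y (\<phi> u)) \<ominus>\<^bsub>V\<^esub> r y (r x (\<phi> u)) \<ominus>\<^bsub>V\<^esub> (\<phi> (q x (q y u)) \<ominus>\<^bsub>V\<^esub> \<phi> (q y (q x u)))"
        using x y u p U.rep_closed
        by (simp add: V.rep_bracket U.rep_bracket lin_minus[OF U.real_vs_V V.real_vs_V HD[OF \<phi>]])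
      moreover have "?r x (?r y \<phi>) u \<ominus>\<^bsub>V\<^esub> ?r y (?r x \<phi>) u =
          (r x (r y (\<phi> u)) \<ominus>\<^bsub>V\<^esub> r x (\<phi> (q y u)) \<ominus>\<^bsub>V\<^esub> (r y (\<phi> (q x u)) \<ominus>\<^bsub>V\<^esub> \<phi> (q y (q x u)))) \<ominus>\<^bsub>V\<^esub>
          (r y (r x (\<phi> u)) \<ominus>\<^bsub>V\<^esub> r y (\<phi> (q x u)) \<ominus>\<^bsub>V\<^esub> (r x (\<phi> (q y u)) \<ominus>\<^bsub>V\<^esub> \<phi> (q x (q y u))))"
        using x y u p U.rep_closed V.rep_closed
        by (simp add: lin_minus[OF V.real_vs_V V.real_vs_V V.rep_lin])
      ultimately show "r (bracket h x y) (\<phi> u) \<ominus>\<^bsub>V\<^esub> \<phi> (q (bracket h x y) u) = ?r x (?r y \<phi>) u \<ominus>\<^bsub>V\<^esub> ?r y (?r x \<phi>) u"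
        using x y u p U.rep_closed V.rep_closed by (simp add: AC)
    qed
  next
    fix \<phi> assume \<phi>: "\<phi> \<in> carrier ?H"
    show "(\<lambda>x. ?r x \<phi>) \<in> lin h ?H"
    proof (rule lin_into_hom_space[OF U.real_vs_V V.real_vs_h])
      show "(\<lambda>u. r x (\<phi> u) \<ominus>\<^bsub>V\<^esub> \<phi> (q x u)) \<in> lin U V" if "x \<in> carrier h" for x
        using that \<phi> by (intro lin_diff lin_compose[OF HD V.rep_lin] lin_compose[OF U.rep_lin HD] V.real_vs_V)
      show "(\<lambda>x. r x (\<phi> u) \<ominus>\<^bsub>V\<^esub> \<phi> (q x u)) \<in> lin h V" if "u \<in> carrier U" for u
        using that \<phi> lin_closed[OF HD[OF \<phi>]]
        by (intro lin_diff lin_compose[OF U.rep_lin_left HD] V.rep_lin_left V.real_vs_V)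
    qed
  qed
  then show ?thesis by (intro lie_representation.intro V.h.real_lie_algebra_axioms H(1))
qed

section \<open>The representations attached to an ideal\<close>

lemma quot_lie_simps:
  "carrier (quot_lie g I) = carrier (quot_vs g I)"
  "add (quot_lie g I) = add (quot_vs g I)"
  "zero (quot_lie g I) = zero (quot_vs g I)"
  "smult (quot_lie g I) = smult (quot_vs g I)"
  "bracket (quot_lie g I) = (\<lambda>X Y. \<Union>x\<in>X. \<Union>y\<in>Y. I +>\<^bsub>g\<^esub> bracket g x y)"
  by (simp_all add: quot_lie_def module.defs lie_alg.defs)

locale lie_algebra_ideal = g: real_lie_algebra g for g :: "'a lie_alg" +
  fixes I :: "'a set"
  assumes ideal: "lie_ideal I g"
begin

abbreviation Q where "Q \<equiv> quot_lie g I"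
abbreviation J where "J \<equiv> sub_lie g I"
abbreviation \<pi> where "\<pi> \<equiv> quot_proj g I"

lemma real_vs_g: "real_vs g" ..

lemma subspace_I: "lin_subspace I g"
  and bracket_I: "x \<in> carrier g \<Longrightarrow> u \<in> I \<Longrightarrow> bracket g x u \<in> I"
  using ideal by (auto simp: lie_ideal_def)

lemma I_carrier: "u \<in> I \<Longrightarrow> u \<in> carrier g"
  using subspaceD(2)[OF subspace_I] by auto

lemma bracket_I_left: "u \<in> I \<Longrightarrow> x \<in> carrier g \<Longrightarrow> bracket g u x \<in> I"
  using g.bracket_skew[of u x] bracket_I[of x u] subspace_neg[OF subspace_I] I_carrier by simp

sublocale q: quotient_space g I by (rule quotient_space.intro) (rule subspace_I)

lemma \<pi>_eq: "\<pi> x = I +>\<^bsub>g\<^esub> x" by (simp add: quot_proj_def)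

lemma carrier_Q: "carrier Q = \<pi> ` carrier g"
  by (simp add: quot_lie_simps q.carrier_quot \<pi>_eq cong: image_cong)

lemma real_vs_Q: "real_vs Q" and \<pi>_lin: "\<pi> \<in> lin g Q"
proof -
  have add: "\<pi> x \<oplus>\<^bsub>Q\<^esub> \<pi> y = \<pi> (x \<oplus>\<^bsub>g\<^esub> y)" if "x \<in> carrier g" "y \<in> carrier g" for x y
    using that lin_add[OF q.cls_lin] by (simp add: quot_lie_simps \<pi>_eq)
  have smult: "c \<odot>\<^bsub>Q\<^esub> \<pi> x = \<pi> (c \<odot>\<^bsub>g\<^esub> x)" if "x \<in> carrier g" for c x
    using that lin_smult[OF q.cls_lin] by (simp add: quot_lie_simps \<pi>_eq)
  have zero: "\<zero>\<^bsub>Q\<^esub> = \<pi> \<zero>\<^bsub>g\<^esub>"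
    using lin_zero[OF real_vs_g q.quot_vs_real_vs q.cls_lin] by (simp add: quot_lie_simps \<pi>_eq)
  show "real_vs Q" by (rule real_vs_image(1)[OF real_vs_g carrier_Q add smult zero])
  show "\<pi> \<in> lin g Q" by (rule real_vs_image(2)[OF real_vs_g carrier_Q add smult zero])
qed

lemma \<pi>_closed: "x \<in> carrier g \<Longrightarrow> \<pi> x \<in> carrier Q" by (simp add: carrier_Q)

lemma Q_cases:
  assumes "X \<in> carrier Q"
  obtains x where "x \<in> carrier g" "X = \<pi> x"
  using assms carrier_Q by auto

lemma \<pi>_eq_iff: "x \<in> carrier g \<Longrightarrow> y \<in> carrier g \<Longrightarrow> \<pi> x = \<pi> y \<longleftrightarrow> x \<ominus>\<^bsub>g\<^esub> y \<in> I"
  by (simp add: \<pi>_eq q.cls_eq_iff)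

lemma \<pi>_I: "u \<in> I \<Longrightarrow> \<pi> u = \<zero>\<^bsub>Q\<^esub>"
  using q.cls_mem[of u] I_carrier by (simp add: \<pi>_eq quot_lie_simps quot_vs_def)

text \<open>
  The bracket of the quotient is well defined because brackets with elements of the ideal, on
  either side, lie in the ideal.
\<close>

lemma \<pi>_bracket_cong:
  assumes "x \<in> carrier g" "y \<in> carrier g" "x' \<in> carrier g" "y' \<in> carrier g" "x' \<ominus>\<^bsub>g\<^esub> x \<in> I" "y' \<ominus>\<^bsub>g\<^esub> y \<in> I"
  shows "\<pi> (bracket g x' y') = \<pi> (bracket g x y)"
proof -
  have "bracket g x' (y' \<ominus>\<^bsub>g\<^esub> y) = bracket g x' y' \<ominus>\<^bsub>g\<^esub> bracket g x' y"
    using assms by (intro lin_minus[OF real_vs_g real_vs_g g.bracket_right_linear])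
  then have "\<pi> (bracket g x' y') = \<pi> (bracket g x' y)"
    using bracket_I[OF assms(3,6)] assms g.bracket_closed by (simp add: \<pi>_eq_iff)
  moreover have "bracket g (x' \<ominus>\<^bsub>g\<^esub> x) y = bracket g x' y \<ominus>\<^bsub>g\<^esub> bracket g x y"
    using assms by (intro lin_minus[OF real_vs_g real_vs_g g.bracket_left_linear])
  then have "\<pi> (bracket g x' y) = \<pi> (bracket g x y)"
    using bracket_I_left[OF assms(5,2)] assms g.bracket_closed by (simp add: \<pi>_eq_iff)
  ultimately show ?thesis by simp
qed

lemma bracket_Q:
  assumes x: "x \<in> carrier g" and y: "y \<in> carrier g"
  shows "bracket Q (\<pi> x) (\<pi> y) = \<pi> (bracket g x y)"
proof -
  have inner: "(\<Union>y'\<in>\<pi> y. \<pi> (bracket g x' y')) = \<pi> (bracket g x' y)" if "x' \<in> carrier g" for x'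
    unfolding \<pi>_eq[of y]
  proof (rule q.cls_UN[OF y])
    show "\<pi> (bracket g x' y') = \<pi> (bracket g x' y)" if "y' \<in> carrier g" "y' \<ominus>\<^bsub>g\<^esub> y \<in> I" for y'
      using that \<open>x' \<in> carrier g\<close> y subspaceD(3)[OF subspace_I] real_vs_g
      by (intro \<pi>_bracket_cong) (auto simp: a_minus_def g.M.r_neg)
  qed
  have "bracket Q (\<pi> x) (\<pi> y) = (\<Union>x'\<in>\<pi> x. \<Union>y'\<in>\<pi> y. \<pi> (bracket g x' y'))"
    by (simp add: quot_lie_simps \<pi>_eq)
  also have "\<dots> = (\<Union>y'\<in>\<pi> y. \<pi> (bracket g x y'))"
    unfolding \<pi>_eq[of x]
  proof (rule q.cls_UN[OF x])
    show "(\<Union>y'\<in>\<pi> y. \<pi> (bracket g x' y')) = (\<Union>y'\<in>\<pi> y. \<pi> (bracket g x y'))"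
      if "x' \<in> carrier g" "x' \<ominus>\<^bsub>g\<^esub> x \<in> I" for x'
      unfolding inner[OF that(1)] inner[OF x]
      using that x y subspaceD(3)[OF subspace_I]
      by (intro \<pi>_bracket_cong) (auto simp: a_minus_def g.M.r_neg)
  qed
  also have "\<dots> = \<pi> (bracket g x y)" by (rule inner[OF x])
  finally show ?thesis .
qed

lemma quotient_lie_algebra: "real_lie_algebra Q"
proof -
  note add = lin_add[OF \<pi>_lin, symmetric] and smult = lin_smult[OF \<pi>_lin, symmetric]
  have "real_lie_algebra_axioms Q"
  proof (rule real_lie_algebra_axioms.intro)
    fix Y assume "Y \<in> carrier Q"
    then obtain y where y: "y \<in> carrier g" "Y = \<pi> y" by (rule Q_cases)
    show "(\<lambda>X. bracket Q X Y) \<in> lin Q Q" unfolding y(2)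
      by (rule linI) (use y g.bracket_closed in \<open>auto elim!: Q_cases simp: bracket_Q \<pi>_closed add smult
        lin_add[OF g.bracket_left_linear] lin_smult[OF g.bracket_left_linear]\<close>)
    show "(\<lambda>X. bracket Q Y X) \<in> lin Q Q" unfolding y(2)
      by (rule linI) (use y g.bracket_closed in \<open>auto elim!: Q_cases simp: bracket_Q \<pi>_closed add smult
        lin_add[OF g.bracket_right_linear] lin_smult[OF g.bracket_right_linear]\<close>)
    show "bracket Q Y Y = \<zero>\<^bsub>Q\<^esub>"
      using y g.bracket_self lin_zero[OF real_vs_g real_vs_Q \<pi>_lin] by (simp add: bracket_Q)
    fix X Z assume "X \<in> carrier Q" "Z \<in> carrier Q"
    then obtain x z where xz: "x \<in> carrier g" "X = \<pi> x" "z \<in> carrier g" "Z = \<pi> z"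
      by (metis Q_cases)
    show "bracket Q X (bracket Q Y Z) \<oplus>\<^bsub>Q\<^esub> bracket Q Y (bracket Q Z X) \<oplus>\<^bsub>Q\<^esub> bracket Q Z (bracket Q X Y) = \<zero>\<^bsub>Q\<^esub>"
      using y xz g.bracket_closed g.jacobi[of x y z] lin_zero[OF real_vs_g real_vs_Q \<pi>_lin]
      by (simp add: bracket_Q add)
  qed
  then show ?thesis by (intro real_lie_algebra.intro real_vs_Q)
qed

lemma sub_lie_simps:
  "carrier J = I" "add J = add g" "zero J = zero g" "smult J = smult g" "bracket J = bracket g"
  by (simp_all add: sub_lie_def)

lemma real_vs_J: "real_vs J"
  using subspace_real_vs[OF subspace_I] by (simp add: sub_lie_def)

lemma id_lin_J: "(\<lambda>u. u) \<in> lin J g"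
  by (rule linI) (simp_all add: sub_lie_simps I_carrier)

lemma sub_lie_algebra: "real_lie_algebra J"
proof -
  have "real_lie_algebra_axioms J"
    by (rule real_lie_algebra_axioms.intro)
      (auto simp: sub_lie_simps I_carrier bracket_I g.bracket_self g.jacobi
        lin_add[OF g.bracket_left_linear] lin_smult[OF g.bracket_left_linear]
        lin_add[OF g.bracket_right_linear] lin_smult[OF g.bracket_right_linear] intro!: linI)
  then show ?thesis by (intro real_lie_algebra.intro real_vs_J)
qed

sublocale quot: lie_representation Q Q "bracket Q"
  by (rule real_lie_algebra.adjoint_representation[OF quotient_lie_algebra])

sublocale alg: lie_representation g Q "\<lambda>x. bracket Q (\<pi> x)"
  by (rule quot.pullback_representation[OF g.real_lie_algebra_axioms \<pi>_lin]) (simp_all add: bracket_Q)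

text \<open>
  The Bott action thus is the restriction to the ideal of the action of \<open>g\<close> on the quotient.
\<close>

lemma bott_eq:
  assumes "u \<in> I" "X \<in> carrier Q"
  shows "bott g I u X = bracket Q (\<pi> u) X"
proof -
  obtain x where x: "x \<in> carrier g" "X = \<pi> x" using assms(2) by (rule Q_cases)
  have "bott g I u X = \<pi> (bracket g u x)"
    unfolding bott_def x(2) \<pi>_eq[of x]
    using assms(1) x(1) I_carrier subspaceD(3)[OF subspace_I]
    by (intro q.cls_UN[OF x(1)] \<pi>_bracket_cong) (auto simp: a_minus_def g.M.r_neg)
  then show ?thesis using x assms(1) I_carrier by (simp add: bracket_Q)
qed

sublocale def: lie_representation J Q "bott g I"
  by (rule alg.pullback_representation[OF sub_lie_algebra id_lin_J]) (simp_all add: sub_lie_simps bott_eq)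

lemma bracket_Q_I: "u \<in> I \<Longrightarrow> X \<in> carrier Q \<Longrightarrow> bracket Q (\<pi> u) X = \<zero>\<^bsub>Q\<^esub>"
  using lin_zero[OF real_vs_Q real_vs_Q quot.rep_lin_left] by (simp add: \<pi>_I)

lemma ideal_representation: "lie_representation g J (bracket g)"
proof -
  have "lie_representation_axioms g J (bracket g)"
    by (rule lie_representation_axioms.intro)
      (auto simp: sub_lie_simps I_carrier bracket_I
        lin_add[OF g.bracket_left_linear] lin_smult[OF g.bracket_left_linear]
        lin_add[OF g.bracket_right_linear] lin_smult[OF g.bracket_right_linear] intro!: linI
        simp: a_minus_def subspace_neg_eq[OF subspace_I, folded sub_lie_def] g.jacobi_minus)
  then show ?thesis by (intro lie_representation.intro g.real_lie_algebra_axioms real_vs_J)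
qed

sublocale hom: lie_representation g "hom_space J Q" "ad_hom g I"
proof -
  have "ad_hom g I = (\<lambda>x \<phi>. \<lambda>u\<in>carrier J. bracket Q (\<pi> x) (\<phi> u) \<ominus>\<^bsub>Q\<^esub> \<phi> (bracket g x u))"
    by (simp add: ad_hom_def sub_lie_simps fun_eq_iff)
  then show "lie_representation g (hom_space J Q) (ad_hom g I)"
    using hom_representation[OF alg.lie_representation_axioms ideal_representation] by simp
qed

lemma cochain_complexes:
  "cochain_complex (C_alg g I)" "cochain_complex (C_quot g I)" "cochain_complex (C_def g I)" "cochain_complex (C_hom g I)"
  unfolding C_alg_def C_quot_def C_def_def C_hom_def
  by (rule alg.cochain_complex_ce_cx quot.cochain_complex_ce_cx def.cochain_complex_ce_cx hom.cochain_complex_ce_cx)+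

lemma cx_simps [simp]:
  "cx_space (C_alg g I) k = cochain_space k g Q"
  "cx_space (C_quot g I) k = cochain_space k Q Q"
  "cx_space (C_def g I) k = cochain_space k J Q"
  "cx_space (C_hom g I) k = cochain_space k g (hom_space J Q)"
  "cx_diff (C_alg g I) k = ce_diff g Q (\<lambda>x. bracket Q (\<pi> x)) k"
  "cx_diff (C_hom g I) k = ce_diff g (hom_space J Q) (ad_hom g I) k"
  by (simp_all add: C_alg_def C_quot_def C_def_def C_hom_def ce_cx_def)

lemma canonical_incl_cochain_map: "cochain_map (C_quot g I) (C_alg g I) (canonical_incl g I)"
proof -
  have "canonical_incl g I = (\<lambda>p \<omega>. \<lambda>xs\<in>tuples p g. \<omega> (map \<pi> xs))"
    by (simp add: canonical_incl_def fun_eq_iff)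
  then show ?thesis
    using quot.pullback_cochain_map[OF alg.lie_representation_axioms \<pi>_lin]
    by (simp add: C_quot_def C_alg_def bracket_Q)
qed

lemma iota_star_cochain_map: "cochain_map (C_alg g I) (C_def g I) (iota_star g I)"
proof -
  have "iota_star g I = (\<lambda>p \<omega>. \<lambda>xs\<in>tuples p J. \<omega> (map (\<lambda>u. u) xs))"
    by (simp add: iota_star_def fun_eq_iff)
  then show ?thesis
    using alg.pullback_cochain_map[OF def.lie_representation_axioms id_lin_J]
    by (simp add: C_def_def C_alg_def bott_eq sub_lie_simps)
qed

lemma map_tuples: "T \<in> lin h k \<Longrightarrow> xs \<in> tuples p h \<Longrightarrow> map T xs \<in> tuples p k"
  using lin_closed by (fastforce simp: tuples_iff)

text \<open>
  The preimage of \<open>\<psi>\<close> is its pullback along a linear projection onto the ideal, which fixes the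
  arguments from the ideal.
\<close>

lemma iota_star_surjective: "cx_surjective (C_alg g I) (C_def g I) (iota_star g I)"
  unfolding cx_surjective_def
proof (intro allI equalityI subsetI)
  fix k \<psi>
  show "\<psi> \<in> carrier (cx_space (C_def g I) k)" if "\<psi> \<in> iota_star g I k ` carrier (cx_space (C_alg g I) k)"
    using that lin_closed[OF cochain_mapD(3)[OF iota_star_cochain_map]] by blast
  assume "\<psi> \<in> carrier (cx_space (C_def g I) k)"
  then have \<psi>: "\<psi> \<in> carrier (cochain_space k J Q)" by simp
  obtain P where P: "P \<in> lin g g" "\<And>x. x \<in> carrier g \<Longrightarrow> P x \<in> I" "\<And>u. u \<in> I \<Longrightarrow> P u = u"
    using subspace_projection[OF subspace_I] by blast
  have PJ: "P \<in> lin g J"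
    by (rule linI) (simp_all add: sub_lie_simps P lin_add[OF P(1)] lin_smult[OF P(1)])
  let ?\<phi> = "\<lambda>xs\<in>tuples k g. \<psi> (map P xs)"
  have "iota_star g I k ?\<phi> = \<psi>"
  proof
    fix xs
    show "iota_star g I k ?\<phi> xs = \<psi> xs"
    proof (cases "xs \<in> tuples k J")
      case True
      then have "map P xs = xs" by (intro map_idI) (auto simp: tuples_iff sub_lie_simps P(3))
      moreover have "xs \<in> tuples k g" using True I_carrier by (auto simp: tuples_iff sub_lie_simps)
      ultimately show ?thesis using True by (simp add: iota_star_def)
    qed (use cochain_spaceD(4)[OF \<psi>] in \<open>simp add: iota_star_def extensional_def\<close>)
  qed
  moreover have "?\<phi> \<in> carrier (cochain_space k g Q)"
    by (rule pullback_cochain[OF real_vs_Q real_vs_J real_vs_g PJ \<psi>])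
  ultimately show "\<psi> \<in> iota_star g I k ` carrier (cx_space (C_alg g I) k)"
    by (metis cx_simps(1) imageI)
qed

text \<open>
  Every list of classes is the image of a list of representatives.
\<close>

lemma canonical_incl_inj: "inj_on (canonical_incl g I k) (carrier (cochain_space k Q Q))"
proof (rule inj_onI)
  fix \<phi> \<psi> assume \<phi>: "\<phi> \<in> carrier (cochain_space k Q Q)" and \<psi>: "\<psi> \<in> carrier (cochain_space k Q Q)"
    and eq: "canonical_incl g I k \<phi> = canonical_incl g I k \<psi>"
  show "\<phi> = \<psi>"
  proof (rule cochain_eqI[OF \<phi> \<psi>])
    fix Xs assume "Xs \<in> tuples k Q"
    then have l: "length Xs = k" and s: "set Xs \<subseteq> carrier Q" by (auto simp: tuples_iff)
    have "Xs \<in> map \<pi> ` lists (carrier g)"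
      using s lists_image[of \<pi> "carrier g"] by (auto simp: carrier_Q)
    then obtain xs where xs: "Xs = map \<pi> xs" "set xs \<subseteq> carrier g" by (auto simp: subset_iff)
    then have "xs \<in> tuples k g" using l by (simp add: tuples_iff)
    then show "\<phi> Xs = \<psi> Xs" using fun_cong[OF eq, of xs] xs(1) by (simp add: canonical_incl_def)
  qed
qed

end

context lie_algebra_ideal
begin

section \<open>Restricting the last argument to the ideal\<close>

abbreviation Hom where "Hom \<equiv> hom_space J Q"
abbreviation Cg where "Cg k \<equiv> cochain_space k g Q"
abbreviation CHom where "CHom k \<equiv> cochain_space k g Hom"

definition last_restr :: "('a list \<Rightarrow> 'a set) \<Rightarrow> 'a list \<Rightarrow> 'a \<Rightarrow> 'a set" where
  "last_restr f xs = (\<lambda>u\<in>I. f (xs @ [u]))"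

lemma real_vs_Hom: "real_vs Hom" by (rule hom_space_real_vs[OF real_vs_J real_vs_Q])

lemma carrier_J: "carrier J = I" by (simp add: sub_lie_simps)

lemma last_restr_multilinear:
  assumes f: "multilinear g Q f"
  shows "multilinear g Hom (last_restr f)"
proof (rule multilinearI)
  have lin: "(\<lambda>u. f (xs @ [u])) \<in> lin J Q" if "set xs \<subseteq> carrier g" for xs
    using multilinear_lin[OF f that, of "[]"] by (intro lin_compose[OF id_lin_J]) simp
  have eq: "last_restr f xs = restrict (\<lambda>u. f (xs @ [u])) (carrier J)" for xs
    by (simp add: last_restr_def carrier_J)
  show "last_restr f xs \<in> carrier Hom" if "set xs \<subseteq> carrier g" for xs
    using hom_spaceI[OF real_vs_J lin[OF that]] by (simp add: last_restr_def carrier_J)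
  show "(\<lambda>x. last_restr f (pre @ x # post)) \<in> lin g Hom"
    if "set pre \<subseteq> carrier g" "set post \<subseteq> carrier g" for pre post
    unfolding eq
  proof (rule lin_into_hom_space[OF real_vs_J real_vs_g])
    show "(\<lambda>u. f ((pre @ x # post) @ [u])) \<in> lin J Q" if "x \<in> carrier g" for x
      using \<open>set pre \<subseteq> carrier g\<close> \<open>set post \<subseteq> carrier g\<close> that by (intro lin) simp
    show "(\<lambda>x. f ((pre @ x # post) @ [u])) \<in> lin g Q" if "u \<in> carrier J" for u
      using multilinear_lin[OF f, of pre "post @ [u]"] \<open>set pre \<subseteq> carrier g\<close> \<open>set post \<subseteq> carrier g\<close>
        that I_carrier by (simp add: carrier_J)
  qed
qed

lemma last_restr_alternating:
  assumes f: "alternating g Q f"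
  shows "alternating g Hom (last_restr f)"
proof (rule alternatingI)
  fix pre x post assume m: "set pre \<subseteq> carrier g" "x \<in> carrier g" "set post \<subseteq> carrier g"
  have "f (pre @ x # x # post @ [u]) = \<zero>\<^bsub>Q\<^esub>" if "u \<in> I" for u
    using alternating_adjacent[OF f m(1,2), of "post @ [u]"] m that I_carrier by simp
  then show "last_restr f (pre @ x # x # post) = \<zero>\<^bsub>Hom\<^esub>"
    by (auto simp: last_restr_def hom_space_simps carrier_J intro!: restrict_ext)
qed

lemma Hom_minus:
  "\<phi> \<in> carrier Hom \<Longrightarrow> \<psi> \<in> carrier Hom \<Longrightarrow> \<phi> \<ominus>\<^bsub>Hom\<^esub> \<psi> = (\<lambda>u\<in>I. \<phi> u \<ominus>\<^bsub>Q\<^esub> \<psi> u)"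
  using hom_space_real_vs(2)[OF real_vs_J real_vs_Q] by (simp add: carrier_J)

lemma last_restr_closed: "multilinear g Q f \<Longrightarrow> set xs \<subseteq> carrier g \<Longrightarrow> last_restr f xs \<in> carrier Hom"
  using multilinear_closed[OF last_restr_multilinear] .

text \<open>
  The last argument \<open>u\<close> contributes \<open>- f (\<dots>, [x, u])\<close> to \<open>L\<^sub>x f\<close>, which is the second term of the
  action on linear maps from the ideal to the quotient.
\<close>

lemma last_restr_lie_deriv:
  assumes "multilinear g Q f" "x \<in> carrier g" "set xs \<subseteq> carrier g"
  shows "hom.L x (last_restr f) xs = last_restr (alg.L x f) xs"
  using assms
proof (induction xs arbitrary: f)
  case Nil
  have "f [u] \<in> carrier Q" if "u \<in> I" for u
    using multilinear_closed[OF Nil(1), of "[u]"] that I_carrier by simp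
  then show ?case using Nil bracket_I by (intro ext) (simp add: last_restr_def ad_hom_def)
next
  case (Cons y xs)
  have y: "y \<in> carrier g" "set xs \<subseteq> carrier g" "bracket g x y \<in> carrier g"
    using Cons.prems g.bracket_closed by auto
  note ml = multilinear_Cons[OF Cons.prems(1)]
  have eq: "last_restr f (b # zs) = last_restr (\<lambda>zs. f (b # zs)) zs" for b zs by (simp add: last_restr_def)
  have "hom.L x (last_restr f) (y # xs) =
      last_restr (alg.L x (\<lambda>zs. f (y # zs))) xs \<ominus>\<^bsub>Hom\<^esub> last_restr (\<lambda>zs. f (bracket g x y # zs)) xs"
    using Cons.IH[OF ml] y Cons.prems by (simp add: eq cong: if_cong)
  also have "\<dots> = (\<lambda>u\<in>I. last_restr (alg.L x (\<lambda>zs. f (y # zs))) xs u \<ominus>\<^bsub>Q\<^esub> last_restr (\<lambda>zs. f (bracket g x y # zs)) xs u)"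
    using y Cons.prems ml by (intro Hom_minus last_restr_closed alg.multilinear_L) auto
  also have "\<dots> = last_restr (alg.L x f) (y # xs)"
    by (auto simp: last_restr_def intro!: restrict_ext)
  finally show ?case .
qed

text \<open>
  The recursion for \<open>d f\<close> ends with the term \<open>\<plusminus> L\<^sub>u f\<close> without further arguments, that is with the action
  of \<open>u\<close> on a value of \<open>f\<close>; it vanishes because \<open>u\<close> lies in the ideal.
\<close>

lemma last_restr_cartan_diff:
  assumes "multilinear g Q f" "set xs \<subseteq> carrier g"
  shows "hom.D (last_restr f) xs = last_restr (alg.D f) xs"
  using assms
proof (induction xs arbitrary: f)
  case Nil
  have "alg.D f [u] = \<zero>\<^bsub>Q\<^esub>" if "u \<in> I" for u
    using multilinear_closed[OF Nil(1), of "[]"] that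
    by (simp add: bracket_Q_I real_vs_minus_self[OF real_vs_Q real_vs_zero_closed[OF real_vs_Q]])
  then show ?case
    by (intro ext) (simp add: last_restr_def hom_space_simps carrier_J del: cartan_diff.simps(2))
next
  case (Cons y xs)
  have y: "y \<in> carrier g" "set xs \<subseteq> carrier g" using Cons.prems by auto
  note ml = multilinear_Cons[OF Cons.prems(1) y(1)]
  have eq: "(\<lambda>zs. last_restr f (y # zs)) = last_restr (\<lambda>zs. f (y # zs))" by (simp add: last_restr_def fun_eq_iff)
  have "hom.D (last_restr f) (y # xs) =
      last_restr (alg.L y f) xs \<ominus>\<^bsub>Hom\<^esub> last_restr (alg.D (\<lambda>zs. f (y # zs))) xs"
    using Cons.IH[OF ml] y Cons.prems last_restr_lie_deriv by (simp add: eq)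
  also have "\<dots> = (\<lambda>u\<in>I. last_restr (alg.L y f) xs u \<ominus>\<^bsub>Q\<^esub> last_restr (alg.D (\<lambda>zs. f (y # zs))) xs u)"
    using y Cons.prems ml by (intro Hom_minus last_restr_closed alg.multilinear_L alg.multilinear_D)
  also have "\<dots> = last_restr (alg.D f) (y # xs)"
    by (auto simp: last_restr_def intro!: restrict_ext)
  finally show ?case .
qed

lemma tuples_snoc: "xs \<in> tuples k g \<Longrightarrow> u \<in> I \<Longrightarrow> xs @ [u] \<in> tuples (Suc k) g"
  using I_carrier by (auto simp: tuples_iff)

lemma restrict_last_restr:
  assumes "\<And>xs. xs \<in> tuples (Suc k) g \<Longrightarrow> f xs = f' xs"
  shows "restrict (last_restr f) (tuples k g) = restrict (last_restr f') (tuples k g)"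
  using assms tuples_snoc by (auto simp: last_restr_def fun_eq_iff)

lemma last_restr_cochain:
  assumes \<phi>: "\<phi> \<in> carrier (Cg (Suc k))"
  shows "restrict (last_restr \<phi>) (tuples k g) \<in> carrier (CHom k)"
    and "ce_diff g Hom (ad_hom g I) k (restrict (last_restr \<phi>) (tuples k g)) =
      restrict (last_restr (ce_diff g Q (\<lambda>x. bracket Q (\<pi> x)) (Suc k) \<phi>)) (tuples (Suc k) g)"
proof -
  let ?f = "extend_zero (Suc k) g Q \<phi>"
  note ml = multilinear_extend_zero[OF real_vs_Q real_vs_g \<phi>] and al = alternating_extend_zero[OF \<phi>]
  have eq: "restrict (last_restr \<phi>) (tuples k g) = restrict (last_restr ?f) (tuples k g)"
    by (rule restrict_last_restr) (simp add: extend_zero_def)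
  show "restrict (last_restr \<phi>) (tuples k g) \<in> carrier (CHom k)"
    unfolding eq by (intro restrict_cochain real_vs_Hom real_vs_g last_restr_multilinear last_restr_alternating ml al)
  have "ce_diff g Hom (ad_hom g I) k (restrict (last_restr ?f) (tuples k g)) =
      restrict (hom.D (last_restr ?f)) (tuples (Suc k) g)"
    by (intro hom.ce_diff_restrict last_restr_multilinear last_restr_alternating ml al)
  also have "\<dots> = restrict (last_restr (alg.D ?f)) (tuples (Suc k) g)"
    by (rule restrict_ext) (simp add: last_restr_cartan_diff[OF ml] tuples_iff)
  also have "\<dots> = restrict (last_restr (ce_diff g Q (\<lambda>x. bracket Q (\<pi> x)) (Suc k) \<phi>)) (tuples (Suc k) g)"
    by (rule restrict_last_restr) (simp add: alg.ce_diff_eq[OF \<phi>])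
  finally show "ce_diff g Hom (ad_hom g I) k (restrict (last_restr \<phi>) (tuples k g)) =
      restrict (last_restr (ce_diff g Q (\<lambda>x. bracket Q (\<pi> x)) (Suc k) \<phi>)) (tuples (Suc k) g)"
    unfolding eq .
qed

lemma last_restr_lin:
  "(\<lambda>\<phi>. restrict (last_restr \<phi>) (tuples k g)) \<in> lin (Cg (Suc k)) (CHom k)"
  by (rule linI)
    (auto simp: last_restr_cochain(1) cochain_space_simps hom_space_simps last_restr_def tuples_snoc carrier_J
      intro!: restrict_ext)

lemma Pi_map_eq:
  "Pi_map g I k \<phi> = (-1) ^ (k + 1) \<odot>\<^bsub>CHom k\<^esub> restrict (last_restr \<phi>) (tuples k g)"
  by (auto simp: Pi_map_def cochain_space_simps hom_space_simps last_restr_def carrier_J fun_eq_iff)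

lemma real_vs_C: "real_vs (Cg k)" "real_vs (CHom k)"
  by (rule cochain_space_real_vs[OF real_vs_Q real_vs_g] cochain_space_real_vs[OF real_vs_Hom real_vs_g])+

text \<open>
  The restriction of the last argument commutes with the differentials; the factor \<open>(-1)\<^sup>k\<^sup>+\<^sup>1\<close>
  compensates the sign of the shifted differential.
\<close>

lemma Pi_map_cochain_map_hom: "cochain_map (shift (C_alg g I)) (C_hom g I) (Pi_map g I)"
proof (rule cochain_mapI)
  show "cochain_complex (shift (C_alg g I))" "cochain_complex (C_hom g I)"
    by (intro cochain_complex_shift cochain_complexes)+
  show "Pi_map g I k \<in> lin (cx_space (shift (C_alg g I)) k) (cx_space (C_hom g I) k)" for k
    using lin_smult_left[OF real_vs_C(2) last_restr_lin] by (simp add: Pi_map_eq[abs_def])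
  show "Pi_map g I (Suc k) (cx_diff (shift (C_alg g I)) k \<phi>) = cx_diff (C_hom g I) k (Pi_map g I k \<phi>)"
    if "\<phi> \<in> carrier (cx_space (shift (C_alg g I)) k)" for k \<phi>
  proof -
    have \<phi>: "\<phi> \<in> carrier (Cg (Suc k))" using that by simp
    let ?R = "\<lambda>k \<phi>. restrict (last_restr \<phi>) (tuples k g)"
    let ?d = "ce_diff g Q (\<lambda>x. bracket Q (\<pi> x)) (Suc k) \<phi>"
    have d: "?d \<in> carrier (Cg (Suc (Suc k)))" by (rule alg.ce_diff_closed[OF \<phi>])
    have Rd: "?R (Suc k) ?d \<in> carrier (CHom (Suc k))" by (rule last_restr_cochain(1)[OF d])
    have "Pi_map g I (Suc k) (\<ominus>\<^bsub>Cg (Suc (Suc k))\<^esub> ?d) =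
        (-1) ^ (Suc k + 1) \<odot>\<^bsub>CHom (Suc k)\<^esub> (\<ominus>\<^bsub>CHom (Suc k)\<^esub> ?R (Suc k) ?d)"
      unfolding Pi_map_eq lin_neg[OF real_vs_C last_restr_lin d] ..
    also have "\<dots> = (-1) ^ (k + 1) \<odot>\<^bsub>CHom (Suc k)\<^esub> ?R (Suc k) ?d"
      using Rd by (simp add: real_vs_neg_eq[OF real_vs_C(2), symmetric] real_vs_smult_assoc[OF real_vs_C(2)])
    also have "\<dots> = ce_diff g Hom (ad_hom g I) k (Pi_map g I k \<phi>)"
      unfolding Pi_map_eq lin_smult[OF hom.ce_diff_lin last_restr_cochain(1)[OF \<phi>]] last_restr_cochain(2)[OF \<phi>] ..
    finally show ?thesis by simp
  qed
qed

lemma Pi_map_cochain_map: "cochain_map (shift (C_alg g I)) (C_wedge g I) (Pi_map g I)"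
  and Pi_map_surjective: "cx_surjective (shift (C_alg g I)) (C_wedge g I) (Pi_map g I)"
  unfolding C_wedge_def by (rule cochain_map_image[OF Pi_map_cochain_map_hom])+

section \<open>The two rows and the two columns\<close>

text \<open>
  The argument from the ideal is moved to the last position by transpositions.
\<close>

lemma vanish_anywhere:
  assumes f: "multilinear g Q f" "alternating g Q f"
    and last: "\<And>xs u. set xs \<subseteq> carrier g \<Longrightarrow> u \<in> I \<Longrightarrow> f (xs @ [u]) = \<zero>\<^bsub>Q\<^esub>"
    and "set pre \<subseteq> carrier g" "u \<in> I" "set post \<subseteq> carrier g"
  shows "f (pre @ u # post) = \<zero>\<^bsub>Q\<^esub>"
  using assms(4-6)
proof (induction post arbitrary: pre)
  case Nil
  then show ?case by (simp add: last)
next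
  case (Cons y post)
  have "f (pre @ u # y # post) = \<ominus>\<^bsub>Q\<^esub> f ((pre @ [y]) @ u # post)"
    using alternating_swap[OF real_vs_Q real_vs_g f, of pre u y post] Cons.prems I_carrier by simp
  also have "\<dots> = \<zero>\<^bsub>Q\<^esub>"
    using Cons.IH[of "pre @ [y]"] Cons.prems by (simp add: real_vs_neg_zero[OF real_vs_Q])
  finally show ?case .
qed

text \<open>
  The arguments are replaced one at a time, from left to right.
\<close>

lemma eq_mod_I:
  assumes f: "multilinear g Q f"
    and van: "\<And>pre u post. set pre \<subseteq> carrier g \<Longrightarrow> u \<in> I \<Longrightarrow> set post \<subseteq> carrier g \<Longrightarrow> f (pre @ u # post) = \<zero>\<^bsub>Q\<^esub>"
    and T: "\<And>x. x \<in> carrier g \<Longrightarrow> T x \<in> carrier g \<and> \<pi> (T x) = \<pi> x"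
    and "set pre \<subseteq> carrier g" "set xs \<subseteq> carrier g"
  shows "f (pre @ map T xs) = f (pre @ xs)"
  using assms(4,5)
proof (induction xs arbitrary: pre)
  case Nil
  then show ?case by simp
next
  case (Cons x xs)
  have x: "x \<in> carrier g" "T x \<in> carrier g" "T x \<ominus>\<^bsub>g\<^esub> x \<in> I"
    using Cons.prems T[of x] \<pi>_eq_iff[of "T x" x] by auto
  have c: "f (pre @ y # xs) \<in> carrier Q" if "y \<in> carrier g" for y
    using Cons.prems that by (intro multilinear_closed[OF f]) auto
  have "f (pre @ T x # xs) \<ominus>\<^bsub>Q\<^esub> f (pre @ x # xs) = f (pre @ (T x \<ominus>\<^bsub>g\<^esub> x) # xs)"
    using lin_minus[OF real_vs_g real_vs_Q multilinear_lin[OF f, of pre xs]] Cons.prems x by simp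
  also have "\<dots> = \<zero>\<^bsub>Q\<^esub>" using van[OF Cons.prems(1) x(3), of xs] Cons.prems(2) by simp
  finally have "f (pre @ T x # xs) = f (pre @ x # xs)"
    by (rule real_vs_eq_if_minus_zero[OF real_vs_Q c[OF x(2)] c[OF x(1)]])
  then show ?case using Cons.IH[of "pre @ [T x]"] Cons.prems x by simp
qed

lemma section_lin:
  obtains s where "s \<in> lin Q g" "\<And>X. X \<in> carrier Q \<Longrightarrow> \<pi> (s X) = X"
proof -
  obtain s where s: "s \<in> lin (quot_vs g I) g" "\<And>X. X \<in> carrier (quot_vs g I) \<Longrightarrow> I +>\<^bsub>g\<^esub> s X = X"
    using q.linear_section by blast
  show thesis
  proof (rule that)
    show "s \<in> lin Q g"
      by (rule linI) (simp_all add: quot_lie_simps lin_closed[OF s(1)] lin_add[OF s(1)] lin_smult[OF s(1)])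
    show "\<pi> (s X) = X" if "X \<in> carrier Q" for X
      using s(2)[of X] that by (simp add: \<pi>_eq quot_lie_simps)
  qed
qed

lemma Pi_map_zero_iff:
  assumes \<phi>: "\<phi> \<in> carrier (Cg (Suc k))"
  shows "Pi_map g I k \<phi> = \<zero>\<^bsub>CHom k\<^esub> \<longleftrightarrow> (\<forall>xs\<in>tuples k g. \<forall>u\<in>I. \<phi> (xs @ [u]) = \<zero>\<^bsub>Q\<^esub>)"
proof -
  have sgn: "(-1) ^ (k + 1) \<odot>\<^bsub>Q\<^esub> v = \<zero>\<^bsub>Q\<^esub> \<longleftrightarrow> v = \<zero>\<^bsub>Q\<^esub>" if v: "v \<in> carrier Q" for v
  proof
    assume "(-1) ^ (k + 1) \<odot>\<^bsub>Q\<^esub> v = \<zero>\<^bsub>Q\<^esub>"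
    then have "(-1) ^ (k + 1) \<odot>\<^bsub>Q\<^esub> ((-1) ^ (k + 1) \<odot>\<^bsub>Q\<^esub> v) = \<zero>\<^bsub>Q\<^esub>" by (simp add: real_vs_smult_zero[OF real_vs_Q])
    then show "v = \<zero>\<^bsub>Q\<^esub>"
      using v by (simp add: real_vs_smult_assoc[OF real_vs_Q] real_vs_one[OF real_vs_Q] flip: power_mult_distrib)
  qed (simp add: real_vs_smult_zero[OF real_vs_Q])
  have "Pi_map g I k \<phi> = \<zero>\<^bsub>CHom k\<^esub> \<longleftrightarrow>
      (\<forall>xs\<in>tuples k g. \<forall>u\<in>I. (-1) ^ (k + 1) \<odot>\<^bsub>Q\<^esub> \<phi> (xs @ [u]) = \<zero>\<^bsub>Q\<^esub>)"
    by (auto simp: Pi_map_def cochain_space_simps hom_space_simps carrier_J fun_eq_iff restrict_def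
        split: if_split_asm)
  then show ?thesis using sgn cochain_spaceD(1)[OF \<phi>] tuples_snoc by simp
qed

lemma canonical_incl_vanish:
  assumes \<psi>: "\<psi> \<in> carrier (cochain_space (Suc k) Q Q)"
    and xs: "set xs \<subseteq> carrier g" "u \<in> I" "length xs = k"
  shows "canonical_incl g I (Suc k) \<psi> (xs @ [u]) = \<zero>\<^bsub>Q\<^esub>"
proof -
  have "(\<lambda>X. extend_zero (Suc k) Q Q \<psi> (map \<pi> xs @ X # [])) \<in> lin Q Q"
    using xs(1) \<pi>_closed by (intro multilinear_lin[OF multilinear_extend_zero[OF real_vs_Q real_vs_Q \<psi>]]) auto
  from lin_zero[OF real_vs_Q real_vs_Q this]
  have "extend_zero (Suc k) Q Q \<psi> (map \<pi> (xs @ [u])) = \<zero>\<^bsub>Q\<^esub>" using xs by (simp add: \<pi>_I)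
  moreover have t: "xs @ [u] \<in> tuples (Suc k) g" using xs tuples_snoc by (simp add: tuples_iff)
  ultimately show ?thesis
    using map_tuples[OF \<pi>_lin t] by (simp add: extend_zero_def canonical_incl_def)
qed

text \<open>
  If \<open>\<Pi> \<phi> = 0\<close>, replacing every argument \<open>x\<close> by \<open>s (\<pi> x)\<close>, for a linear section \<open>s\<close>, does not change
  \<open>\<phi>\<close>; so \<open>\<phi>\<close> is the pullback along \<open>\<pi>\<close> of the cochain \<open>\<phi> \<circ> s\<close>.
\<close>

lemma Pi_map_kernel:
  "canonical_incl g I (Suc k) ` carrier (cochain_space (Suc k) Q Q) =
    {\<phi> \<in> carrier (Cg (Suc k)). Pi_map g I k \<phi> = \<zero>\<^bsub>CHom k\<^esub>}"
proof (intro equalityI subsetI)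
  fix \<phi> assume "\<phi> \<in> canonical_incl g I (Suc k) ` carrier (cochain_space (Suc k) Q Q)"
  then obtain \<psi> where \<psi>: "\<psi> \<in> carrier (cochain_space (Suc k) Q Q)" "\<phi> = canonical_incl g I (Suc k) \<psi>" by auto
  then have \<phi>: "\<phi> \<in> carrier (Cg (Suc k))"
    using lin_closed[OF cochain_mapD(3)[OF canonical_incl_cochain_map, of "Suc k"]] by simp
  show "\<phi> \<in> {\<phi> \<in> carrier (Cg (Suc k)). Pi_map g I k \<phi> = \<zero>\<^bsub>CHom k\<^esub>}"
    using \<phi> canonical_incl_vanish[OF \<psi>(1)] Pi_map_zero_iff[OF \<phi>] by (auto simp: tuples_iff \<psi>(2))
next
  fix \<phi> assume "\<phi> \<in> {\<phi> \<in> carrier (Cg (Suc k)). Pi_map g I k \<phi> = \<zero>\<^bsub>CHom k\<^esub>}"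
  then have \<phi>: "\<phi> \<in> carrier (Cg (Suc k))"
    and van: "\<And>xs u. xs \<in> tuples k g \<Longrightarrow> u \<in> I \<Longrightarrow> \<phi> (xs @ [u]) = \<zero>\<^bsub>Q\<^esub>"
    using Pi_map_zero_iff by auto
  let ?f = "extend_zero (Suc k) g Q \<phi>"
  note ml = multilinear_extend_zero[OF real_vs_Q real_vs_g \<phi>] and al = alternating_extend_zero[OF \<phi>]
  have "?f (xs @ [u]) = \<zero>\<^bsub>Q\<^esub>" if "set xs \<subseteq> carrier g" "u \<in> I" for xs u
    using that van[of xs u] by (auto simp: extend_zero_def tuples_iff)
  note van' = vanish_anywhere[OF ml al this]
  obtain s where s: "s \<in> lin Q g" "\<And>X. X \<in> carrier Q \<Longrightarrow> \<pi> (s X) = X" using section_lin by blast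
  let ?\<psi> = "\<lambda>Xs\<in>tuples (Suc k) Q. \<phi> (map s Xs)"
  have \<psi>: "?\<psi> \<in> carrier (cochain_space (Suc k) Q Q)"
    by (rule pullback_cochain[OF real_vs_Q real_vs_g real_vs_Q s(1) \<phi>])
  have "canonical_incl g I (Suc k) ?\<psi> = \<phi>"
  proof
    fix xs
    show "canonical_incl g I (Suc k) ?\<psi> xs = \<phi> xs"
    proof (cases "xs \<in> tuples (Suc k) g")
      case True
      let ?T = "\<lambda>x. s (\<pi> x)"
      have T: "?T x \<in> carrier g \<and> \<pi> (?T x) = \<pi> x" if "x \<in> carrier g" for x
        using that s \<pi>_closed lin_closed[OF s(1)] by simp
      have "?f ([] @ map ?T xs) = ?f ([] @ xs)"
        using True by (intro eq_mod_I[OF ml van' T]) (auto simp: tuples_iff)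
      moreover have "map ?T xs \<in> tuples (Suc k) g" using True T by (auto simp: tuples_iff)
      ultimately show ?thesis using True map_tuples[OF \<pi>_lin True]
        by (simp add: canonical_incl_def extend_zero_def comp_def)
    qed (use cochain_spaceD(4)[OF \<phi>] in \<open>simp add: canonical_incl_def extensional_def\<close>)
  qed
  then show "\<phi> \<in> canonical_incl g I (Suc k) ` carrier (cochain_space (Suc k) Q Q)" using \<psi> by (metis imageI)
qed

lemma C_wedge_simps [simp]:
  "cx_space (C_wedge g I) k = (CHom k)\<lparr>carrier := Pi_map g I k ` carrier (Cg (Suc k))\<rparr>"
  by (simp add: C_wedge_def)

lemma top_row: "short_exact (shift (C_quot g I)) (shift (C_alg g I)) (C_wedge g I)
        (\<lambda>k. canonical_incl g I (Suc k)) (Pi_map g I)"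
  using canonical_incl_inj Pi_map_surjective Pi_map_kernel
  by (intro short_exactI cochain_map_shift canonical_incl_cochain_map Pi_map_cochain_map)
    (simp_all add: cx_surjective_def)

lemma C_ker_eq: "C_ker g I = sub_cx (C_alg g I)
    (\<lambda>k. a_kernel (cx_space (C_alg g I) k) (cx_space (C_def g I) k) (iota_star g I k))"
proof -
  have "(\<forall>us\<in>tuples p J. \<phi> us = \<zero>\<^bsub>Q\<^esub>) \<longleftrightarrow> iota_star g I p \<phi> = \<zero>\<^bsub>cochain_space p J Q\<^esub>" for p \<phi>
    by (auto simp: iota_star_def cochain_space_simps fun_eq_iff restrict_def)
  then show ?thesis by (simp add: C_ker_def a_kernel_def')
qed

lemma kernel_row: "short_exact (C_ker g I) (C_alg g I) (C_def g I) (\<lambda>k \<phi>. \<phi>) (iota_star g I)"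
  unfolding C_ker_eq by (rule short_exact_kernel[OF iota_star_cochain_map iota_star_surjective])

lemma bottom_row: "short_exact (shift (C_ker g I)) (shift (C_alg g I)) (shift (C_def g I))
        (\<lambda>k \<phi>. \<phi>) (\<lambda>k. iota_star g I (Suc k))"
  using short_exact_shift[OF kernel_row] .

lemma right_square:
  assumes \<phi>: "\<phi> \<in> carrier (Cg (Suc k))"
  shows "res_wedge g I k (Pi_map g I k \<phi>) = iota_star g I (Suc k) \<phi>"
proof -
  have "(-1) ^ (k + 1) \<odot>\<^bsub>Q\<^esub> Pi_map g I k \<phi> (butlast us) (last us) = \<phi> us" if us: "us \<in> tuples (Suc k) J" for us
  proof -
    have ne: "us \<noteq> []" using us by (auto simp: tuples_iff)
    have s: "set us \<subseteq> I" "length us = Suc k" using us by (auto simp: tuples_iff carrier_J)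
    then have "last us \<in> I" using last_in_set[OF ne] by auto
    moreover have "butlast us \<in> tuples k g"
      using s I_carrier by (auto simp: tuples_iff dest: in_set_butlastD)
    ultimately have "Pi_map g I k \<phi> (butlast us) (last us) = (-1) ^ (k + 1) \<odot>\<^bsub>Q\<^esub> \<phi> us"
      using ne by (simp add: Pi_map_def)
    moreover have "\<phi> us \<in> carrier Q"
      using s I_carrier by (intro cochain_spaceD(1)[OF \<phi>]) (auto simp: tuples_iff)
    ultimately show ?thesis
      by (simp add: real_vs_smult_assoc[OF real_vs_Q] real_vs_one[OF real_vs_Q] flip: power_mult_distrib)
  qed
  then show ?thesis by (auto simp: res_wedge_def iota_star_def intro!: restrict_ext)
qed

lemma res_wedge_cochain_map: "cochain_map (C_wedge g I) (shift (C_def g I)) (res_wedge g I)"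
  by (rule cochain_map_factor[OF Pi_map_cochain_map Pi_map_surjective cochain_map_shift[OF iota_star_cochain_map]])
    (simp add: right_square)

lemma res_wedge_surjective: "cx_surjective (C_wedge g I) (shift (C_def g I)) (res_wedge g I)"
  unfolding cx_surjective_def
proof
  fix k
  have "res_wedge g I k ` carrier (cx_space (C_wedge g I) k) = iota_star g I (Suc k) ` carrier (Cg (Suc k))"
    by (auto simp: right_square image_image)
  also have "\<dots> = carrier (cx_space (shift (C_def g I)) k)"
    using iota_star_surjective by (simp add: cx_surjective_def)
  finally show "res_wedge g I k ` carrier (cx_space (C_wedge g I) k) = carrier (cx_space (shift (C_def g I)) k)" .
qed

lemma canonical_incl_kernel:
  assumes "\<psi> \<in> carrier (cochain_space (Suc k) Q Q)"
  shows "canonical_incl g I (Suc k) \<psi> \<in> carrier (cx_space (C_ker g I) (Suc k))"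
proof -
  have c: "canonical_incl g I (Suc k) \<psi> \<in> carrier (Cg (Suc k))"
    using lin_closed[OF cochain_mapD(3)[OF canonical_incl_cochain_map, of "Suc k"]] assms by simp
  have "canonical_incl g I (Suc k) \<psi> us = \<zero>\<^bsub>Q\<^esub>" if us: "us \<in> tuples (Suc k) J" for us
  proof -
    have ne: "us \<noteq> []" and s: "set us \<subseteq> I" "length us = Suc k" using us by (auto simp: tuples_iff carrier_J)
    have "set (butlast us) \<subseteq> carrier g" "last us \<in> I" "length (butlast us) = k"
      using s I_carrier last_in_set[OF ne] by (auto dest: in_set_butlastD)
    from canonical_incl_vanish[OF assms this] show ?thesis using ne by simp
  qed
  then show ?thesis using c by (simp add: C_ker_def)
qed

text \<open>
  The subcomplex carries the operations of the ambient complex, but its additive inverse, being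
  described as an element of the smaller carrier, has to be compared with the ambient one.
\<close>

lemma left_column: "cochain_map (shift (C_quot g I)) (shift (C_ker g I)) (\<lambda>k. canonical_incl g I (Suc k))"
proof -
  have ker: "cochain_complex (C_ker g I)" using kernel_row cochain_mapD(1) by (auto simp: short_exact_def)
  note c = cochain_map_shift[OF canonical_incl_cochain_map]
  have sub: "lin_subspace (carrier (cx_space (C_ker g I) k)) (Cg k)" for k
    unfolding C_ker_eq
    using lin_kernel_subspace[OF cochain_complexD(1)[OF cochain_complexes(1)] cochain_complexD(1)[OF cochain_complexes(3)]
      cochain_mapD(3)[OF iota_star_cochain_map]] by simp
  have sp: "cx_space (C_ker g I) k = (Cg k)\<lparr>carrier := carrier (cx_space (C_ker g I) k)\<rparr>" for k
    by (simp add: C_ker_def)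
  have df: "cx_diff (C_ker g I) k = cx_diff (C_alg g I) k" for k by (simp add: C_ker_def)
  show ?thesis
  proof (rule cochain_mapI)
    show "cochain_complex (shift (C_quot g I))" by (rule cochain_mapD(1)[OF c])
    show "cochain_complex (shift (C_ker g I))" by (rule cochain_complex_shift[OF ker])
    show "canonical_incl g I (Suc k) \<in> lin (cx_space (shift (C_quot g I)) k) (cx_space (shift (C_ker g I)) k)" for k
    proof (rule linI)
      show "canonical_incl g I (Suc k) x \<in> carrier (cx_space (shift (C_ker g I)) k)"
        if "x \<in> carrier (cx_space (shift (C_quot g I)) k)" for x
        using canonical_incl_kernel that by simp
    qed (use lin_add[OF cochain_mapD(3)[OF c]] lin_smult[OF cochain_mapD(3)[OF c]] in \<open>simp_all add: C_ker_def\<close>)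
    fix k \<phi> assume \<phi>: "\<phi> \<in> carrier (cx_space (shift (C_quot g I)) k)"
    have m: "cx_diff (C_ker g I) (Suc k) (canonical_incl g I (Suc k) \<phi>) \<in> carrier (cx_space (C_ker g I) (Suc (Suc k)))"
      using \<phi> by (intro lin_closed[OF cochain_complexD(2)[OF ker]] canonical_incl_kernel) simp
    have "canonical_incl g I (Suc (Suc k)) (cx_diff (shift (C_quot g I)) k \<phi>) =
        \<ominus>\<^bsub>Cg (Suc (Suc k))\<^esub> cx_diff (C_alg g I) (Suc k) (canonical_incl g I (Suc k) \<phi>)"
      using cochain_mapD(4)[OF c \<phi>] by simp
    also have "\<dots> = \<ominus>\<^bsub>cx_space (C_ker g I) (Suc (Suc k))\<^esub> cx_diff (C_ker g I) (Suc k) (canonical_incl g I (Suc k) \<phi>)"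
      unfolding df[symmetric] by (subst sp, rule subspace_neg_eq[OF sub m, symmetric])
    finally show "canonical_incl g I (Suc (Suc k)) (cx_diff (shift (C_quot g I)) k \<phi>) =
        cx_diff (shift (C_ker g I)) k (canonical_incl g I (Suc k) \<phi>)" by simp
  qed
qed

section \<open>Cohomology in degree zero\<close>

text \<open>
  The shifted complex has no coboundaries in degree zero, whereas the definition in degree one
  divides by the differentials of elements of \<open>g/i\<close>; these vanish with the Bott representation. The
  sign of the shifted differential does not affect cocycles.
\<close>

lemma shift_cohomology_0: "cohomology (shift (C_def g I)) 0 = cohomology (C_def g I) 1"
proof -
  have "ce_diff J Q (bott g I) 0 \<phi> = \<zero>\<^bsub>cochain_space 1 J Q\<^esub>" if "\<phi> \<in> carrier (cochain_space 0 J Q)" for \<phi>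
  proof -
    have "def.D (extend_zero 0 J Q \<phi>) us = \<zero>\<^bsub>Q\<^esub>" if us: "us \<in> tuples (Suc 0) J" for us
    proof -
      obtain u where u: "us = [u]" "u \<in> I" using us by (auto simp: tuples_iff carrier_J length_Suc_conv)
      have "extend_zero 0 J Q \<phi> [] \<in> carrier Q"
        using multilinear_closed[OF multilinear_extend_zero[OF real_vs_Q real_vs_J \<open>\<phi> \<in> carrier (cochain_space 0 J Q)\<close>], of "[]"]
        by simp
      then show ?thesis using u
        by (simp add: bott_eq bracket_Q_I real_vs_minus_self[OF real_vs_Q real_vs_zero_closed[OF real_vs_Q]])
    qed
    then show ?thesis
      unfolding def.ce_diff_eq_restrict[OF that] cochain_space_simps One_nat_def by (intro restrict_ext)
  qed
  moreover have "carrier (cochain_space 0 J Q) \<noteq> {}"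
    using real_vs_zero_closed[OF cochain_space_real_vs[OF real_vs_Q real_vs_J]] by auto
  ultimately have "ce_diff J Q (bott g I) 0 ` carrier (cochain_space 0 J Q) = {\<zero>\<^bsub>cochain_space 1 J Q\<^esub>}"
    by (auto simp: image_iff)
  then have B: "coboundaries (C_def g I) 1 = coboundaries (shift (C_def g I)) 0"
    by (simp add: C_def_def ce_cx_def)
  have "cocycles (shift (C_def g I)) 0 = cocycles (C_def g I) 1"
  proof -
    note vs = cochain_complexD(1)[OF cochain_complexes(3)] and d = cochain_complexD(2)[OF cochain_complexes(3)]
    interpret V: vectorspace real_ring "cx_space (C_def g I) (Suc (Suc 0))" by (rule vs)
    have "\<ominus>\<^bsub>cx_space (C_def g I) (Suc (Suc 0))\<^esub> z = \<zero>\<^bsub>cx_space (C_def g I) (Suc (Suc 0))\<^esub> \<longleftrightarrow>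
        z = \<zero>\<^bsub>cx_space (C_def g I) (Suc (Suc 0))\<^esub>" if "z \<in> carrier (cx_space (C_def g I) (Suc (Suc 0)))" for z
      using V.M.minus_minus[OF that] real_vs_neg_zero[OF vs, of "Suc (Suc 0)"] by metis
    then show ?thesis using lin_closed[OF d, of _ "Suc 0"] by (auto simp: cocycles_eq)
  qed
  then show ?thesis using B by (simp add: cohomology_def del: coboundaries.simps)
qed

lemma res_wedge_0_inj: "inj_on (res_wedge g I 0) (carrier (cx_space (C_wedge g I) 0))"
proof (rule inj_onI)
  fix \<alpha> \<beta> assume "\<alpha> \<in> carrier (cx_space (C_wedge g I) 0)" "\<beta> \<in> carrier (cx_space (C_wedge g I) 0)"
    and eq: "res_wedge g I 0 \<alpha> = res_wedge g I 0 \<beta>"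
  then obtain \<phi> \<psi> where \<phi>: "\<phi> \<in> carrier (Cg 1)" "\<alpha> = Pi_map g I 0 \<phi>"
    and \<psi>: "\<psi> \<in> carrier (Cg 1)" "\<beta> = Pi_map g I 0 \<psi>" by auto
  have restr: "iota_star g I 1 \<phi> = iota_star g I 1 \<psi>"
    using eq right_square[of _ 0] \<phi> \<psi> by simp
  have "\<phi> [u] = \<psi> [u]" if "u \<in> I" for u
    using that fun_cong[OF restr, of "[u]"]
    by (simp add: iota_star_def tuples_iff carrier_J)
  then show "\<alpha> = \<beta>" unfolding \<phi>(2) \<psi>(2) by (auto simp: Pi_map_def fun_eq_iff tuples_iff restrict_def)
qed

section \<open>The dual of the quotient\<close>

lemma real_line_simps: "carrier real_line = UNIV" "add real_line = (+)" "smult real_line = (*)" "zero real_line = 0"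
  by (simp_all add: real_line_def)

text \<open>
  A functional that vanishes on the ideal is recovered from its composition with a linear section of
  the projection.
\<close>

lemma dual_proj_bij: "bij_betw (dual_proj g I) (carrier (dual Q)) (annihilator g I)"
proof (rule bij_betw_imageI)
  show "inj_on (dual_proj g I) (carrier (dual Q))"
  proof (rule inj_onI)
    fix \<alpha> \<beta> assume ab: "\<alpha> \<in> carrier (dual Q)" "\<beta> \<in> carrier (dual Q)" and eq: "dual_proj g I \<alpha> = dual_proj g I \<beta>"
    have "\<alpha> X = \<beta> X" if X: "X \<in> carrier Q" for X
    proof -
      obtain x where "x \<in> carrier g" "X = \<pi> x" using X by (rule Q_cases)
      then show ?thesis using fun_cong[OF eq, of x] by (simp add: dual_proj_def)
    qed
    then show "\<alpha> = \<beta>" using ab by (auto simp: hom_space_simps intro: extensionalityI)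
  qed
  obtain s where s: "s \<in> lin Q g" "\<And>X. X \<in> carrier Q \<Longrightarrow> \<pi> (s X) = X" using section_lin by blast
  show "dual_proj g I ` carrier (dual Q) = annihilator g I"
  proof (intro equalityI subsetI)
    fix \<beta> assume "\<beta> \<in> dual_proj g I ` carrier (dual Q)"
    then obtain \<alpha> where \<alpha>: "\<alpha> \<in> lin Q real_line" "\<beta> = dual_proj g I \<alpha>" by (auto simp: hom_space_simps)
    have "\<alpha> \<zero>\<^bsub>Q\<^esub> = 0"
      using lin_smult[OF \<alpha>(1) real_vs_zero_closed[OF real_vs_Q], of 0]
      by (simp add: real_vs_smult_zero[OF real_vs_Q] real_line_simps)
    moreover have "(\<lambda>x. \<alpha> (\<pi> x)) \<in> lin g real_line" by (rule lin_compose[OF \<pi>_lin \<alpha>(1)])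
    ultimately show "\<beta> \<in> annihilator g I"
      using hom_spaceI[OF real_vs_g] I_carrier
      by (auto simp: annihilator_def \<alpha>(2) dual_proj_def \<pi>_I)
  next
    fix \<beta> assume "\<beta> \<in> annihilator g I"
    then have \<beta>: "\<beta> \<in> lin g real_line" "\<beta> \<in> extensional (carrier g)" "\<And>u. u \<in> I \<Longrightarrow> \<beta> u = 0"
      by (auto simp: annihilator_def hom_space_simps)
    let ?\<alpha> = "\<lambda>X\<in>carrier Q. \<beta> (s X)"
    have "dual_proj g I ?\<alpha> = \<beta>"
    proof (rule extensionalityI[OF _ \<beta>(2)])
      show "dual_proj g I ?\<alpha> \<in> extensional (carrier g)" by (simp add: dual_proj_def)
      show "dual_proj g I ?\<alpha> x = \<beta> x" if x: "x \<in> carrier g" for x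
      proof -
        have sx: "s (\<pi> x) \<in> carrier g" using lin_closed[OF s(1)] \<pi>_closed x by simp
        have "s (\<pi> x) \<ominus>\<^bsub>g\<^esub> x \<in> I" using \<pi>_eq_iff[OF sx x] s(2)[OF \<pi>_closed[OF x]] by simp
        moreover have "s (\<pi> x) = (s (\<pi> x) \<ominus>\<^bsub>g\<^esub> x) \<oplus>\<^bsub>g\<^esub> x"
          using sx x by (simp add: a_minus_def g.M.a_assoc g.M.l_neg)
        ultimately have "\<beta> (s (\<pi> x)) = \<beta> x"
          using lin_add[OF \<beta>(1), of "s (\<pi> x) \<ominus>\<^bsub>g\<^esub> x" x] \<beta>(3) x I_carrier by (simp add: real_line_simps)
        then show ?thesis using x \<pi>_closed by (simp add: dual_proj_def)
      qed
    qed
    moreover have "?\<alpha> \<in> carrier (dual Q)" by (intro hom_spaceI real_vs_Q lin_compose[OF s(1) \<beta>(1)])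
    ultimately show "\<beta> \<in> dual_proj g I ` carrier (dual Q)" by (metis imageI)
  qed
qed

lemma canonical_incl_wedge:
  "canonical_incl g I (length \<alpha>s) (wedge Q Q \<alpha>s v) = wedge g Q (map (dual_proj g I) \<alpha>s) v"
proof
  fix xs
  show "canonical_incl g I (length \<alpha>s) (wedge Q Q \<alpha>s v) xs = wedge g Q (map (dual_proj g I) \<alpha>s) v xs"
  proof (cases "xs \<in> tuples (length \<alpha>s) g")
    case True
    have *: "(\<Prod>j<length \<alpha>s. (\<alpha>s ! j) (map \<pi> xs ! \<sigma> j)) = (\<Prod>j<length \<alpha>s. (map (dual_proj g I) \<alpha>s ! j) (xs ! \<sigma> j))"
      if \<sigma>: "\<sigma> permutes {..<length \<alpha>s}" for \<sigma>
    proof (rule prod.cong)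
      fix j assume "j \<in> {..<length \<alpha>s}"
      moreover from this have "\<sigma> j < length \<alpha>s" using permutes_in_image[OF \<sigma>, of j] by simp
      ultimately show "(\<alpha>s ! j) (map \<pi> xs ! \<sigma> j) = (map (dual_proj g I) \<alpha>s ! j) (xs ! \<sigma> j)"
        using True nth_in[of xs "carrier g" "\<sigma> j"] by (simp add: tuples_iff dual_proj_def)
    qed simp
    have "map \<pi> xs \<in> tuples (length \<alpha>s) Q" by (rule map_tuples[OF \<pi>_lin True])
    moreover have "(\<Sum>\<sigma> | \<sigma> permutes {..<length \<alpha>s}. of_int (sign \<sigma>) * (\<Prod>j<length \<alpha>s. (\<alpha>s ! j) (map \<pi> xs ! \<sigma> j))) =
        (\<Sum>\<sigma> | \<sigma> permutes {..<length \<alpha>s}. of_int (sign \<sigma>) *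
          (\<Prod>j<length \<alpha>s. (map (dual_proj g I) \<alpha>s ! j) (xs ! \<sigma> j)) :: real)"
      using * by (intro sum.cong refl) (simp only: mem_Collect_eq)
    ultimately show ?thesis using True by (simp only: canonical_incl_def wedge_def length_map restrict_apply')
  qed (simp add: canonical_incl_def wedge_def)
qed

end

theorem proposition4p10:
  fixes g :: "'a lie_alg" and I :: "'a set"
  assumes lie: "real_lie_algebra g"
    and fd: "vectorspace.fin_dim real_ring g"
    and ideal: "lie_ideal I g"
  shows
    \<comment> \<open>the restriction is a cochain map\<close>
    "cochain_map (C_wedge g I) (shift (C_def g I)) (res_wedge g I)
     \<and> \<comment> \<open>it induces an injective map into the first deformation cohomology of the ideal\<close>
     (cohomology (shift (C_def g I)) 0 = cohomology (C_def g I) 1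
      \<and> linear_map real_ring (cohomology (C_wedge g I) 0) (cohomology (C_def g I) 1)
          (cohomology_map (shift (C_def g I)) (res_wedge g I) 0)
      \<and> inj_on (cohomology_map (shift (C_def g I)) (res_wedge g I) 0)
          (carrier (cohomology (C_wedge g I) 0)))
     \<and> \<comment> \<open>rows\<close>
     (short_exact (shift (C_quot g I)) (shift (C_alg g I)) (C_wedge g I)
        (\<lambda>k. canonical_incl g I (Suc k)) (Pi_map g I)
      \<and> short_exact (shift (C_ker g I)) (shift (C_alg g I)) (shift (C_def g I))
        (\<lambda>k \<phi>. \<phi>) (\<lambda>k. iota_star g I (Suc k)))
     \<and> \<comment> \<open>columns\<close>
     (cochain_map (shift (C_quot g I)) (shift (C_ker g I)) (\<lambda>k. canonical_incl g I (Suc k))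
      \<and> cx_injective (shift (C_quot g I)) (\<lambda>k. canonical_incl g I (Suc k))
      \<and> cx_surjective (C_wedge g I) (shift (C_def g I)) (res_wedge g I))
     \<and> \<comment> \<open>commutativity of the left and of the right square\<close>
     ((\<forall>k. \<forall>\<phi>\<in>carrier (cx_space (shift (C_quot g I)) k).
         id (canonical_incl g I (Suc k) \<phi>) = (\<lambda>\<psi>. \<psi>) (canonical_incl g I (Suc k) \<phi>))
      \<and> (\<forall>k. \<forall>\<phi>\<in>carrier (cx_space (shift (C_alg g I)) k).
         res_wedge g I k (Pi_map g I k \<phi>) = iota_star g I (Suc k) (id \<phi>)))
     \<and> \<comment> \<open>the left maps are the canonical inclusion given by the dual of the quotient being
          the annihilator of the ideal\<close>
     (bij_betw (dual_proj g I) (carrier (dual (quot_lie g I))) (annihilator g I)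
      \<and> (\<forall>\<alpha>s. \<forall>v\<in>carrier (quot_lie g I). set \<alpha>s \<subseteq> carrier (dual (quot_lie g I)) \<longrightarrow>
         canonical_incl g I (length \<alpha>s) (wedge (quot_lie g I) (quot_lie g I) \<alpha>s v)
           = wedge g (quot_lie g I) (map (dual_proj g I) \<alpha>s) v))"
proof -
  interpret lie_algebra_ideal g I
    by (intro lie_algebra_ideal.intro lie lie_algebra_ideal_axioms.intro ideal)
  have "linear_map real_ring (cohomology (C_wedge g I) 0) (cohomology (C_def g I) 1)
      (cohomology_map (shift (C_def g I)) (res_wedge g I) 0)"
    using cohomology_map_linear(1)[OF res_wedge_cochain_map, of 0] by (simp only: shift_cohomology_0)
  moreover have "inj_on (cohomology_map (shift (C_def g I)) (res_wedge g I) 0) (carrier (cohomology (C_wedge g I) 0))"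
    by (rule zeroth_cohomology_map_inj[OF res_wedge_cochain_map res_wedge_0_inj])
  moreover have "cx_injective (shift (C_quot g I)) (\<lambda>k. canonical_incl g I (Suc k))"
    using top_row by (simp add: short_exact_def)
  ultimately show ?thesis
    by (intro conjI allI ballI impI res_wedge_cochain_map shift_cohomology_0 top_row bottom_row left_column
        res_wedge_surjective dual_proj_bij canonical_incl_wedge) (simp_all add: right_square)
qed

end
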